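(* Let $S$ be a countable $E$-unitary inverse semigroup with idempotent set $E=E(S)$ and maximal group image $G=G(S)$. Then $C^*_r(S)\cong C^*(E)\rtimes_r G$, where $\rtimes_r$ is the reduced partial crossed product for the partial action of $G$ on $C^*(E)\cong C_0(\widehat E)$ induced by the partial action $\theta$ of $G$ on $\widehat E$ described in the context.
   Context: An inverse semigroup is a semigroup $S$ in which each $s$ has a unique $s^*$ with $s=ss^*s$ and $s^*=s^*ss^*$. $E(S)$ is its commutative subsemigroup of idempotents (a meet semilattice); the natural partial order is $s\le t$ iff $s=te$ for some $e\in E(S)$. The maximal group image $G(S)$ is the quotient of $S$ by the congruence $s\sim t$ iff $se=te$ for some $e\in E(S)$; $\sigma\colon S\to G(S)$ is the quotient map. $S$ is $E$-unitary if $\sigma^{-1}(1)=E(S)$. $C^*_r(S)$ is the $C^*$-subalgebra of $B(\ell^2(S))$ generated by the operators $\Lambda_s$, where $\Lambda_s\delta_t=\delta_{st}$ if $s^*st=t$ and $\Lambda_s\delta_t=0$ otherwise. $C^*(E)$ is the universal $C^*$-algebra for $*$-representations of the semilattice $E$. $\widehat E$ is the space of non-zero semilattice homomorphisms $\varphi\colon E\to\{0,1\}$, topologized as a subspace of $\{0,1\}^E$; $C^*(E)\cong C_0(\widehat E)$. For $e\in E$, $D(e)=\{\varphi\in\widehat E\mid \varphi(e)=1\}$. $S$ acts on $\widehat E$ by the homeomorphisms $\beta_s\colon D(s^*s)\to D(ss^* )$, $\beta_s(\varphi)(e)=\varphi(s^*es)$. For a locally compact Hausdorff space $X$, $I_X$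 is the inverse monoid of homeomorphisms between open subsets of $X$. A partial action of a discrete group $G$ on $X$ is a map $\theta\colon G\to I_X$ with $\theta(1)=1_X$, $\theta(g^{-1})=\theta(g)^{-1}$, and $\theta(g)\theta(h)$ a restriction of $\theta(gh)$; the domain of $\theta(g)$ is written $X_{g^{-1}}$. For $S$ $E$-unitary, the partial action of $G$ on $\widehat E$ is $\theta(g)=\bigcup_{s\in\sigma^{-1}(g)}\beta_s$ (union of partial maps viewed as relations), with domain $\bigcup_{s\in\sigma^{-1}(g)}D(s^*s)$. Reduced partial crossed product $C_0(X)\rtimes_r G$: let $A=C_0(X)$, $A_g=C_0(X_g)$, $\alpha_g\colon A_{g^{-1}}\to A_g$, $\alpha_g(f)(x)=f(\theta(g)^{-1}x)$. On finite sums $\sum_g a_g\delta_g$ with $a_g\in A_g$ put $(a\delta_g)(b\delta_h)=\alpha_g(\alpha_{g^{-1}}(a)b)\delta_{gh}$ and $(a\delta_g)^*=\alpha_{g^{-1}}(a^* )\delta_{g^{-1}}$. Take a faithful representation $\pi\colon A\to B(H)$; for $h\in G$ let $\pi_h\colon A\to B(H)$ be the extension of $\pi\circ\alpha_{h^{-1}}\colon A_h\to B(H)$ to $A$ given by $\pi_h(a)=\text{strong-}\lim_\lambda \pi(\alpha_{h^{-1}}(a e_\lambda))$ with $(e_\lambda)$ an approximate unit of $A_h$. Then $A\rtimes_r G$ is the norm closure of the image of the representation on $\ell^2(G,H)$ given by $(a\delta_g\cdot\xi)(h)=\pi_h(a)\xi(g^{-1}h)$; it is independent of the choice of faithful $\pi$.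 *)

theory Defs
  imports "HOL-Analysis.Analysis" "HOL-Library.Countable"
begin

section \<open>Inverse semigroups\<close>

class inverse_semigroup = semigroup_mult +
  assumes ex1_star: "\<exists>!t. s = s * t * s \<and> t = t * s * t"

definition star :: "'s::inverse_semigroup \<Rightarrow> 's" where
  "star s = (THE t. s = s * t * s \<and> t = t * s * t)"

definition idempotents :: "'s::inverse_semigroup set" where
  "idempotents = {e. e * e = e}"

lemma star_props:
  fixes s :: "'s::inverse_semigroup"
  shows "s * star s * s = s" "star s * s * star s = star s"
  using theI'[OF ex1_star[of s]] unfolding star_def by auto

lemma star_unique:
  fixes s :: "'s::inverse_semigroup"
  shows "s * t * s = s \<Longrightarrow> t * s * t = t \<Longrightarrow> star s = t"
  using ex1_star[of s] star_props[of s] by metis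

lemma star_star [simp]: "star (star s) = (s::'s::inverse_semigroup)"
  by (rule star_unique) (simp_all add: star_props)

lemma star_idem: "e * e = e \<Longrightarrow> star e = (e::'s::inverse_semigroup)"
  by (rule star_unique) simp_all

lemma idem_mult_idem:
  fixes e f :: "'s::inverse_semigroup"
  assumes e: "e * e = e" and f: "f * f = f"
  shows "(e * f) * (e * f) = e * f"
proof -
  define x where "x = star (e * f)"
  have 1: "(e * f) * x * (e * f) = e * f" and 2: "x * (e * f) * x = x"
    unfolding x_def by (rule star_props)+
  have e': "e * (e * z) = e * z" and f': "f * (f * z) = f * z" for z
    using e f by (metis mult.assoc)+
  have "star (e * f) = f * x * e"
  proof (rule star_unique)
    show "e * f * (f * x * e) * (e * f) = e * f"
      using 1 by (simp add: mult.assoc e' f')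
    have "f * x * e * (e * f) * (f * x * e) = f * (x * (e * f) * x) * e"
      by (simp add: mult.assoc e' f')
    then show "f * x * e * (e * f) * (f * x * e) = f * x * e"
      using 2 by simp
  qed
  then have x: "x = f * x * e" by (simp add: x_def)
  have "x * x = (f * x * e) * (f * x * e)" using x by simp
  also have "\<dots> = f * (x * (e * f) * x) * e" by (simp add: mult.assoc)
  also have "\<dots> = x" using 2 x by simp
  finally have xx: "x * x = x" .
  then have "star x = x" by (rule star_idem)
  then have "x = e * f" by (simp add: x_def)
  then show ?thesis using xx by simp
qed

lemma idem_commute:
  fixes e f :: "'s::inverse_semigroup"
  assumes e: "e * e = e" and f: "f * f = f"
  shows "e * f = f * e"
proof -
  have e': "e * (e * z) = e * z" and f': "f * (f * z) = f * z" for z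
    using e f by (metis mult.assoc)+
  have "star (e * f) = f * e"
    by (rule star_unique)
       (use idem_mult_idem[OF e f] idem_mult_idem[OF f e] in \<open>simp_all add: mult.assoc e' f'\<close>)
  moreover have "star (e * f) = e * f"
    by (rule star_idem) (rule idem_mult_idem[OF e f])
  ultimately show ?thesis by simp
qed

lemma star_mult_self_idem:
  "(star s * s) * (star s * s) = star s * (s::'s::inverse_semigroup)"
  "(s * star s) * (s * star s) = s * star (s::'s::inverse_semigroup)"
  by (metis star_props mult.assoc)+

lemma conj_idem_aux:
  fixes e s :: "'s::inverse_semigroup"
  assumes e: "e * e = e"
  shows "(star s * e * s) * (star s * e * s) = star s * e * s"
    and "s * (star s * e * s) = e * s"
proof -
  show *: "s * (star s * e * s) = e * s"
  proof -
    have "s * (star s * e * s) = (s * star s) * e * s" by (simp add: mult.assoc)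
    also have "\<dots> = e * (s * star s * s)"
      using idem_commute[OF star_mult_self_idem(2)[of s] e] by (simp add: mult.assoc)
    finally show ?thesis by (simp add: star_props)
  qed
  have "(star s * e * s) * (star s * e * s) = star s * e * (s * (star s * e * s))"
    by (simp add: mult.assoc)
  also have "\<dots> = star s * (e * e) * s" unfolding * by (simp add: mult.assoc)
  finally show "(star s * e * s) * (star s * e * s) = star s * e * s" by (simp add: e)
qed

lemma star_mult:
  fixes s t :: "'s::inverse_semigroup"
  shows "star (s * t) = star t * star s"
proof (rule star_unique)
  have c: "(t * star t) * (star s * s) = (star s * s) * (t * star t)"
    by (rule idem_commute) (rule star_mult_self_idem)+
  have "s * t * (star t * star s) * (s * t) = s * ((t * star t) * (star s * s)) * t"
    by (simp add: mult.assoc)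
  also have "\<dots> = (s * star s * s) * (t * star t * t)" unfolding c by (simp add: mult.assoc)
  finally show "s * t * (star t * star s) * (s * t) = s * t" by (simp add: star_props)
  have "star t * star s * (s * t) * (star t * star s)
      = star t * ((star s * s) * (t * star t)) * star s"
    by (simp add: mult.assoc)
  also have "\<dots> = (star t * t * star t) * (star s * s * star s)"
    unfolding c[symmetric] by (simp add: mult.assoc)
  finally show "star t * star s * (s * t) * (star t * star s) = star t * star s"
    by (simp add: star_props)
qed

typedef (overloaded) 's idem = "idempotents :: 's::inverse_semigroup set"
  morphisms idem_val Abs_idem
proof -
  have "star undefined * undefined \<in> (idempotents :: 's set)"
    by (simp add: idempotents_def star_mult_self_idem)
  then show ?thesis by blast
qed

setup_lifting type_definition_idem

instantiation idem :: (inverse_semigroup) ab_semigroup_mult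
begin
lift_definition times_idem :: "'a idem \<Rightarrow> 'a idem \<Rightarrow> 'a idem" is "(*)"
  by (simp add: idempotents_def idem_mult_idem)
instance
  by standard (transfer; simp add: idempotents_def mult.assoc idem_commute)+
end

lift_definition dom_idem :: "'s::inverse_semigroup \<Rightarrow> 's idem" is "\<lambda>s. star s * s"
  by (simp add: idempotents_def star_mult_self_idem)

lift_definition conj_idem :: "'s::inverse_semigroup \<Rightarrow> 's idem \<Rightarrow> 's idem"
  is "\<lambda>s e. star s * e * s"
  by (simp add: idempotents_def conj_idem_aux)


section \<open>The maximal group image\<close>

class mult_group = monoid_mult + inverse +
  assumes left_inverse_group: "inverse g * g = 1"
    and divide_group: "g / h = g * inverse h"

definition max_group_rel :: "'s::inverse_semigroup \<Rightarrow> 's \<Rightarrow> bool" where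
  "max_group_rel s t \<longleftrightarrow> (\<exists>e\<in>idempotents. s * e = t * e)"

lemma equivp_max_group_rel: "equivp (max_group_rel :: 's::inverse_semigroup \<Rightarrow> 's \<Rightarrow> bool)"
proof (rule equivpI)
  have "star s * s \<in> idempotents" for s :: 's
    by (simp add: idempotents_def star_mult_self_idem)
  then show "reflp (max_group_rel :: 's \<Rightarrow> 's \<Rightarrow> bool)"
    unfolding reflp_def max_group_rel_def by blast
  show "symp (max_group_rel :: 's \<Rightarrow> 's \<Rightarrow> bool)"
    by (auto simp: symp_def max_group_rel_def) metis
  show "transp (max_group_rel :: 's \<Rightarrow> 's \<Rightarrow> bool)"
    unfolding transp_def
  proof (intro allI impI)
    fix s t u :: 's assume "max_group_rel s t" "max_group_rel t u"
    then obtain e f where e: "e * e = e" "s * e = t * e" and f: "f * f = f" "t * f = u * f"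
      by (auto simp: max_group_rel_def idempotents_def)
    have "s * (e * f) = t * (e * f)" using e by (metis mult.assoc)
    also have "\<dots> = t * f * e" using idem_commute[OF e(1) f(1)] by (simp add: mult.assoc)
    also have "\<dots> = u * (e * f)" unfolding f(2)
      using idem_commute[OF e(1) f(1)] by (simp add: mult.assoc)
    finally show "max_group_rel s u"
      unfolding max_group_rel_def idempotents_def using idem_mult_idem[OF e(1) f(1)] by blast
  qed
qed

quotient_type (overloaded) 's max_group = "'s::inverse_semigroup" / max_group_rel
  by (rule equivp_max_group_rel)

lift_definition max_group_class :: "'s::inverse_semigroup \<Rightarrow> 's max_group" is "\<lambda>s. s" .

lemma max_group_rel_mult_left:
  fixes s t u :: "'s::inverse_semigroup"
  assumes "max_group_rel s t" shows "max_group_rel (u * s) (u * t)"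
  using assms unfolding max_group_rel_def by (metis mult.assoc)

lemma max_group_rel_mult_right:
  fixes s t u :: "'s::inverse_semigroup"
  assumes "max_group_rel s t" shows "max_group_rel (s * u) (t * u)"
proof -
  obtain e where e: "e * e = e" "s * e = t * e"
    using assms by (auto simp: max_group_rel_def idempotents_def)
  have "s * u * (star u * e * u) = s * e * u"
    using conj_idem_aux(2)[OF e(1), of u] by (simp add: mult.assoc)
  moreover have "t * u * (star u * e * u) = t * e * u"
    using conj_idem_aux(2)[OF e(1), of u] by (simp add: mult.assoc)
  ultimately show ?thesis
    unfolding max_group_rel_def idempotents_def using conj_idem_aux(1)[OF e(1), of u] e(2) by auto
qed

lemma max_group_rel_idem:
  fixes e f :: "'s::inverse_semigroup"
  assumes "e * e = e" "f * f = f" shows "max_group_rel e f"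
proof -
  have "e * (e * f) = f * (e * f)"
    using assms idem_commute[OF assms] by (metis mult.assoc)
  then show ?thesis
    unfolding max_group_rel_def idempotents_def using idem_mult_idem[OF assms] by blast
qed

lemma max_group_rel_mult_idem:
  fixes e s :: "'s::inverse_semigroup"
  assumes "e * e = e" shows "max_group_rel (s * e) s"
  using assms by (auto simp: max_group_rel_def idempotents_def mult.assoc intro!: exI[of _ e])

lemma max_group_class_eq_iff: "max_group_class s = max_group_class t \<longleftrightarrow> max_group_rel s t"
  by transfer (rule refl)

lemma max_group_class_surj: "\<exists>s. g = max_group_class s"
  by (induct g) (auto simp: max_group_class.abs_eq)

instantiation max_group :: (inverse_semigroup) "{times, one, inverse}"
begin

lift_definition times_max_group :: "'a max_group \<Rightarrow> 'a max_group \<Rightarrow> 'a max_group" is "(*)"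
  using max_group_rel_mult_left max_group_rel_mult_right equivp_max_group_rel
  by (meson equivp_transp)

lift_definition inverse_max_group :: "'a max_group \<Rightarrow> 'a max_group" is star
proof -
  fix s t :: 'a assume "max_group_rel s t"
  then obtain e where e: "e * e = e" "s * e = t * e"
    by (auto simp: max_group_rel_def idempotents_def)
  have st: "e * star s = e * star t"
    using arg_cong[OF e(2), of star] by (simp add: star_mult star_idem[OF e(1)])
  have "star s * (s * e * star s) = e * star s" "star t * (t * e * star t) = e * star t"
    using conj_idem_aux(2)[OF e(1), of "star s"] conj_idem_aux(2)[OF e(1), of "star t"] by simp_all
  moreover have "s * e * star s = t * e * star t"
    using st e by (metis mult.assoc)
  moreover have "(s * e * star s) * (s * e * star s) = s * e * star s"
    using conj_idem_aux(1)[OF e(1), of "star s"] by simp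
  ultimately show "max_group_rel (star s) (star t)"
    unfolding max_group_rel_def idempotents_def using st by auto
qed

text \<open>The class of an idempotent does not depend on the idempotent.\<close>
definition one_max_group :: "'a max_group" where
  "one_max_group = max_group_class (star undefined * undefined)"

definition divide_max_group :: "'a max_group \<Rightarrow> 'a max_group \<Rightarrow> 'a max_group" where
  "divide_max_group g h = g * inverse h"

instance ..

end

lemma max_group_class_mult: "max_group_class (s * t) = max_group_class s * max_group_class t"
  by transfer (rule equivp_reflp[OF equivp_max_group_rel])

lemma max_group_class_star: "max_group_class (star s) = inverse (max_group_class s)"
  by transfer (rule equivp_reflp[OF equivp_max_group_rel])

lemma max_group_class_idem: "e * e = e \<Longrightarrow> max_group_class e = 1"
  unfolding one_max_group_def max_group_class_eq_iff
  by (rule max_group_rel_idem) (simp_all add: star_mult_self_idem)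

instance max_group :: (inverse_semigroup) mult_group
proof
  fix g h k :: "'a max_group"
  obtain s t u where s: "g = max_group_class s" "h = max_group_class t" "k = max_group_class u"
    using max_group_class_surj by metis
  have one: "1 = max_group_class (star s * s)" "1 = max_group_class (s * star s)"
    by (simp_all add: max_group_class_idem star_mult_self_idem)
  show "g * h * k = g * (h * k)"
    unfolding s max_group_class_mult[symmetric] by (simp add: mult.assoc)
  show "g * 1 = g"
    unfolding one(1) s max_group_class_mult[symmetric] by (simp add: mult.assoc[symmetric] star_props)
  show "1 * g = g"
    unfolding one(2) s max_group_class_mult[symmetric] by (simp add: star_props)
  show "inverse g * g = 1"
    unfolding one(1) s max_group_class_mult max_group_class_star ..
  show "g / h = g * inverse h" by (rule divide_max_group_def)
qed

definition E_unitary :: "'s::inverse_semigroup itself \<Rightarrow> bool" where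
  "E_unitary _ \<longleftrightarrow> (max_group_class :: 's \<Rightarrow> 's max_group) -` {1} = idempotents"


section \<open>Complex Hilbert spaces\<close>

class complex_hilbert = banach +
  fixes scaleC :: "complex \<Rightarrow> 'a \<Rightarrow> 'a"  (infixr "*\<^sub>C" 75)
    and cinner :: "'a \<Rightarrow> 'a \<Rightarrow> complex"
  assumes scaleC_add_right: "c *\<^sub>C (x + y) = c *\<^sub>C x + c *\<^sub>C y"
    and scaleC_add_left: "(c + d) *\<^sub>C x = c *\<^sub>C x + d *\<^sub>C x"
    and scaleC_scaleC: "c *\<^sub>C (d *\<^sub>C x) = (c * d) *\<^sub>C x"
    and scaleC_of_real: "complex_of_real r *\<^sub>C x = r *\<^sub>R x"
    and cinner_commute: "cinner x y = cnj (cinner y x)"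
    and cinner_add_left: "cinner (x + y) z = cinner x z + cinner y z"
    and cinner_scaleC_left: "cinner (c *\<^sub>C x) y = c * cinner x y"
    and cinner_self: "cinner x x = complex_of_real ((norm x)\<^sup>2)"

lemma cinner_add_right:
  "cinner x (y + z) = cinner x y + cinner x (z :: 'a::complex_hilbert)"
  by (metis cinner_add_left cinner_commute complex_cnj_add)

lemma cinner_scaleC_right:
  "cinner x (c *\<^sub>C y) = cnj c * cinner x (y :: 'a::complex_hilbert)"
  by (metis cinner_scaleC_left cinner_commute complex_cnj_mult)

lemma norm_scaleC: "norm (c *\<^sub>C x) = cmod c * norm (x :: 'a::complex_hilbert)"
proof -
  have "complex_of_real ((norm (c *\<^sub>C x))\<^sup>2) = (c * cnj c) * complex_of_real ((norm x)\<^sup>2)"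
    unfolding cinner_self[symmetric] cinner_scaleC_left cinner_scaleC_right by (simp only: mult_ac)
  also have "\<dots> = complex_of_real ((cmod c * norm x)\<^sup>2)"
    unfolding complex_norm_square[symmetric] by (simp only: of_real_mult power_mult_distrib)
  finally have "complex_of_real ((norm (c *\<^sub>C x))\<^sup>2) = complex_of_real ((cmod c * norm x)\<^sup>2)" .
  then have "(norm (c *\<^sub>C x))\<^sup>2 = (cmod c * norm x)\<^sup>2"
    using of_real_eq_iff by blast
  then show ?thesis by simp
qed

lemma cinner_bound: "cmod (cinner x y) \<le> norm x * norm (y :: 'a::complex_hilbert)"
proof (cases "cinner x y = 0")
  case False
  define c where "c = cinner x y / complex_of_real (cmod (cinner x y))"
  have c: "cmod c = 1" using False by (simp add: c_def norm_divide)
  have "cnj (cinner x y) * cinner x y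
      = complex_of_real (cmod (cinner x y)) * complex_of_real (cmod (cinner x y))"
    by (metis complex_norm_square mult.commute of_real_mult power2_eq_square)
  then have cc: "cnj c * cinner x y = complex_of_real (cmod (cinner x y))"
    using False by (simp add: c_def)
  let ?y = "c *\<^sub>C y"
  have xy: "cinner x ?y = complex_of_real (cmod (cinner x y))"
    by (simp add: cinner_scaleC_right cc)
  have yx: "cinner ?y x = complex_of_real (cmod (cinner x y))"
    by (subst cinner_commute) (simp add: xy)
  have "complex_of_real ((norm (x + ?y))\<^sup>2)
      = complex_of_real ((norm x)\<^sup>2 + 2 * cmod (cinner x y) + (norm ?y)\<^sup>2)"
    unfolding cinner_self[symmetric] cinner_add_left cinner_add_right xy yx
    by (simp add: cinner_self)
  then have "(norm (x + ?y))\<^sup>2 = (norm x)\<^sup>2 + 2 * cmod (cinner x y) + (norm ?y)\<^sup>2"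
    using of_real_eq_iff by blast
  moreover have "(norm (x + ?y))\<^sup>2 \<le> (norm x + norm ?y)\<^sup>2"
    by (intro power_mono norm_triangle_ineq) simp
  ultimately show ?thesis by (simp add: norm_scaleC c power2_sum)
qed simp

instantiation complex :: complex_hilbert
begin
definition scaleC_complex :: "complex \<Rightarrow> complex \<Rightarrow> complex" where "scaleC_complex c z = c * z"
definition cinner_complex :: "complex \<Rightarrow> complex \<Rightarrow> complex" where "cinner_complex z w = z * cnj w"
instance
proof
  fix x y z c d :: complex and r :: real
  show "cinner x x = complex_of_real ((norm x)\<^sup>2)"
    unfolding cinner_complex_def by (rule complex_norm_square[symmetric])
qed (simp_all add: scaleC_complex_def cinner_complex_def ring_distribs scaleR_conv_of_real)
end


subsection \<open>The Hilbert space of square-summable families in a Hilbert space\<close>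

definition square_summable :: "('i \<Rightarrow> 'h::real_normed_vector) \<Rightarrow> bool" where
  "square_summable f \<longleftrightarrow> (\<lambda>i. (norm (f i))\<^sup>2) summable_on UNIV"

lemma square_summableI:
  fixes f :: "'i \<Rightarrow> 'h::real_normed_vector"
  assumes "\<And>F. finite F \<Longrightarrow> L2_set (\<lambda>i. norm (f i)) F \<le> B"
  shows "square_summable f" "sqrt (\<Sum>\<^sub>\<infinity>i. (norm (f i))\<^sup>2) \<le> B"
proof -
  have B: "0 \<le> B" using assms[of "{}"] by simp
  have le: "(\<Sum>i\<in>F. (norm (f i))\<^sup>2) \<le> B\<^sup>2" if "finite F" for F
  proof -
    have "(L2_set (\<lambda>i. norm (f i)) F)\<^sup>2 \<le> B\<^sup>2"
      using assms[OF that] by (intro power_mono L2_set_nonneg)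
    then show ?thesis by (simp add: L2_set_def sum_nonneg)
  qed
  show s: "square_summable f"
    unfolding square_summable_def
    by (rule nonneg_bdd_above_summable_on) (auto intro!: bdd_aboveI[of _ "B\<^sup>2"] le)
  have "(\<Sum>\<^sub>\<infinity>i. (norm (f i))\<^sup>2) \<le> B\<^sup>2"
    by (rule infsum_le_finite_sums) (use s le in \<open>auto simp: square_summable_def\<close>)
  then show "sqrt (\<Sum>\<^sub>\<infinity>i. (norm (f i))\<^sup>2) \<le> B"
    using B by (simp add: real_le_lsqrt infsum_nonneg)
qed

lemma L2_set_le_infsum:
  fixes f :: "'i \<Rightarrow> 'h::real_normed_vector"
  assumes "square_summable f" "finite F"
  shows "L2_set (\<lambda>i. norm (f i)) F \<le> sqrt (\<Sum>\<^sub>\<infinity>i. (norm (f i))\<^sup>2)"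
  unfolding L2_set_def
  by (rule real_sqrt_le_mono) (use assms in \<open>auto intro!: finite_sum_le_infsum simp: square_summable_def\<close>)

lemma square_summable_add:
  fixes f g :: "'i \<Rightarrow> 'h::real_normed_vector"
  assumes f: "square_summable f" and g: "square_summable g"
  shows "square_summable (\<lambda>i. f i + g i)"
    and "sqrt (\<Sum>\<^sub>\<infinity>i. (norm (f i + g i))\<^sup>2)
      \<le> sqrt (\<Sum>\<^sub>\<infinity>i. (norm (f i))\<^sup>2) + sqrt (\<Sum>\<^sub>\<infinity>i. (norm (g i))\<^sup>2)"
proof -
  have *: "L2_set (\<lambda>i. norm (f i + g i)) F
      \<le> sqrt (\<Sum>\<^sub>\<infinity>i. (norm (f i))\<^sup>2) + sqrt (\<Sum>\<^sub>\<infinity>i. (norm (g i))\<^sup>2)" if "finite F" for F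
  proof -
    have "L2_set (\<lambda>i. norm (f i + g i)) F \<le> L2_set (\<lambda>i. norm (f i) + norm (g i)) F"
      by (intro L2_set_mono norm_triangle_ineq) auto
    also have "\<dots> \<le> L2_set (\<lambda>i. norm (f i)) F + L2_set (\<lambda>i. norm (g i)) F"
      by (rule L2_set_triangle_ineq)
    also have "\<dots> \<le> sqrt (\<Sum>\<^sub>\<infinity>i. (norm (f i))\<^sup>2) + sqrt (\<Sum>\<^sub>\<infinity>i. (norm (g i))\<^sup>2)"
      by (intro add_mono L2_set_le_infsum f g that)
    finally show ?thesis .
  qed
  show "square_summable (\<lambda>i. f i + g i)"
    "sqrt (\<Sum>\<^sub>\<infinity>i. (norm (f i + g i))\<^sup>2)
      \<le> sqrt (\<Sum>\<^sub>\<infinity>i. (norm (f i))\<^sup>2) + sqrt (\<Sum>\<^sub>\<infinity>i. (norm (g i))\<^sup>2)"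
    using square_summableI[OF *] by auto
qed

lemma square_summable_scale:
  fixes f :: "'i \<Rightarrow> 'h::real_normed_vector" and g :: "'i \<Rightarrow> 'k::real_normed_vector"
  assumes "square_summable f" "\<And>i. norm (g i) = c * norm (f i)"
  shows "square_summable g"
  using assms unfolding square_summable_def
  by (simp add: power_mult_distrib summable_on_cmult_right)

typedef (overloaded) ('i, 'h) ell2 = "{f :: 'i \<Rightarrow> 'h::real_normed_vector. square_summable f}"
  morphisms ell2_fun Abs_ell2
  by (rule exI[of _ "\<lambda>_. 0"]) (simp add: square_summable_def)

setup_lifting type_definition_ell2

lemma square_summable_ell2_fun: "square_summable (ell2_fun x)"
  using ell2_fun[of x] by simp

instantiation ell2 :: (type, real_normed_vector) real_vector
begin

lift_definition zero_ell2 :: "('a, 'b) ell2" is "\<lambda>_. 0" by (simp add: square_summable_def)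
lift_definition uminus_ell2 :: "('a, 'b) ell2 \<Rightarrow> ('a, 'b) ell2" is "\<lambda>f i. - f i"
  by (simp add: square_summable_def)
lift_definition plus_ell2 :: "('a, 'b) ell2 \<Rightarrow> ('a, 'b) ell2 \<Rightarrow> ('a, 'b) ell2" is "\<lambda>f g i. f i + g i"
  by (rule square_summable_add)
lift_definition minus_ell2 :: "('a, 'b) ell2 \<Rightarrow> ('a, 'b) ell2 \<Rightarrow> ('a, 'b) ell2" is "\<lambda>f g i. f i - g i"
proof -
  fix f g :: "'a \<Rightarrow> 'b" assume f: "square_summable f" and g: "square_summable g"
  have "square_summable (\<lambda>i. - g i)" using g by (simp add: square_summable_def)
  from square_summable_add(1)[OF f this] show "square_summable (\<lambda>i. f i - g i)" by simp
qed
lift_definition scaleR_ell2 :: "real \<Rightarrow> ('a, 'b) ell2 \<Rightarrow> ('a, 'b) ell2" is "\<lambda>r f i. r *\<^sub>R f i"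
  by (erule square_summable_scale) (rule norm_scaleR)

instance
proof
  fix x y z :: "('a, 'b) ell2" and r q :: real
  show "x + y + z = x + (y + z)" by transfer (simp add: add.assoc)
  show "x + y = y + x" by transfer (simp add: add.commute)
  show "0 + x = x" by transfer simp
  show "- x + x = 0" by transfer simp
  show "x - y = x + - y" by transfer simp
  show "r *\<^sub>R (x + y) = r *\<^sub>R x + r *\<^sub>R y" by transfer (simp add: scaleR_add_right)
  show "(r + q) *\<^sub>R x = r *\<^sub>R x + q *\<^sub>R x" by transfer (simp add: scaleR_add_left)
  show "r *\<^sub>R q *\<^sub>R x = (r * q) *\<^sub>R x" by transfer simp
  show "1 *\<^sub>R x = x" by transfer simp
qed

end

instantiation ell2 :: (type, real_normed_vector) real_normed_vector
begin

definition norm_ell2 :: "('a, 'b) ell2 \<Rightarrow> real" where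
  "norm_ell2 x = sqrt (\<Sum>\<^sub>\<infinity>i. (norm (ell2_fun x i))\<^sup>2)"

definition sgn_ell2 :: "('a, 'b) ell2 \<Rightarrow> ('a, 'b) ell2" where
  "sgn_ell2 x = x /\<^sub>R norm x"

definition dist_ell2 :: "('a, 'b) ell2 \<Rightarrow> ('a, 'b) ell2 \<Rightarrow> real" where
  "dist_ell2 x y = norm (x - y)"

definition uniformity_ell2 :: "(('a, 'b) ell2 \<times> ('a, 'b) ell2) filter" where
  "uniformity_ell2 = (INF e\<in>{0<..}. principal {(x, y). dist x y < e})"

definition open_ell2 :: "('a, 'b) ell2 set \<Rightarrow> bool" where
  "open_ell2 U \<longleftrightarrow> (\<forall>x\<in>U. \<forall>\<^sub>F (x', y) in uniformity. x' = x \<longrightarrow> y \<in> U)"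

instance
proof
  fix x y :: "('a, 'b) ell2" and r :: real
  show "dist x y = norm (x - y)" by (rule dist_ell2_def)
  show "sgn x = x /\<^sub>R norm x" by (rule sgn_ell2_def)
  show "uniformity = (INF e\<in>{0<..}. principal {(x :: ('a, 'b) ell2, y). dist x y < e})"
    by (rule uniformity_ell2_def)
  show "open U \<longleftrightarrow> (\<forall>x\<in>U. \<forall>\<^sub>F (x', y) in uniformity. x' = x \<longrightarrow> y \<in> U)"
    for U :: "('a, 'b) ell2 set" by (rule open_ell2_def)
  show "norm x = 0 \<longleftrightarrow> x = 0"
  proof
    assume 0: "norm x = 0"
    have "norm (ell2_fun x i) \<le> 0" for i
      using L2_set_le_infsum[OF square_summable_ell2_fun[of x], of "{i}"] 0
      by (simp add: norm_ell2_def)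
    then have "ell2_fun x = (\<lambda>_. 0)" by (simp add: fun_eq_iff)
    then show "x = 0" by (simp only: ell2_fun_inject[symmetric] zero_ell2.rep_eq)
  qed (simp add: norm_ell2_def zero_ell2.rep_eq)
  show "norm (x + y) \<le> norm x + norm y"
    unfolding norm_ell2_def plus_ell2.rep_eq
    by (rule square_summable_add(2)[OF square_summable_ell2_fun square_summable_ell2_fun])
  show "norm (r *\<^sub>R x) = \<bar>r\<bar> * norm x"
    unfolding norm_ell2_def scaleR_ell2.rep_eq
    by (simp add: power_mult_distrib infsum_cmult_right' real_sqrt_mult)
qed

end

lemma L2_set_le_norm_ell2: "finite F \<Longrightarrow> L2_set (\<lambda>i. norm (ell2_fun x i)) F \<le> norm x"
  unfolding norm_ell2_def by (rule L2_set_le_infsum[OF square_summable_ell2_fun])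

lemma norm_ell2_fun_le: "norm (ell2_fun x i) \<le> norm x"
  using L2_set_le_norm_ell2[of "{i}" x] by simp

instance ell2 :: (type, banach) banach
proof
  fix X :: "nat \<Rightarrow> ('a, 'b) ell2"
  assume X: "Cauchy X"
  have "Cauchy (\<lambda>n. ell2_fun (X n) i)" for i
  proof (rule metric_CauchyI)
    fix e :: real assume "0 < e"
    then obtain M where M: "\<And>m n. M \<le> m \<Longrightarrow> M \<le> n \<Longrightarrow> norm (X m - X n) < e"
      using X unfolding Cauchy_iff by blast
    have "dist (ell2_fun (X m) i) (ell2_fun (X n) i) < e" if "M \<le> m" "M \<le> n" for m n
      using norm_ell2_fun_le[of "X m - X n" i] M[OF that]
      by (simp add: dist_norm minus_ell2.rep_eq)
    then show "\<exists>M. \<forall>m\<ge>M. \<forall>n\<ge>M. dist (ell2_fun (X m) i) (ell2_fun (X n) i) < e" by blast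
  qed
  then have "\<forall>i. \<exists>l. (\<lambda>n. ell2_fun (X n) i) \<longlonglongrightarrow> l"
    by (simp add: Cauchy_convergent convergent_def[symmetric])
  then obtain f where f: "\<And>i. (\<lambda>n. ell2_fun (X n) i) \<longlonglongrightarrow> f i" by metis
  have bound: "\<exists>M. \<forall>n\<ge>M. \<forall>F. finite F \<longrightarrow> L2_set (\<lambda>i. norm (ell2_fun (X n) i - f i)) F \<le> e"
    if "0 < e" for e
  proof -
    obtain M where M: "\<And>m n. M \<le> m \<Longrightarrow> M \<le> n \<Longrightarrow> norm (X m - X n) < e"
      using X \<open>0 < e\<close> unfolding Cauchy_iff by blast
    have "L2_set (\<lambda>i. norm (ell2_fun (X n) i - f i)) F \<le> e" if "M \<le> n" "finite F" for n F
    proof (rule tendsto_upperbound)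
      show "(\<lambda>m. L2_set (\<lambda>i. norm (ell2_fun (X n) i - ell2_fun (X m) i)) F)
          \<longlonglongrightarrow> L2_set (\<lambda>i. norm (ell2_fun (X n) i - f i)) F"
        unfolding L2_set_def by (intro tendsto_intros f)
      show "\<forall>\<^sub>F m in sequentially. L2_set (\<lambda>i. norm (ell2_fun (X n) i - ell2_fun (X m) i)) F \<le> e"
        using eventually_ge_at_top[of M]
      proof eventually_elim
        case (elim m)
        have "L2_set (\<lambda>i. norm (ell2_fun (X n - X m) i)) F \<le> norm (X n - X m)"
          by (rule L2_set_le_norm_ell2[OF \<open>finite F\<close>])
        then show ?case using M[OF \<open>M \<le> n\<close> elim] by (simp add: minus_ell2.rep_eq)
      qed
    qed simp
    then show ?thesis by blast
  qed
  obtain M where "\<forall>F. finite F \<longrightarrow> L2_set (\<lambda>i. norm (ell2_fun (X M) i - f i)) F \<le> 1"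
    using bound[of 1] by auto
  then have "square_summable (\<lambda>i. ell2_fun (X M) i - f i)"
    by (intro square_summableI(1)) blast
  then have "square_summable (\<lambda>i. - (ell2_fun (X M) i - f i))"
    by (simp add: square_summable_def norm_minus_commute)
  from square_summable_add(1)[OF square_summable_ell2_fun[of "X M"] this]
  have "square_summable f" by simp
  then have fx: "ell2_fun (Abs_ell2 f) = f" by (simp add: Abs_ell2_inverse)
  have "X \<longlonglongrightarrow> Abs_ell2 f"
  proof (rule metric_LIMSEQ_I)
    fix e :: real assume "0 < e"
    then obtain M where M: "\<forall>n\<ge>M. \<forall>F. finite F \<longrightarrow>
        L2_set (\<lambda>i. norm (ell2_fun (X n) i - f i)) F \<le> e / 2"
      using bound[of "e / 2"] by auto
    have "dist (X n) (Abs_ell2 f) \<le> e / 2" if "M \<le> n" for n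
      unfolding dist_norm norm_ell2_def minus_ell2.rep_eq fx
      by (rule square_summableI(2)) (use M that in blast)
    moreover have "e / 2 < e" using \<open>0 < e\<close> by simp
    ultimately have "dist (X n) (Abs_ell2 f) < e" if "M \<le> n" for n
      using that by (meson le_less_trans)
    then show "\<exists>M. \<forall>n\<ge>M. dist (X n) (Abs_ell2 f) < e" by blast
  qed
  then show "convergent X" by (rule convergentI)
qed

lemma summable_cinner:
  fixes f g :: "'i \<Rightarrow> 'h::complex_hilbert"
  assumes "square_summable f" "square_summable g"
  shows "(\<lambda>i. cinner (f i) (g i)) summable_on UNIV"
proof -
  have "(\<lambda>i. (norm (f i))\<^sup>2 + (norm (g i))\<^sup>2) summable_on UNIV"
    using assms unfolding square_summable_def by (rule summable_on_add)
  then have "(\<lambda>i. norm (cinner (f i) (g i))) summable_on UNIV"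
  proof (rule summable_on_comparison_test)
    fix i
    have "2 * (norm (f i) * norm (g i)) \<le> (norm (f i))\<^sup>2 + (norm (g i))\<^sup>2"
      using sum_squares_bound[of "norm (f i)" "norm (g i)"] by (simp add: mult.assoc)
    moreover have "0 \<le> norm (f i) * norm (g i)" by simp
    ultimately show "norm (cinner (f i) (g i)) \<le> (norm (f i))\<^sup>2 + (norm (g i))\<^sup>2"
      using cinner_bound[of "f i" "g i"] by linarith
  qed simp
  then show ?thesis by (rule abs_summable_summable)
qed

instantiation ell2 :: (type, complex_hilbert) complex_hilbert
begin

lift_definition scaleC_ell2 :: "complex \<Rightarrow> ('a, 'b) ell2 \<Rightarrow> ('a, 'b) ell2" is "\<lambda>c f i. c *\<^sub>C f i"
  by (erule square_summable_scale) (rule norm_scaleC)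

definition cinner_ell2 :: "('a, 'b) ell2 \<Rightarrow> ('a, 'b) ell2 \<Rightarrow> complex" where
  "cinner_ell2 x y = (\<Sum>\<^sub>\<infinity>i. cinner (ell2_fun x i) (ell2_fun y i))"

instance
proof
  fix x y z :: "('a, 'b) ell2" and c d :: complex and r :: real
  show "c *\<^sub>C (x + y) = c *\<^sub>C x + c *\<^sub>C y" by transfer (simp add: scaleC_add_right)
  show "(c + d) *\<^sub>C x = c *\<^sub>C x + d *\<^sub>C x" by transfer (simp add: scaleC_add_left)
  show "c *\<^sub>C d *\<^sub>C x = (c * d) *\<^sub>C x" by transfer (simp add: scaleC_scaleC)
  show "complex_of_real r *\<^sub>C x = r *\<^sub>R x" by transfer (simp add: scaleC_of_real)
  note s = summable_cinner[OF square_summable_ell2_fun square_summable_ell2_fun]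
  show "cinner x y = cnj (cinner y x)"
    unfolding cinner_ell2_def infsum_cnj[symmetric] by (subst cinner_commute) (rule refl)
  show "cinner (x + y) z = cinner x z + cinner y z"
    unfolding cinner_ell2_def plus_ell2.rep_eq cinner_add_left by (rule infsum_add[OF s s])
  show "cinner (c *\<^sub>C x) y = c * cinner x y"
    unfolding cinner_ell2_def scaleC_ell2.rep_eq cinner_scaleC_left by (rule infsum_cmult_right')
  have "cinner x x = complex_of_real (\<Sum>\<^sub>\<infinity>i. (norm (ell2_fun x i))\<^sup>2)"
    unfolding cinner_ell2_def cinner_self
    using square_summable_ell2_fun[of x] unfolding square_summable_def
    by (intro infsumI has_sum_of_real) simp
  then show "cinner x x = complex_of_real ((norm x)\<^sup>2)"
    by (simp add: norm_ell2_def infsum_nonneg)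
qed

end


lift_definition ell2_delta :: "'i \<Rightarrow> ('i, complex) ell2" is "\<lambda>i j. if j = i then 1 else 0"
proof -
  fix i :: 'i
  have "{j. (norm (if j = i then 1 else 0 :: complex))\<^sup>2 \<noteq> 0} \<subseteq> {i}" by auto
  then show "square_summable (\<lambda>j. if j = i then 1 else 0 :: complex)"
    unfolding square_summable_def
    by (intro finite_nonzero_values_imp_summable_on) (auto intro: finite_subset)
qed


section \<open>Star-algebras and concrete C*-algebras\<close>

record 'a star_algebra =
  sa_carrier :: "'a set"
  sa_add :: "'a \<Rightarrow> 'a \<Rightarrow> 'a"
  sa_scale :: "complex \<Rightarrow> 'a \<Rightarrow> 'a"
  sa_mult :: "'a \<Rightarrow> 'a \<Rightarrow> 'a"
  sa_star :: "'a \<Rightarrow> 'a"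

definition star_hom :: "'a star_algebra \<Rightarrow> 'b star_algebra \<Rightarrow> ('a \<Rightarrow> 'b) \<Rightarrow> bool" where
  "star_hom A B \<Phi> \<longleftrightarrow>
     \<Phi> ` sa_carrier A \<subseteq> sa_carrier B \<and>
     (\<forall>a\<in>sa_carrier A. \<forall>b\<in>sa_carrier A. \<Phi> (sa_add A a b) = sa_add B (\<Phi> a) (\<Phi> b)) \<and>
     (\<forall>c. \<forall>a\<in>sa_carrier A. \<Phi> (sa_scale A c a) = sa_scale B c (\<Phi> a)) \<and>
     (\<forall>a\<in>sa_carrier A. \<forall>b\<in>sa_carrier A. \<Phi> (sa_mult A a b) = sa_mult B (\<Phi> a) (\<Phi> b)) \<and>
     (\<forall>a\<in>sa_carrier A. \<Phi> (sa_star A a) = sa_star B (\<Phi> a))"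

definition star_iso :: "'a star_algebra \<Rightarrow> 'b star_algebra \<Rightarrow> ('a \<Rightarrow> 'b) \<Rightarrow> bool" where
  "star_iso A B \<Phi> \<longleftrightarrow> star_hom A B \<Phi> \<and> bij_betw \<Phi> (sa_carrier A) (sa_carrier B)"

definition star_isomorphic :: "'a star_algebra \<Rightarrow> 'b star_algebra \<Rightarrow> bool"  (infix "\<cong>\<^sub>*" 50) where
  "A \<cong>\<^sub>* B \<longleftrightarrow> (\<exists>\<Phi>. star_iso A B \<Phi>)"

text \<open>
  The library type of bounded operators consists of the real-linear ones; \<open>complex_ops\<close>
  below is \<open>B(H)\<close>.
\<close>

type_synonym 'h op = "'h \<Rightarrow>\<^sub>L 'h"

definition complex_ops :: "'h::complex_hilbert op set" where
  "complex_ops = {T. \<forall>c x. blinfun_apply T (c *\<^sub>C x) = c *\<^sub>C blinfun_apply T x}"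

definition scale_op :: "complex \<Rightarrow> 'h::complex_hilbert op \<Rightarrow> 'h op" where
  "scale_op c T = Blinfun (\<lambda>x. c *\<^sub>C blinfun_apply T x)"

definition adj_op :: "'h::complex_hilbert op \<Rightarrow> 'h op" where
  "adj_op T = (THE T'. \<forall>x y. cinner (blinfun_apply T x) y = cinner x (blinfun_apply T' y))"

definition op_algebra :: "'h::complex_hilbert op set \<Rightarrow> 'h op star_algebra" where
  "op_algebra A = \<lparr>sa_carrier = A, sa_add = (+), sa_scale = scale_op,
     sa_mult = (o\<^sub>L), sa_star = adj_op\<rparr>"

definition cstar_subalgebra :: "'h::complex_hilbert op set \<Rightarrow> bool" where
  "cstar_subalgebra A \<longleftrightarrow> A \<subseteq> complex_ops \<and> 0 \<in> A \<and>
     (\<forall>S\<in>A. \<forall>T\<in>A. S + T \<in> A) \<and> (\<forall>c. \<forall>T\<in>A. scale_op c T \<in> A) \<and>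
     (\<forall>S\<in>A. \<forall>T\<in>A. S o\<^sub>L T \<in> A) \<and> (\<forall>T\<in>A. adj_op T \<in> A) \<and> closed A"

definition cstar_generated :: "'h::complex_hilbert op set \<Rightarrow> 'h op set" where
  "cstar_generated B = \<Inter>{A. cstar_subalgebra A \<and> B \<subseteq> A}"

definition faithful_rep :: "'a star_algebra \<Rightarrow> ('a \<Rightarrow> 'h::complex_hilbert op) \<Rightarrow> bool" where
  "faithful_rep A \<pi> \<longleftrightarrow> star_hom A (op_algebra complex_ops) \<pi> \<and> inj_on \<pi> (sa_carrier A)"

text \<open>For an open set \<open>U\<close>, \<open>C_0(U)\<close> is realised as an ideal of the functions on the whole space.\<close>

definition C0 :: "'x::topological_space set \<Rightarrow> ('x \<Rightarrow> complex) set" where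
  "C0 U = {f. continuous_on UNIV f \<and> (\<forall>\<epsilon>>0. compact {x. \<epsilon> \<le> cmod (f x)}) \<and> (\<forall>x. x \<notin> U \<longrightarrow> f x = 0)}"

definition C0_algebra :: "('x::topological_space \<Rightarrow> complex) star_algebra" where
  "C0_algebra = \<lparr>sa_carrier = C0 UNIV, sa_add = (\<lambda>f g x. f x + g x),
     sa_scale = (\<lambda>c f x. c * f x), sa_mult = (\<lambda>f g x. f x * g x), sa_star = (\<lambda>f x. cnj (f x))\<rparr>"

text \<open>
  A net in \<open>C_0(U)\<close> is represented by the filter of its tails. The approximate units
  considered consist of positive contractions.
\<close>

definition approximate_unit :: "'x::topological_space set \<Rightarrow> ('x \<Rightarrow> complex) filter \<Rightarrow> bool" where
  "approximate_unit U F \<longleftrightarrow> F \<noteq> bot \<and>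
     (\<forall>\<^sub>F e in F. e \<in> C0 U \<and> range e \<subseteq> complex_of_real ` {0..1}) \<and>
     (\<forall>a\<in>C0 U. uniform_limit UNIV (\<lambda>e x. a x * e x) a F)"


section \<open>Reduced partial crossed products\<close>

text \<open>
  A partial action of \<open>G\<close> on \<open>X\<close> is given by the graphs \<open>\<theta> g \<subseteq> X \<times> X\<close> of the partial
  homeomorphisms; \<open>X\<^sub>g\<close> is the domain of \<open>\<theta> g\<inverse>\<close>.
\<close>

type_synonym ('g, 'x) partial_map_family = "'g \<Rightarrow> ('x \<times> 'x) set"

definition pa_dom :: "('g::mult_group, 'x) partial_map_family \<Rightarrow> 'g \<Rightarrow> 'x set" where
  "pa_dom \<theta> g = Domain (\<theta> (inverse g))"

definition pa_alpha ::
    "('g::mult_group, 'x) partial_map_family \<Rightarrow> 'g \<Rightarrow> ('x \<Rightarrow> complex) \<Rightarrow> 'x \<Rightarrow> complex" where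
  "pa_alpha \<theta> g f x = (if x \<in> pa_dom \<theta> g then f (THE y. (y, x) \<in> \<theta> g) else 0)"

definition pa_rep ::
    "('g::mult_group, 'x::topological_space) partial_map_family \<Rightarrow>
     (('x \<Rightarrow> complex) \<Rightarrow> 'h::complex_hilbert op) \<Rightarrow> 'g \<Rightarrow> ('x \<Rightarrow> complex) \<Rightarrow> 'h op" where
  "pa_rep \<theta> \<pi> h a = (THE T. T \<in> complex_ops \<and>
     (\<forall>F. approximate_unit (pa_dom \<theta> h) F \<longrightarrow>
       (\<forall>\<xi>. ((\<lambda>e. blinfun_apply (\<pi> (pa_alpha \<theta> (inverse h) (\<lambda>x. a x * e x))) \<xi>)
              \<longlongrightarrow> blinfun_apply T \<xi>) F)))"

definition regular_rep ::
    "('g::mult_group, 'x::topological_space) partial_map_family \<Rightarrow>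
     (('x \<Rightarrow> complex) \<Rightarrow> 'h::complex_hilbert op) \<Rightarrow> 'g \<Rightarrow> ('x \<Rightarrow> complex) \<Rightarrow> ('g, 'h) ell2 op" where
  "regular_rep \<theta> \<pi> g a = (THE T. \<forall>\<xi> h.
     ell2_fun (blinfun_apply T \<xi>) h = blinfun_apply (pa_rep \<theta> \<pi> h a) (ell2_fun \<xi> (inverse g * h)))"

definition reduced_crossed_product ::
    "('g::mult_group, 'x::topological_space) partial_map_family \<Rightarrow>
     (('x \<Rightarrow> complex) \<Rightarrow> 'h::complex_hilbert op) \<Rightarrow> ('g, 'h) ell2 op star_algebra" where
  "reduced_crossed_product \<theta> \<pi> = op_algebra (closure
     {\<Sum>g\<in>K. regular_rep \<theta> \<pi> g (a g) | K a. finite K \<and> (\<forall>g\<in>K. a g \<in> C0 (pa_dom \<theta> g))})"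


section \<open>The algebras associated with an inverse semigroup\<close>

subsection \<open>The reduced C*-algebra\<close>

definition left_regular_op :: "'s::inverse_semigroup \<Rightarrow> ('s, complex) ell2 op" where
  "left_regular_op s = (THE T. T \<in> complex_ops \<and>
     (\<forall>t. blinfun_apply T (ell2_delta t) = (if star s * s * t = t then ell2_delta (s * t) else 0)))"

definition reduced_cstar ::
    "'s::inverse_semigroup itself \<Rightarrow> ('s, complex) ell2 op star_algebra" where
  "reduced_cstar _ = op_algebra (cstar_generated (range left_regular_op))"


subsection \<open>The universal C*-algebra of the semilattice of idempotents\<close>

definition semilattice_rep :: "('s::inverse_semigroup idem \<Rightarrow> 'h::complex_hilbert op) \<Rightarrow> bool" where
  "semilattice_rep v \<longleftrightarrow> (\<forall>e. v e \<in> complex_ops \<and> adj_op (v e) = v e) \<and>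
     (\<forall>e f. v (e * f) = v e o\<^sub>L v f)"

text \<open>
  The universal C*-algebra is generated by the direct sum of all representations on the separable
  Hilbert space \<open>\<ell>\<^sup>2(\<nat>)\<close>. This is universal when the semilattice is countable: every representation is
  then a direct sum of representations on separable spaces, and each of these extends by zero
  to one on \<open>\<ell>\<^sup>2(\<nat>)\<close>. Summands indexed by maps that are not representations are annihilated.
\<close>

type_synonym 's universal_space =
  "('s idem \<Rightarrow> (nat, complex) ell2 op, (nat, complex) ell2) ell2"

definition universal_rep :: "'s::inverse_semigroup idem \<Rightarrow> 's universal_space op" where
  "universal_rep e = (THE T. \<forall>\<xi> v. ell2_fun (blinfun_apply T \<xi>) v =
     (if semilattice_rep v then blinfun_apply (v e) (ell2_fun \<xi> v) else 0))"

definition semilattice_cstar ::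
    "'s::inverse_semigroup itself \<Rightarrow> 's universal_space op star_algebra" where
  "semilattice_cstar _ = op_algebra (cstar_generated (range (universal_rep :: 's idem \<Rightarrow> _)))"


subsection \<open>The spectrum and the partial action of the maximal group image\<close>

typedef (overloaded) 's spectrum =
  "{\<phi> :: 's::inverse_semigroup idem \<Rightarrow> bool. (\<exists>e. \<phi> e) \<and> (\<forall>e f. \<phi> (e * f) \<longleftrightarrow> \<phi> e \<and> \<phi> f)}"
  morphisms char_fun Abs_spectrum
  by (rule exI[of _ "\<lambda>_. True"]) simp

text \<open>Subspace topology from the product of discrete two-point spaces.\<close>

instantiation spectrum :: (inverse_semigroup) topological_space
begin

definition open_spectrum :: "'a spectrum set \<Rightarrow> bool" where
  "open_spectrum U \<longleftrightarrow> (\<exists>V. open V \<and> U = char_fun -` V)"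

instance
proof
  show "open (UNIV :: 'a spectrum set)"
    unfolding open_spectrum_def by (rule exI[of _ UNIV]) simp
  show "open (U \<inter> V)" if "open U" "open V" for U V :: "'a spectrum set"
    using that unfolding open_spectrum_def by (metis open_Int vimage_Int)
  show "open (\<Union>K)" if "\<forall>U\<in>K. open U" for K :: "'a spectrum set set"
  proof -
    have "\<forall>U\<in>K. \<exists>V. open V \<and> U = char_fun -` V"
      using that unfolding open_spectrum_def by blast
    then obtain V where V: "\<forall>U\<in>K. open (V U) \<and> U = char_fun -` V U"
      by (rule bchoice[THEN exE])
    then have "open (\<Union>U\<in>K. V U)" by auto
    moreover have "\<Union>K = char_fun -` (\<Union>U\<in>K. V U)"
      unfolding vimage_UN using V by auto
    ultimately show ?thesis unfolding open_spectrum_def by blast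
  qed
qed

end

definition spectrum_D :: "'s::inverse_semigroup idem \<Rightarrow> 's spectrum set" where
  "spectrum_D e = {\<phi>. char_fun \<phi> e}"

definition beta :: "'s::inverse_semigroup \<Rightarrow> ('s spectrum \<times> 's spectrum) set" where
  "beta s = {(\<phi>, \<psi>). \<phi> \<in> spectrum_D (dom_idem s) \<and> (\<forall>e. char_fun \<psi> e = char_fun \<phi> (conj_idem s e))}"

definition theta :: "('s::inverse_semigroup max_group, 's spectrum) partial_map_family" where
  "theta g = (\<Union>s \<in> max_group_class -` {g}. beta s)"

text \<open>
  The identification of \<open>C_0\<close> of the spectrum with the universal C*-algebra: the unique star-isomorphism
  (on \<open>C0 UNIV\<close>) sending the indicator of \<open>spectrum_D e\<close> to the generator of \<open>e\<close>.
\<close>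

definition spectral_iso :: "('s::inverse_semigroup spectrum \<Rightarrow> complex) \<Rightarrow> 's universal_space op" where
  "spectral_iso = (SOME \<Phi>. star_iso C0_algebra (semilattice_cstar TYPE('s)) \<Phi> \<and>
     (\<forall>e. \<Phi> (indicator (spectrum_D e)) = universal_rep e))"

text \<open>
  Transporting \<open>\<theta>\<close> along \<open>spectral_iso\<close>, a representation \<open>\<pi>\<close> of the universal C*-algebra becomes
  the representation \<open>\<pi> \<circ> spectral_iso\<close> of \<open>C_0\<close> of the spectrum.
\<close>

definition semilattice_crossed_product ::
    "('s::inverse_semigroup universal_space op \<Rightarrow> 'h::complex_hilbert op) \<Rightarrow>
     ('s max_group, 'h) ell2 op star_algebra" where
  "semilattice_crossed_product \<pi> = reduced_crossed_product theta (\<pi> \<circ> spectral_iso)"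

end

theory Submission
  imports Defs
begin

text \<open>
  Both algebras are closures of the span of a family of operators indexed by \<open>S\<close> with the same
  multiplication and involution: the operators \<open>\<Lambda>\<^sub>s\<close>, and the operators \<open>W\<^sub>s\<close> of the crossed
  product given by the indicator of \<open>D(s s\<^sup>*)\<close> at the group element \<open>\<sigma>(s)\<close>. So it suffices that
  a finite sum \<open>a\<close> has the same norm in both representations. The norm of a represented element
  is determined by the diagonal coefficients of the powers of \<open>a\<^sup>* a\<close> at a total set of vectors.
  In both representations the coefficients at the basis vectors factor, since \<open>S\<close> is E-unitary,
  through the restriction of sums to the idempotents, that is through \<open>C\<^sub>0\<close> of the spectrum. There
  they are bounded by the supremum norm, which is attained both by a faithful representation and,
  by density, by the principal characters, which give the coefficients of \<open>\<Lambda>\<close>.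
\<close>

section \<open>Adjoints and operator norms on complex Hilbert spaces\<close>

text \<open>Norms are compared through growth rates, without functional calculus. With
  \<open>S\<close> the adjoint of the operator times the operator, the coefficient of S^(2k) at
  \<xi> is the squared norm of S^k \<xi>. Bounding coefficients with any constant depending on \<xi>
  therefore bounds a growth rate, and such a rate survives linear combinations. Hence a total set of
  vectors and finite sums suffice. The main obstacle lies in the crossed product. The domains X_h
  are open but in general not compact, so \<open>\<pi>\<^sub>h\<close> is only a strong limit, and
  its definition quantifies over every approximate unit. Countability of S supplies a sequence of
  compact open sets exhausting X_h, whose indicators are a concrete approximate unit. Moreover
  \<theta>(g)\<theta>(h) is only a restriction of \<theta>(gh), so it takes an argument that
  \<open>W\<close> is multiplicative: the representations at h and at gh must agree on indicators
  that correspond under \<theta>(g). That S is E-unitary is used in two ways: it makes \<theta>(g)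
  single-valued, and it forces an element with a non-zero diagonal coefficient to be
  idempotent.\<close>

lemma scaleR_scaleC: "r *\<^sub>R (c *\<^sub>C x) = c *\<^sub>C (r *\<^sub>R (x::'a::complex_hilbert))"
  by (metis mult.commute scaleC_of_real scaleC_scaleC)

lemma scaleC_zero_right [simp]: "c *\<^sub>C (0::'a::complex_hilbert) = 0"
  by (metis add_cancel_right_left scaleC_add_right)

lemma scaleC_zero_left [simp]: "0 *\<^sub>C (x::'a::complex_hilbert) = 0"
  by (metis of_real_0 scaleC_of_real scaleR_zero_left)

lemma scaleC_one [simp]: "1 *\<^sub>C (x::'a::complex_hilbert) = x"
  by (metis of_real_1 scaleC_of_real scaleR_one)

lemma scaleC_minus_one: "(-1) *\<^sub>C (x::'a::complex_hilbert) = - x"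
  using scaleC_of_real[of "-1" x] by simp

lemma scaleC_minus_right: "c *\<^sub>C (- (x::'a::complex_hilbert)) = - (c *\<^sub>C x)"
  by (metis scaleC_minus_one mult.commute scaleC_scaleC)

lemma scaleC_diff_right: "c *\<^sub>C (x - (y::'a::complex_hilbert)) = c *\<^sub>C x - c *\<^sub>C y"
  by (metis diff_conv_add_uminus scaleC_add_right scaleC_minus_right)

lemma bounded_linear_scaleC: "bounded_linear (\<lambda>x::'a::complex_hilbert. c *\<^sub>C x)"
  by (rule bounded_linear_intro[where K="cmod c"])
    (simp_all add: scaleC_add_right scaleR_scaleC norm_scaleC mult.commute)

lemma cinner_bounded_bilinear: "bounded_bilinear (cinner :: 'a::complex_hilbert \<Rightarrow> _)"
proof
  fix r :: real and a b :: 'a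
  show "cinner (r *\<^sub>R a) b = r *\<^sub>R cinner a b"
    unfolding scaleC_of_real[symmetric, of r a] cinner_scaleC_left by
        (simp add: scaleR_conv_of_real)
  show "cinner a (r *\<^sub>R b) = r *\<^sub>R cinner a b"
    unfolding scaleC_of_real[symmetric, of r b] cinner_scaleC_right by
        (simp add: scaleR_conv_of_real)
  show "\<exists>K. \<forall>a b::'a. norm (cinner a b) \<le> norm a * norm b * K"
    by (rule exI[of _ 1]) (simp add: cinner_bound)
qed (simp_all add: cinner_add_left cinner_add_right)

interpretation cinner: bounded_bilinear "cinner :: 'a::complex_hilbert \<Rightarrow> _"
  by (rule cinner_bounded_bilinear)

lemma norm_square_cinner: "(norm (x::'a::complex_hilbert))\<^sup>2 = Re (cinner x x)"
  by (simp add: cinner_self)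

lemma cinner_ext:
  assumes "\<And>y. cinner x y = cinner z (y::'a::complex_hilbert)" shows "x = z"
proof -
  have "cinner (x - z) (x - z) = 0" using assms by (simp add: cinner.diff_left)
  then show ?thesis by (simp add: cinner_self)
qed

lemma cinner_ext':
  assumes "\<And>y. cinner y x = cinner y (z::'a::complex_hilbert)" shows "x = z"
  using assms by (metis cinner_commute cinner_ext)

lemma norm_sum_square:
  "(norm (x + y :: 'a::complex_hilbert))\<^sup>2 = (norm x)\<^sup>2 + 2 * Re (cinner x y) + (norm y)\<^sup>2"
proof -
  have "Re (cinner y x) = Re (cinner x y)" by (subst cinner_commute) simp
  then show ?thesis by (simp add: norm_square_cinner cinner.add_left cinner.add_right)
qed

lemma norm_diff_square:
  "(norm (x - y :: 'a::complex_hilbert))\<^sup>2 = (norm x)\<^sup>2 - 2 * Re (cinner x y) + (norm y)\<^sup>2"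
  using norm_sum_square[of x "- y"] by (simp add: cinner.minus_right)

text \<open>The representing vector minimises \<open>\<parallel>z\<parallel>\<^sup>2 - 2 Re (f z)\<close>; the parallelogram law
  makes minimising sequences Cauchy.\<close>

lemma riesz_representation:
  fixes f :: "'a::complex_hilbert \<Rightarrow> complex"
  assumes f: "bounded_linear f" and fC: "\<And>c x. f (c *\<^sub>C x) = c * f x"
  shows "\<exists>z. \<forall>x. f x = cinner x z"
proof -
  interpret f: bounded_linear f by (rule f)
  define J where "J z = (norm z)\<^sup>2 - 2 * Re (f z)" for z
  obtain B where B: "\<And>x. norm (f x) \<le> norm x * B" using f.bounded by blast
  have bel: "- B\<^sup>2 \<le> J z" for z
  proof -
    have "Re (f z) \<le> norm z * B" using B[of z] complex_Re_le_cmod[of "f z"] by linarith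
    moreover have "0 \<le> (norm z - B)\<^sup>2" by simp
    ultimately show ?thesis unfolding J_def by (simp add: power2_diff)
  qed
  define m where "m = (INF z. J z)"
  have bdd: "bdd_below (range J)" using bel by (auto intro!: bdd_belowI)
  have m: "m \<le> J z" for z unfolding m_def using bdd by (simp add: cINF_lower)
  define d :: "nat \<Rightarrow> real" where "d n = 1 / Suc n" for n
  have "\<exists>z. J z < m + d n" for n
    using cINF_less_iff[OF _ bdd, of "m + d n"] unfolding m_def d_def by auto
  then obtain Z where Z: "\<And>n. J (Z n) < m + d n" by metis
  \<comment> \<open>\<open>J z + J w - 2 * J\<close> at the midpoint equals half the squared
    distance of \<open>z\<close> and \<open>w\<close>, and \<open>J\<close> at the midpoint is at
    least \<open>m\<close>.\<close>
  have par: "(norm (z - w))\<^sup>2 \<le> 2 * (J z - m) + 2 * (J w - m)" for z w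
  proof -
    have "J ((1/2) *\<^sub>R (z + w)) = (norm (z + w))\<^sup>2 / 4 - Re (f z) - Re (f w)"
      proof -
      have "(norm ((1/2) *\<^sub>R (z + w)))\<^sup>2 = (norm (z + w))\<^sup>2 / 4"
        by (simp only: norm_scaleR power_mult_distrib) (simp add: power_divide)
      moreover have "Re (f ((1/2) *\<^sub>R (z + w))) = (Re (f z) + Re (f w)) / 2"
        by (simp only: f.scaleR f.add) simp
      ultimately show ?thesis unfolding J_def by simp
    qed
    moreover have "(norm (z + w))\<^sup>2 + (norm (z - w))\<^sup>2 = 2 * (norm z)\<^sup>2 + 2 * (norm w)\<^sup>2"
      by (simp add: norm_sum_square norm_diff_square)
    ultimately show ?thesis using m[of "(1/2) *\<^sub>R (z + w)"] unfolding J_def by simp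
  qed
  have "Cauchy Z"
  proof (rule CauchyI)
    fix e :: real assume e: "0 < e"
    obtain N where N: "d N < e\<^sup>2 / 4"
      using nat_approx_posE[of "e\<^sup>2 / 4"] e unfolding d_def by auto
    then have N: "4 * d N < e\<^sup>2" by simp
    have "norm (Z i - Z j) < e" if "N \<le> i" "N \<le> j" for i j
    proof -
      have "d i \<le> d N" "d j \<le> d N"
        using that by (simp_all add: d_def frac_le)
      then have "(norm (Z i - Z j))\<^sup>2 < e\<^sup>2"
        using par[of "Z i" "Z j"] Z[of i] Z[of j] N by argo
      then show ?thesis using e power_less_imp_less_base by fastforce
    qed
    then show "\<exists>M. \<forall>i\<ge>M. \<forall>j\<ge>M. norm (Z i - Z j) < e" by blast
  qed
  then obtain z where z: "Z \<longlonglongrightarrow> z" using Cauchy_convergent convergent_def by blast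
  have Jz: "J z = m"
  proof (rule antisym)
    have "(\<lambda>n. J (Z n)) \<longlonglongrightarrow> J z" unfolding J_def
      by (intro tendsto_diff tendsto_power tendsto_norm tendsto_mult tendsto_const tendsto_Re z
          f.tendsto)
    moreover have "(\<lambda>n. m + d n) \<longlonglongrightarrow> m + 0"
      using LIMSEQ_inverse_real_of_nat
      unfolding d_def by (intro tendsto_add tendsto_const) (simp only: inverse_eq_divide)
    ultimately have "J z \<le> m + 0" by (rule LIMSEQ_le) (use Z less_imp_le in blast)
    then show "J z \<le> m" by simp
  qed (rule m)
  have re: "Re (f x) = Re (cinner x z)" for x
  proof -
    define a where "a = 2 * Re (cinner x z) - 2 * Re (f x)"
    have q: "0 \<le> a * t + (norm x)\<^sup>2 * t\<^sup>2" for t :: real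
    proof -
      have "J (t *\<^sub>R x + z) = J z + a * t + (norm x)\<^sup>2 * t\<^sup>2"
        unfolding J_def norm_sum_square a_def
        by (simp add: f.add f.scaleR cinner.scaleR_left algebra_simps)
      then show ?thesis using m[of "t *\<^sub>R x + z"] Jz by simp
    qed
    have "a = 0"
    proof (rule ccontr)
      assume "a \<noteq> 0"
      \<comment> \<open>\<open>a\<close> is the derivative of \<open>J\<close> at its minimum in
        direction \<open>x\<close>. A small step against it would lower \<open>J\<close>; adding 1
        to the squared norm keeps the step defined for \<open>x = 0\<close>.\<close>
      define n where "n = (norm x)\<^sup>2 + 1"
      have n: "n > 0" "(norm x)\<^sup>2 < n" by (simp_all add: n_def add_nonneg_pos)
      have "0 \<le> a * (- a / n) + (norm x)\<^sup>2 * (- a / n)\<^sup>2" by (rule q)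
      also have "\<dots> = (a\<^sup>2 / n) * ((norm x)\<^sup>2 / n - 1)"
        using n by (simp add: field_simps power2_eq_square)
      also have "\<dots> < 0" using n \<open>a \<noteq> 0\<close> by (intro mult_pos_neg) simp_all
      finally show False by simp
    qed
    then show ?thesis by (simp add: a_def)
  qed
  have "f x = cinner x z" for x
  proof (rule complex_eqI)
    show "Re (f x) = Re (cinner x z)" by (rule re)
    \<comment> \<open>So far only real parts are known to agree; the real part at -i times
      \<open>x\<close> is the imaginary part at \<open>x\<close>.\<close>
    show "Im (f x) = Im (cinner x z)"
      using re[of "(- \<i>) *\<^sub>C x"] by (simp add: fC cinner_scaleC_left)
  qed
  then show ?thesis by blast
qed

section \<open>Complex-linear operators and their adjoints\<close>

lemma complex_opsD: "T \<in> complex_ops \<Longrightarrow> blinfun_apply T (c *\<^sub>C x) = c *\<^sub>C blinfun_apply T x"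
  by (simp add: complex_ops_def)

lemma scale_op_apply [simp]: "blinfun_apply (scale_op c T) x = c *\<^sub>C blinfun_apply T x"
proof -
  have "bounded_linear (\<lambda>x. c *\<^sub>C blinfun_apply T x)"
    by (rule bounded_linear_compose[OF bounded_linear_scaleC blinfun.bounded_linear_right])
  then show ?thesis unfolding scale_op_def by (simp add: bounded_linear_Blinfun_apply)
qed

lemma adj_op_eqI:
  assumes "\<And>x y. cinner (blinfun_apply T x) y = cinner x (blinfun_apply T' y)"
  shows "adj_op T = T'"
  unfolding adj_op_def
proof (rule the_equality)
  fix T'' assume "\<forall>x y. cinner (blinfun_apply T x) y = cinner x (blinfun_apply T'' y)"
  then show "T'' = T'" using assms by - (rule blinfun_eqI, rule cinner_ext', metis)
qed (use assms in blast)

text \<open>\<open>adj_op\<close> is a definite description, so an adjoint has to be produced: for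
  each \<open>y\<close> it is the vector representing the functional that pairs \<open>T x\<close>
  with \<open>y\<close>. Operators of the library type are only real-linear; membership in
  \<open>complex_ops\<close> is what makes this functional complex-linear.\<close>

lemma adj_exists:
  fixes T :: "'h::complex_hilbert op"
  assumes T: "T \<in> complex_ops"
  shows "\<exists>T'. \<forall>x y. cinner (blinfun_apply T x) y = cinner x (blinfun_apply T' y)"
proof -
  have "\<exists>z. \<forall>x. cinner (blinfun_apply T x) y = cinner x z" for y
  proof (rule riesz_representation)
    show "bounded_linear (\<lambda>x. cinner (blinfun_apply T x) y)"
      by (rule bounded_linear_compose[OF cinner.bounded_linear_left blinfun.bounded_linear_right])
  qed (simp add: complex_opsD[OF T] cinner_scaleC_left)
  then obtain R where R: "\<And>x y. cinner (blinfun_apply T x) y = cinner x (R y)" by metis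
  have "bounded_linear R"
  proof (rule bounded_linear_intro[where K="norm T"])
    fix y z :: 'h and r :: real
    show "R (y + z) = R y + R z"
      by (rule cinner_ext') (simp add: cinner_add_right flip: R)
    show "R (r *\<^sub>R y) = r *\<^sub>R R y"
      by (rule cinner_ext') (simp add: cinner.scaleR_right flip: R)
    have "(norm (R y))\<^sup>2 = Re (cinner (blinfun_apply T (R y)) y)"
      by (simp add: R norm_square_cinner)
    also have "\<dots> \<le> norm (blinfun_apply T (R y)) * norm y"
      using complex_Re_le_cmod cinner_bound order_trans by blast
    also have "\<dots> \<le> (norm T * norm (R y)) * norm y"
      by (intro mult_right_mono norm_blinfun) simp
    finally have "norm (R y) * norm (R y) \<le> norm (R y) * (norm y * norm T)"
      by (simp add: power2_eq_square mult_ac)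
    then show "norm (R y) \<le> norm y * norm T"
      by (cases "norm (R y) = 0") (auto simp: mult_le_cancel_left)
  qed
  then have "blinfun_apply (Blinfun R) = R" by (rule bounded_linear_Blinfun_apply)
  then show ?thesis using R by metis
qed

lemma cinner_adj:
  fixes T :: "'h::complex_hilbert op"
  assumes "T \<in> complex_ops"
  shows "cinner (blinfun_apply T x) y = cinner x (blinfun_apply (adj_op T) y)"
  using adj_exists[OF assms] adj_op_eqI by metis

lemma cinner_adj':
  assumes "T \<in> complex_ops"
  shows "cinner (blinfun_apply (adj_op T) x) y = cinner x (blinfun_apply T y)"
  using cinner_adj[OF assms] by (metis cinner_commute)

text \<open>Having an adjoint forces complex linearity, because the inner product is complex-linear
  in its first argument. This puts adjoints into \<open>complex_ops\<close> at no cost.\<close>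

lemma complex_ops_if_adj:
  assumes "\<And>x y. cinner (blinfun_apply T x) y = cinner x (blinfun_apply T' y)"
  shows "T \<in> complex_ops"
proof -
  have "blinfun_apply T (c *\<^sub>C x) = c *\<^sub>C blinfun_apply T x" for c x
    by (rule cinner_ext) (simp add: assms cinner_scaleC_left)
  then show ?thesis by (simp add: complex_ops_def)
qed

lemma adj_complex_ops [simp]: "T \<in> complex_ops \<Longrightarrow> adj_op T \<in> complex_ops"
  by (rule complex_ops_if_adj) (rule cinner_adj')

lemma complex_ops_zero [simp]: "0 \<in> complex_ops"
  by (simp add: complex_ops_def)
lemma complex_ops_add [simp]: "S \<in> complex_ops \<Longrightarrow> T \<in> complex_ops \<Longrightarrow> S + T \<in> complex_ops"
  by (simp add: complex_ops_def plus_blinfun.rep_eq scaleC_add_right)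
lemma complex_ops_diff [simp]: "S \<in> complex_ops \<Longrightarrow> T \<in> complex_ops \<Longrightarrow> S - T \<in> complex_ops"
  by (simp add: complex_ops_def minus_blinfun.rep_eq scaleC_diff_right)
lemma complex_ops_scale [simp]: "T \<in> complex_ops \<Longrightarrow> scale_op c T \<in> complex_ops"
  by (simp add: complex_ops_def scaleC_scaleC mult.commute)
lemma complex_ops_mult [simp]: "S \<in> complex_ops \<Longrightarrow> T \<in> complex_ops \<Longrightarrow> S o\<^sub>L T \<in> complex_ops"
  by (simp add: complex_ops_def)

lemma adj_zero [simp]: "adj_op (0 :: 'h::complex_hilbert op) = 0"
  by (rule adj_op_eqI) (simp add: cinner.zero_left cinner.zero_right)
lemma adj_add: "S \<in> complex_ops \<Longrightarrow> T \<in> complex_ops \<Longrightarrow> adj_op (S + T) = adj_op S + adj_op T"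
  by (rule adj_op_eqI) (simp add: cinner_adj plus_blinfun.rep_eq cinner_add_left cinner_add_right)
lemma adj_diff: "S \<in> complex_ops \<Longrightarrow> T \<in> complex_ops \<Longrightarrow> adj_op (S - T) = adj_op S - adj_op T"
  by (rule adj_op_eqI)
    (simp add: cinner_adj minus_blinfun.rep_eq cinner.diff_left cinner.diff_right)
lemma adj_scale: "T \<in> complex_ops \<Longrightarrow> adj_op (scale_op c T) = scale_op (cnj c) (adj_op T)"
  by (rule adj_op_eqI) (simp add: cinner_adj cinner_scaleC_left cinner_scaleC_right)

lemma norm_scale_op: "norm (scale_op c T) = cmod c * norm T"
proof -
  have le: "norm (scale_op c T) \<le> cmod c * norm T" for c and T :: "'a op"
    by (rule norm_blinfun_bound)
      (simp_all add: norm_scaleC mult.assoc mult_left_mono norm_blinfun)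
  show ?thesis
  proof (cases "c = 0")
    case False
    have "scale_op (inverse c) (scale_op c T) = T"
      using False by (intro blinfun_eqI) (simp add: scaleC_scaleC)
    then have "norm T \<le> inverse (cmod c) * norm (scale_op c T)"
      using le[of "inverse c" "scale_op c T"] by (simp add: norm_inverse)
    then have "cmod c * norm T \<le> norm (scale_op c T)" using False by (simp add: field_simps)
    then show ?thesis using le[of c T] by simp
  qed (use le[of 0 T] in simp)
qed

lemma norm_adj_le:
  fixes T :: "'h::complex_hilbert op"
  assumes T: "T \<in> complex_ops" shows "norm (adj_op T) \<le> norm T"
proof (rule norm_blinfun_bound)
  fix y
  let ?y = "blinfun_apply (adj_op T) y"
  have "(norm ?y)\<^sup>2 = Re (cinner (blinfun_apply T ?y) y)"
    by (simp add: norm_square_cinner cinner_adj[OF T])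
  also have "\<dots> \<le> norm (blinfun_apply T ?y) * norm y"
    using complex_Re_le_cmod cinner_bound order_trans by blast
  also have "\<dots> \<le> (norm T * norm ?y) * norm y"
    by (intro mult_right_mono norm_blinfun) simp
  finally have "norm ?y * norm ?y \<le> norm ?y * (norm T * norm y)"
    by (simp add: power2_eq_square mult_ac)
  then show "norm ?y \<le> norm T * norm y"
    by (cases "norm ?y = 0") (auto simp: mult_le_cancel_left)
qed simp

lemma scale_op_add: "scale_op c (S + T) = scale_op c S + scale_op c T"
  by (rule blinfun_eqI) (simp add: plus_blinfun.rep_eq scaleC_add_right)
lemma scale_op_scale: "scale_op c (scale_op d T) = scale_op (c * d) T"
  by (rule blinfun_eqI) (simp add: scaleC_scaleC)
lemma scale_op_zero [simp]: "scale_op c 0 = 0"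
  by (rule blinfun_eqI) simp

lemma bounded_linear_scale_op: "bounded_linear (scale_op c :: 'h::complex_hilbert op \<Rightarrow> _)"
proof (rule bounded_linear_intro)
  show "scale_op c (r *\<^sub>R S) = r *\<^sub>R scale_op c S" for r and S :: "'h op"
    by (rule blinfun_eqI) (simp add: scaleR_blinfun.rep_eq scaleR_scaleC)
  show "norm (scale_op c S) \<le> norm S * cmod c" for S :: "'h op"
    by (simp add: norm_scale_op)
qed (rule scale_op_add)

lemmas tendsto_scale_op = bounded_linear.tendsto[OF bounded_linear_scale_op]

lemma closed_complex_ops: "closed (complex_ops :: 'h::complex_hilbert op set)"
proof -
  have l: "continuous_on UNIV (\<lambda>T::'h op. blinfun_apply T y)" for y
    by (rule linear_continuous_on[OF blinfun.bounded_linear_left])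
  have "closed {T::'h op. blinfun_apply T (c *\<^sub>C x) = c *\<^sub>C blinfun_apply T x}" for c x
    by (rule closed_Collect_eq[OF l linear_continuous_on[OF bounded_linear_compose[OF
              bounded_linear_scaleC blinfun.bounded_linear_left]]])
  note cl = this
  have eq: "complex_ops
      = (\<Inter>c. \<Inter>x. {T::'h op. blinfun_apply T (c *\<^sub>C x) = c *\<^sub>C blinfun_apply T x})"
    by (auto simp: complex_ops_def)
  show ?thesis unfolding eq by (rule closed_INT, rule ballI, rule closed_INT, rule ballI, rule cl)
qed

lemma tendsto_adj_op:
  assumes X: "X \<longlonglongrightarrow> T" "\<And>n. X n \<in> complex_ops"
  shows "(\<lambda>n. adj_op (X n)) \<longlonglongrightarrow> adj_op T" "T \<in> complex_ops"
proof -
  show T: "T \<in> complex_ops" using closed_complex_ops X closed_sequentially by blast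
  have "(\<lambda>n. adj_op (X n) - adj_op T) \<longlonglongrightarrow> 0"
  proof (rule tendsto_norm_zero_cancel, rule tendsto_sandwich[where f="\<lambda>_. 0"])
    show "\<forall>\<^sub>F n in sequentially. norm (adj_op (X n) - adj_op T) \<le> norm (X n - T)"
    proof (rule always_eventually, rule allI)
      fix n
      show "norm (adj_op (X n) - adj_op T) \<le> norm (X n - T)"
        unfolding adj_diff[OF X(2) T, symmetric] by (rule norm_adj_le) (simp add: X(2) T)
    qed
    show "(\<lambda>n. norm (X n - T)) \<longlonglongrightarrow> 0" using X(1) by (simp add: LIM_zero tendsto_norm_zero)
  qed auto
  then show "(\<lambda>n. adj_op (X n)) \<longlonglongrightarrow> adj_op T" by (rule LIM_zero_cancel)
qed

text \<open>For self-adjoint \<open>S\<close> the sequence \<open>\<parallel>S\<^sup>k \<xi>\<parallel>\<close> is log-convex, so its growth rate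
  bounds its first ratio.\<close>

lemma selfadjoint_growth:
  fixes S :: "'h::complex_hilbert op"
  assumes S: "\<And>x y. cinner (blinfun_apply S x) y = cinner x (blinfun_apply S y)"
    and M: "0 \<le> M" and C: "\<And>k. norm ((blinfun_apply S ^^ k) \<xi>) \<le> C * M ^ k"
  shows "norm (blinfun_apply S \<xi>) \<le> M * norm \<xi>"
proof (rule ccontr)
  assume neg: "\<not> ?thesis"
  define b where "b k = norm ((blinfun_apply S ^^ k) \<xi>)" for k
  \<comment> \<open>Self-adjointness moves one factor across the inner product; the rest is
    Cauchy-Schwarz.\<close>
  have convex: "(b (Suc k))\<^sup>2 \<le> b (Suc (Suc k)) * b k" for k
  proof -
    let ?x = "(blinfun_apply S ^^ k) \<xi>"
    have "(b (Suc k))\<^sup>2 = Re (cinner (blinfun_apply S (blinfun_apply S ?x)) ?x)"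
      by (simp add: b_def norm_square_cinner S)
    also have "\<dots> \<le> b (Suc (Suc k)) * b k"
      unfolding b_def using complex_Re_le_cmod cinner_bound order_trans by fastforce
    finally show ?thesis .
  qed
  have b01: "b 1 > M * b 0" using neg by (simp add: b_def)
  have b0: "b 0 \<noteq> 0"
  proof
    assume "b 0 = 0" then have "\<xi> = 0" by (simp add: b_def)
    then show False using neg by simp
  qed
  then have b0: "b 0 > 0" by (simp add: b_def)
  define r where "r = b 1 / b 0"
  have r: "r > M" using b01 b0 by (simp add: r_def field_simps)
  then have r0: "r > 0" using M by simp
  have step: "b k > 0 \<and> r * b k \<le> b (Suc k)" for k
  proof (induction k)
    case 0 then show ?case using b0 by (simp add: r_def)
  next
    case (Suc k)
    then have pos: "b (Suc k) > 0" using r0 by (meson less_le_trans mult_pos_pos)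
    have "r * b (Suc k) * b k \<le> b (Suc k) * b (Suc k)"
      using Suc pos by (simp add: mult_ac)
    also have "\<dots> \<le> b (Suc (Suc k)) * b k" using convex by (simp add: power2_eq_square)
    finally show ?case using Suc pos by simp
  qed
  have low: "r ^ k * b 0 \<le> b k" for k
  proof (induction k)
    case (Suc k)
    have "r ^ Suc k * b 0 \<le> r * b k" using Suc r0 by (simp add: mult_left_mono mult.assoc)
    then show ?case using step[of k] by linarith
  qed simp
  have bd: "r ^ k * b 0 \<le> C * M ^ k" for k using low[of k] C[of k] by (simp add: b_def)
  show False
  \<comment> \<open>For \<open>M = 0\<close> the bound at exponent 1 is already absurd; otherwise
    the powers of \<open>r / M > 1\<close> are unbounded.\<close>
  proof (cases "M = 0")
    case True then show False using bd[of 1] mult_pos_pos[OF r0 b0] by simp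
  next
    case False
    then have M: "M > 0" using M by simp
    have "(r / M) ^ k \<le> C / b 0" for k using bd[of k] b0 M by (simp add: field_simps)
    moreover obtain k where "C / b 0 < (r / M) ^ k"
      using real_arch_pow[of "r / M" "C / b 0"] r M by auto
    ultimately show False by (meson not_le)
  qed
qed

text \<open>Linear combinations are built one term at a time, so that an induction has a single
  non-trivial case.\<close>

inductive_set cspan :: "'h::complex_hilbert set \<Rightarrow> 'h set" for D where
  cspan_zero: "0 \<in> cspan D"
| cspan_add: "x \<in> cspan D \<Longrightarrow> d \<in> D \<Longrightarrow> x + c *\<^sub>C d \<in> cspan D"

text \<open>Growth of rate \<open>M\<^sup>2\<close> passes to linear combinations, since only the
  constants change. On the span \<open>selfadjoint_growth\<close> then removes the constant
  altogether, Cauchy-Schwarz turns the bound for \<open>adj_op T o\<^sub>L T\<close> into one for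
  \<open>T\<close>, and density finishes. A direct bound for \<open>T\<close> on \<open>D\<close>
  alone would not extend to the span.\<close>

lemma norm_le_by_growth:
  fixes T :: "'h::complex_hilbert op"
  assumes T: "T \<in> complex_ops" and D: "closure (cspan D) = UNIV" and M: "0 \<le> M"
    and C: "\<And>\<xi>. \<xi> \<in> D \<Longrightarrow>
      \<exists>C. \<forall>k. norm ((blinfun_apply (adj_op T o\<^sub>L T) ^^ k) \<xi>) \<le> C * (M\<^sup>2) ^ k"
  shows "norm T \<le> M"
proof -
  define S where "S = adj_op T o\<^sub>L T"
  let ?P = "\<lambda>k. blinfun_apply S ^^ k"
  have S: "S \<in> complex_ops" using T by (simp add: S_def)
  have sa: "cinner (blinfun_apply S x) y = cinner x (blinfun_apply S y)" for x y
    by (simp add: S_def cinner_adj[OF T] cinner_adj'[OF T])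
  have lin: "?P k (x + c *\<^sub>C y) = ?P k x + c *\<^sub>C ?P k y" for k c x y
    by (induction k) (simp_all add: blinfun.add_right complex_opsD[OF S])
  have grow: "\<exists>C. \<forall>k. norm (?P k \<xi>) \<le> C * (M\<^sup>2) ^ k" if "\<xi> \<in> cspan D" for \<xi>
    using that
  proof induction
    case cspan_zero
    have "?P k 0 = 0" for k by (induction k) simp_all
    then show ?case by (auto intro!: exI[of _ 0])
  next
    case (cspan_add x d c)
    obtain C1 where C1: "\<And>k. norm (?P k x) \<le> C1 * (M\<^sup>2) ^ k" using cspan_add.IH by blast
    obtain C2 where C2: "\<And>k. norm (?P k d) \<le> C2 * (M\<^sup>2) ^ k"
      using C[OF \<open>d \<in> D\<close>] unfolding S_def by blast
    have "norm (?P k (x + c *\<^sub>C d)) \<le> (C1 + cmod c * C2) * (M\<^sup>2) ^ k" for k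
    proof -
      have "norm (?P k (x + c *\<^sub>C d)) \<le> norm (?P k x) + cmod c * norm (?P k d)"
        unfolding lin by (metis norm_scaleC norm_triangle_ineq)
      also have "\<dots> \<le> C1 * (M\<^sup>2) ^ k + cmod c * (C2 * (M\<^sup>2) ^ k)"
        by (intro add_mono mult_left_mono C1 C2) simp
      finally show ?thesis by (simp add: algebra_simps)
    qed
    then show ?case by blast
  qed
  have bd: "norm (blinfun_apply T \<xi>) \<le> M * norm \<xi>" if \<xi>: "\<xi> \<in> cspan D" for \<xi>
  proof -
    obtain C where "\<And>k. norm (?P k \<xi>) \<le> C * (M\<^sup>2) ^ k" using grow[OF \<xi>] by auto
    from selfadjoint_growth[OF sa _ this] have "norm (blinfun_apply S \<xi>) \<le> M\<^sup>2 * norm \<xi>"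
      by simp
    then have "(norm \<xi>) * norm (blinfun_apply S \<xi>) \<le> norm \<xi> * (M\<^sup>2 * norm \<xi>)"
      by (rule mult_left_mono) simp
    moreover have "(norm (blinfun_apply T \<xi>))\<^sup>2 \<le> norm \<xi> * norm (blinfun_apply S \<xi>)"
    proof -
      have "(norm (blinfun_apply T \<xi>))\<^sup>2 = Re (cinner \<xi> (blinfun_apply S \<xi>))"
        by (simp add: norm_square_cinner S_def cinner_adj[OF T])
      then show ?thesis using complex_Re_le_cmod cinner_bound order_trans by fastforce
    qed
    ultimately have "(norm (blinfun_apply T \<xi>))\<^sup>2 \<le> (M * norm \<xi>)\<^sup>2"
      by (simp add: power2_eq_square mult_ac)
    then show ?thesis using M by (simp add: abs_le_square_iff[symmetric])
  qed
  have "closure (cspan D) \<subseteq> {\<xi>. norm (blinfun_apply T \<xi>) \<le> M * norm \<xi>}"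
    using bd by (intro closure_minimal closed_Collect_le continuous_intros) auto
  then show ?thesis unfolding D using M by (intro norm_blinfun_bound) auto
qed

section \<open>Operators on spaces of square-summable families\<close>

lemma ell2_eqI: "(\<And>i. ell2_fun x i = ell2_fun y i) \<Longrightarrow> x = y"
  by (metis ell2_fun_inject ext)

lemma norm_ell2_square: "(norm x)\<^sup>2 = (\<Sum>\<^sub>\<infinity>i. (norm (ell2_fun x i))\<^sup>2)"
  by (simp add: norm_ell2_def infsum_nonneg)

lemma summable_norm_ell2: "(\<lambda>i. (norm (ell2_fun x i))\<^sup>2) summable_on UNIV"
  using square_summable_ell2_fun[of x] by (simp add: square_summable_def)

lemma ell2_fun_bounded_linear: "bounded_linear (\<lambda>x. ell2_fun x i)"
  by (rule bounded_linear_intro[where K=1])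
    (simp_all add: plus_ell2.rep_eq scaleR_ell2.rep_eq norm_ell2_fun_le)

lift_definition ell2_single :: "'i \<Rightarrow> 'h::real_normed_vector \<Rightarrow> ('i, 'h) ell2"
  is "\<lambda>i x j. if j = i then x else 0"
proof -
  fix i :: 'i and x :: 'h
  have "{j. (norm (if j = i then x else 0))\<^sup>2 \<noteq> 0} \<subseteq> {i}" by auto
  then show "square_summable (\<lambda>j. if j = i then x else 0)"
    unfolding square_summable_def
    by (intro finite_nonzero_values_imp_summable_on) (auto intro: finite_subset)
qed

lemma ell2_delta_single: "ell2_delta i = ell2_single i 1"
  by transfer (rule refl)

lemma ell2_single_scaleC: "c *\<^sub>C ell2_single i x = ell2_single i (c *\<^sub>C (x::'h::complex_hilbert))"
  by (rule ell2_eqI) (simp add: scaleC_ell2.rep_eq ell2_single.rep_eq)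

lemma cinner_ell2_single:
  "cinner x (ell2_single i y) = cinner (ell2_fun x i) (y::'h::complex_hilbert)"
proof -
  have "cinner x (ell2_single i y) = (\<Sum>\<^sub>\<infinity>j\<in>{i}. cinner (ell2_fun x j) (ell2_fun (ell2_single i y)
      j))"
    unfolding cinner_ell2_def
    by (rule infsum_cong_neutral) (auto simp: ell2_single.rep_eq cinner.zero_right)
  then show ?thesis by (simp add: ell2_single.rep_eq)
qed

lemma norm_ell2_single: "norm (ell2_single i x) = norm x"
proof -
  have "(\<Sum>\<^sub>\<infinity>j. (norm (ell2_fun (ell2_single i x) j))\<^sup>2)
      = (\<Sum>\<^sub>\<infinity>j\<in>{i}. (norm (ell2_fun (ell2_single i x) j))\<^sup>2)"
    by (rule infsum_cong_neutral) (auto simp: ell2_single.rep_eq)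
  then show ?thesis by (simp add: norm_ell2_def ell2_single.rep_eq)
qed

text \<open>A vector is truncated to finitely many coordinates; the squared error is the tail of a
  convergent sum.\<close>

lemma closure_cspan_singles:
  "closure (cspan (range (\<lambda>(i, x). ell2_single i x))) = (UNIV :: ('i, 'h::complex_hilbert) ell2
      set)"
proof -
  let ?D = "range (\<lambda>(i, x). ell2_single i x) :: ('i, 'h) ell2 set"
  have "x \<in> closure (cspan ?D)" for x
    unfolding closure_approachable
  proof (intro allI impI)
    fix e :: real assume e: "0 < e"
    define f where "f i = (norm (ell2_fun x i))\<^sup>2" for i
    have s: "f summable_on A" for A
      using summable_norm_ell2[of x] summable_on_subset_banach unfolding f_def by blast
    have "(f has_sum infsum f UNIV) UNIV" using s by simp
    then obtain F where F: "finite F" "dist (sum f F) (infsum f UNIV) < e\<^sup>2"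
      unfolding has_sum_def tendsto_iff eventually_finite_subsets_at_top using e
      by (metis order_refl zero_less_power)
    define y where "y = (\<Sum>i\<in>F. ell2_single i (ell2_fun x i))"
    have y: "y \<in> cspan ?D"
      unfolding y_def using F(1)
    proof (induction F)
      case (insert i F)
      have "(\<Sum>i\<in>F. ell2_single i (ell2_fun x i)) + 1 *\<^sub>C ell2_single i (ell2_fun x i) \<in> cspan ?D"
        by (rule cspan_add[OF insert.IH]) force
      then show ?case using insert by (simp add: add.commute)
    qed (auto intro: cspan.intros)
    have yf: "ell2_fun y j = (if j \<in> F then ell2_fun x j else 0)" for j
    proof -
      have "ell2_fun y j = (\<Sum>i\<in>F. ell2_fun (ell2_single i (ell2_fun x i)) j)"
        unfolding y_def by (rule bounded_linear.linear[OF ell2_fun_bounded_linear, THEN linear_sum])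
      then show ?thesis using F(1) by (simp add: ell2_single.rep_eq)
    qed
    have "(norm (y - x))\<^sup>2 = (\<Sum>\<^sub>\<infinity>i\<in>-F. f i)"
      unfolding norm_ell2_square
      by (rule infsum_cong_neutral) (auto simp: minus_ell2.rep_eq yf f_def)
    also have "\<dots> = infsum f UNIV - sum f F"
      using infsum_Diff[of f UNIV F] s F(1) by (simp add: Compl_eq_Diff_UNIV)
    also have "\<dots> < e\<^sup>2" using F(2) by (simp add: dist_real_def)
    finally have "dist y x < e" using e by (simp add: dist_norm power_less_imp_less_base)
    then show "\<exists>y\<in>cspan ?D. dist y x < e" using y by blast
  qed
  then show ?thesis by blast
qed

lemma closure_cspan_deltas:
  "closure (cspan (range ell2_delta)) = (UNIV :: ('i, complex) ell2 set)"
proof -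
  have "cspan (range (\<lambda>(i, x). ell2_single i x)) \<subseteq> cspan (range (ell2_delta :: 'i \<Rightarrow> _))"
  proof
    fix x :: "('i, complex) ell2" assume "x \<in> cspan (range (\<lambda>(i, x). ell2_single i x))"
    then show "x \<in> cspan (range ell2_delta)"
    proof induction
      case (cspan_add x d c)
      then obtain i z where "d = ell2_single i z" by auto
      then have "c *\<^sub>C d = (c * z) *\<^sub>C ell2_delta i"
        by (simp add: ell2_delta_single ell2_single_scaleC scaleC_complex_def)
      then show ?case using cspan.cspan_add[OF cspan_add.IH] by simp
    qed (rule cspan_zero)
  qed
  then show ?thesis using closure_cspan_singles closure_mono by blast
qed

lemma ops_eq_on_total:
  fixes T T' :: "'h::complex_hilbert op"
  assumes T: "T \<in> complex_ops" "T' \<in> complex_ops" and D: "closure (cspan D) = UNIV"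
    and eq: "\<And>x. x \<in> D \<Longrightarrow> blinfun_apply T x = blinfun_apply T' x"
  shows "T = T'"
proof -
  have "blinfun_apply T x = blinfun_apply T' x" if "x \<in> cspan D" for x
    using that by induction (simp_all add: blinfun.add_right complex_opsD[OF T(1)] complex_opsD[OF
        T(2)] eq)
  then have "closure (cspan D) \<subseteq> {x. blinfun_apply T x = blinfun_apply T' x}"
    by (intro closure_minimal closed_Collect_eq continuous_intros) auto
  then show ?thesis using D by (intro blinfun_eqI) auto
qed

text \<open>All operators on square-summable families occurring below have this form.\<close>

definition weighted_shift ::
    "('i \<Rightarrow> 'h::complex_hilbert op) \<Rightarrow> ('i \<Rightarrow> 'i) \<Rightarrow> ('i, 'h) ell2 op" where
  "weighted_shift A \<tau> = Blinfun (\<lambda>\<xi>. Abs_ell2 (\<lambda>i. blinfun_apply (A i) (ell2_fun \<xi> (\<tau> i))))"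

text \<open>Injectivity is demanded only where the weight is non-zero, because left multiplication
  by \<open>star s\<close> is injective only on the part of the semigroup that supports the operator
  of \<open>s\<close>. There the coordinates can be reindexed, so no coordinate of
  \<open>\<xi>\<close> is counted twice and the bound \<open>B\<close> on the weights bounds the
  operator.\<close>

lemma weighted_shift:
  fixes A :: "'i \<Rightarrow> 'h::complex_hilbert op"
  assumes B: "\<And>i. norm (A i) \<le> B" and inj: "inj_on \<tau> {i. A i \<noteq> 0}"
  shows weighted_shift_apply:
      "ell2_fun (blinfun_apply (weighted_shift A \<tau>) \<xi>) i = blinfun_apply (A i) (ell2_fun \<xi> (\<tau> i))"
    and norm_weighted_shift: "norm (weighted_shift A \<tau>) \<le> B"
proof -
  define f where "f \<xi> i = blinfun_apply (A i) (ell2_fun \<xi> (\<tau> i))" for \<xi> :: "('i, 'h) ell2" and i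
  have B0: "0 \<le> B" using B[of undefined] norm_ge_zero order_trans by blast
  have L2: "L2_set (\<lambda>i. norm (f \<xi> i)) F \<le> B * norm \<xi>" if F: "finite F" for \<xi> F
  proof -
    define F' where "F' = F \<inter> {i. A i \<noteq> 0}"
    have F': "finite F'" "inj_on \<tau> F'" using F inj by (auto simp: F'_def intro: inj_on_subset)
    have "(\<Sum>i\<in>F. (norm (f \<xi> i))\<^sup>2) = (\<Sum>i\<in>F'. (norm (f \<xi> i))\<^sup>2)"
      using F by (intro sum.mono_neutral_right) (auto simp: F'_def f_def)
    also have "\<dots> \<le> (\<Sum>i\<in>F'. B\<^sup>2 * (norm (ell2_fun \<xi> (\<tau> i)))\<^sup>2)"
    proof (rule sum_mono)
      fix i
      have "norm (f \<xi> i) \<le> norm (A i) * norm (ell2_fun \<xi> (\<tau> i))"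
        unfolding f_def by (rule norm_blinfun)
      also have "\<dots> \<le> B * norm (ell2_fun \<xi> (\<tau> i))" by (intro mult_right_mono B) simp
      finally show "(norm (f \<xi> i))\<^sup>2 \<le> B\<^sup>2 * (norm (ell2_fun \<xi> (\<tau> i)))\<^sup>2"
        by (metis norm_ge_zero power_mono power_mult_distrib)
    qed
    also have "\<dots> = B\<^sup>2 * (\<Sum>j\<in>\<tau> ` F'. (norm (ell2_fun \<xi> j))\<^sup>2)"
      by (simp add: sum_distrib_left sum.reindex[OF F'(2)])
    also have "\<dots> \<le> B\<^sup>2 * (norm \<xi>)\<^sup>2"
      unfolding norm_ell2_square
      by (intro mult_left_mono finite_sum_le_infsum summable_norm_ell2) (auto simp: F')
    finally have "(\<Sum>i\<in>F. (norm (f \<xi> i))\<^sup>2) \<le> (B * norm \<xi>)\<^sup>2" by (simp add: power_mult_distrib)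
    then show ?thesis unfolding L2_set_def using B0 by (intro real_le_lsqrt sum_nonneg) auto
  qed
  have sq: "square_summable (f \<xi>)" and nb: "sqrt (\<Sum>\<^sub>\<infinity>i. (norm (f \<xi> i))\<^sup>2) \<le> B * norm \<xi>" for \<xi>
    using square_summableI[OF L2] by blast+
  have ap: "ell2_fun (Abs_ell2 (f \<xi>)) = f \<xi>" for \<xi> using sq by (simp add: Abs_ell2_inverse)
  have nb': "norm (Abs_ell2 (f \<xi>)) \<le> B * norm \<xi>" for \<xi> using nb by (simp add: norm_ell2_def ap)
  have "bounded_linear (\<lambda>\<xi>. Abs_ell2 (f \<xi>))"
  proof (rule bounded_linear_intro)
    fix \<xi> \<eta> :: "('i, 'h) ell2" and r :: real
    show "Abs_ell2 (f (\<xi> + \<eta>)) = Abs_ell2 (f \<xi>) + Abs_ell2 (f \<eta>)"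
      by (rule ell2_eqI) (simp add: ap plus_ell2.rep_eq, simp add: f_def plus_ell2.rep_eq
          blinfun.add_right)
    show "Abs_ell2 (f (r *\<^sub>R \<xi>)) = r *\<^sub>R Abs_ell2 (f \<xi>)"
      by (rule ell2_eqI)
        (simp add: ap scaleR_ell2.rep_eq, simp add: f_def scaleR_ell2.rep_eq blinfun.scaleR_right)
    show "norm (Abs_ell2 (f \<xi>)) \<le> norm \<xi> * B" using nb' by (simp add: mult.commute)
  qed
  then have W: "blinfun_apply (weighted_shift A \<tau>) \<xi> = Abs_ell2 (f \<xi>)" for \<xi>
    unfolding weighted_shift_def f_def by (subst bounded_linear_Blinfun_apply) auto
  show "ell2_fun (blinfun_apply (weighted_shift A \<tau>) \<xi>) i = blinfun_apply (A i) (ell2_fun \<xi> (\<tau> i))"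
    unfolding W ap f_def ..
  show "norm (weighted_shift A \<tau>) \<le> B"
    by (rule norm_blinfun_bound[OF B0]) (simp add: W nb')
qed

lemma weighted_shift_complex:
  fixes A :: "'i \<Rightarrow> 'h::complex_hilbert op"
  assumes "\<And>i. norm (A i) \<le> B" "inj_on \<tau> {i. A i \<noteq> 0}" "\<And>i. A i \<in> complex_ops"
  shows "weighted_shift A \<tau> \<in> complex_ops"
  unfolding complex_ops_def using assms(3)
  by (auto intro!: ell2_eqI simp: weighted_shift_apply[OF assms(1,2)] scaleC_ell2.rep_eq
      complex_opsD)

text \<open>The hypotheses make \<open>\<tau>\<close> and \<open>\<tau>'\<close> mutually inverse
  bijections between the supports of the two weights; the inner product is reindexed along
  them.\<close>

lemma adj_weighted_shift:
  fixes A :: "'i \<Rightarrow> 'h::complex_hilbert op"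
  assumes A: "\<And>i. norm (A i) \<le> B" "inj_on \<tau> {i. A i \<noteq> 0}"
    and A': "\<And>i. norm (A' i) \<le> B'" "inj_on \<tau>' {i. A' i \<noteq> 0}"
    and inv: "\<And>i. A i \<noteq> 0 \<Longrightarrow> A' (\<tau> i) \<noteq> 0 \<and> \<tau>' (\<tau> i) = i"
      "\<And>i. A' i \<noteq> 0 \<Longrightarrow> A (\<tau>' i) \<noteq> 0 \<and> \<tau> (\<tau>' i) = i"
    and adj: "\<And>i x y. A i \<noteq> 0 \<Longrightarrow>
      cinner (blinfun_apply (A i) x) y = cinner x (blinfun_apply (A' (\<tau> i)) y)"
  shows "adj_op (weighted_shift A \<tau>) = weighted_shift A' \<tau>'"
proof (rule adj_op_eqI)
  fix x y
  let ?I = "{i. A i \<noteq> 0}" and ?J = "{i. A' i \<noteq> 0}"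
  have bij: "bij_betw \<tau> ?I ?J" using inv by (intro bij_betwI[where g=\<tau>']) auto
  have "cinner (blinfun_apply (weighted_shift A \<tau>) x) y
      = (\<Sum>\<^sub>\<infinity>i\<in>?I. cinner (blinfun_apply (A i) (ell2_fun x (\<tau> i))) (ell2_fun y i))"
    unfolding cinner_ell2_def weighted_shift_apply[OF A]
    by (rule infsum_cong_neutral) (auto simp: cinner.zero_left)
  also have "\<dots> = (\<Sum>\<^sub>\<infinity>i\<in>?I. cinner (ell2_fun x (\<tau> i))
      (blinfun_apply (A' (\<tau> i)) (ell2_fun y (\<tau>' (\<tau> i)))))"
    using inv adj by (intro infsum_cong) auto
  also have "\<dots> = (\<Sum>\<^sub>\<infinity>j\<in>?J. cinner (ell2_fun x j) (blinfun_apply (A' j) (ell2_fun y (\<tau>' j))))"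
    by (rule infsum_reindex_bij_betw[OF bij])
  also have "\<dots> = cinner x (blinfun_apply (weighted_shift A' \<tau>') y)"
    unfolding cinner_ell2_def weighted_shift_apply[OF A']
    by (rule infsum_cong_neutral) (auto simp: cinner.zero_right)
  finally show "cinner (blinfun_apply (weighted_shift A \<tau>) x) y
      = cinner x (blinfun_apply (weighted_shift A' \<tau>') y)" .
qed

section \<open>Closed spans of represented semigroups\<close>

text \<open>Formal linear combinations are lists of coefficient-index pairs, with repetitions
  allowed. Sums, products and adjoints become list operations, and one list can be evaluated in two
  representations.\<close>

definition lin :: "('i \<Rightarrow> 'h::complex_hilbert op) \<Rightarrow> (complex \<times> 'i) list \<Rightarrow> 'h op" where
  "lin v xs = (\<Sum>(c, i)\<leftarrow>xs. scale_op c (v i))"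

definition fsum :: "('i \<Rightarrow> complex) \<Rightarrow> (complex \<times> 'i) list \<Rightarrow> complex" where
  "fsum f xs = (\<Sum>(c, i)\<leftarrow>xs. c * f i)"

definition fscale :: "complex \<Rightarrow> (complex \<times> 'i) list \<Rightarrow> (complex \<times> 'i) list" where
  "fscale c = map (\<lambda>(d, i). (c * d, i))"

definition fmult :: "(complex \<times> 'i::semigroup_mult) list \<Rightarrow> (complex \<times> 'i) list \<Rightarrow> (complex \<times> 'i)
    list" where
  "fmult xs ys = concat (map (\<lambda>(c, i). map (\<lambda>(d, j). (c * d, i * j)) ys) xs)"

definition fstar :: "('i \<Rightarrow> 'i) \<Rightarrow> (complex \<times> 'i) list \<Rightarrow> (complex \<times> 'i) list" where
  "fstar st = map (\<lambda>(c, i). (cnj c, st i))"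

lemma lin_simps [simp]:
  "lin v [] = 0" "lin v ((c, i) # xs) = scale_op c (v i) + lin v xs"
  "lin v (xs @ ys) = lin v xs + lin v ys"
  by (simp_all add: lin_def)

lemma fsum_simps [simp]:
  "fsum f [] = 0" "fsum f ((c, i) # xs) = c * f i + fsum f xs"
  "fsum f (xs @ ys) = fsum f xs + fsum f ys"
  by (simp_all add: fsum_def)

lemma lin_fscale: "lin v (fscale c xs) = scale_op c (lin v xs)"
  by (induction xs) (auto simp: fscale_def scale_op_scale scale_op_add)

lemma fsum_fscale: "fsum f (fscale c xs) = c * fsum f xs"
  by (induction xs) (auto simp: fscale_def algebra_simps)

lemma scale_op_minus_one: "scale_op (- 1) T = - T"
  by (rule blinfun_eqI) (simp add: scaleC_minus_one uminus_blinfun.rep_eq)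

lemma lin_diff: "lin v (xs @ fscale (- 1) ys) = lin v xs - lin v ys"
  by (simp add: lin_fscale scale_op_minus_one)

lemma fsum_fmult:
  assumes "\<And>i j. f (i * j) = f i * f j"
  shows "fsum f (fmult xs ys) = fsum f xs * fsum f ys"
proof -
  have "fsum f (map (\<lambda>(d, j). (c * d, i * j)) ys) = c * f i * fsum f ys" for c i
    by (induction ys) (auto simp: assms algebra_simps)
  then show ?thesis by (induction xs) (auto simp: fmult_def algebra_simps)
qed

lemma fsum_fstar: "fsum f (fstar st xs) = cnj (fsum (\<lambda>i. cnj (f (st i))) xs)"
  by (induction xs) (auto simp: fstar_def)

text \<open>\<open>st\<close> is the abstract involution: \<open>star\<close> for the inverse
  semigroup, \<open>id\<close> for its semilattice of idempotents.\<close>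

locale op_rep =
  fixes v :: "'i::semigroup_mult \<Rightarrow> 'h::complex_hilbert op" and st :: "'i \<Rightarrow> 'i"
  assumes complex_ops [simp]: "v i \<in> complex_ops"
    and mult: "v (i * j) = v i o\<^sub>L v j"
    and adj: "adj_op (v i) = v (st i)"
begin

lemma lin_complex_ops [simp]: "lin v xs \<in> complex_ops"
  by (induction xs) auto

lemma lin_fmult: "lin v (fmult xs ys) = lin v xs o\<^sub>L lin v ys"
proof -
  have "lin v (map (\<lambda>(d, j). (c * d, i * j)) ys) = scale_op c (v i) o\<^sub>L lin v ys" for c i
  proof (induction ys)
    case (Cons y ys)
    then show ?case
      by (cases y) (auto intro!: blinfun_eqI simp: mult plus_blinfun.rep_eq blinfun.add_right
          complex_opsD[OF complex_ops] scaleC_scaleC scaleC_add_right)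
  qed simp
  then show ?thesis
    by (induction xs) (auto simp: fmult_def bounded_bilinear.add_left[OF
        bounded_bilinear_blinfun_compose])
qed

lemma lin_fstar: "lin v (fstar st xs) = adj_op (lin v xs)"
  by (induction xs) (auto simp: fstar_def adj_add adj_scale adj)

end

lemma closure_rangeE:
  fixes g :: "'a \<Rightarrow> 'b::metric_space"
  assumes "S \<in> closure (range g)"
  obtains X where "(\<lambda>n. g (X n)) \<longlonglongrightarrow> S"
proof -
  obtain x where x: "\<And>n. x n \<in> range g" "x \<longlonglongrightarrow> S"
    using assms unfolding closure_sequential by blast
  have "(\<lambda>n. g (inv g (x n))) = x" using x(1) by (simp add: f_inv_into_f)
  then show thesis using that[of "\<lambda>n. inv g (x n)"] x(2) by simp
qed

lemma closure_rangeI: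
  fixes g :: "'a \<Rightarrow> 'b::metric_space"
  assumes "(\<lambda>n. g (X n)) \<longlonglongrightarrow> S"
  shows "S \<in> closure (range g)"
  unfolding closure_sequential using assms by (intro exI[of _ "\<lambda>n. g (X n)"]) simp

lemma tendsto_blinfun_compose:
  "(X \<longlongrightarrow> S) F \<Longrightarrow> (Y \<longlongrightarrow> T) F \<Longrightarrow> ((\<lambda>n. X n o\<^sub>L Y n) \<longlongrightarrow> (S o\<^sub>L T)) F"
  by (rule bounded_bilinear.tendsto[OF bounded_bilinear_blinfun_compose])

context op_rep
begin

lemma closure_add:
  assumes "S \<in> closure (range (lin v))" "T \<in> closure (range (lin v))"
  shows "S + T \<in> closure (range (lin v))"
proof -
  obtain X Y where "(\<lambda>n. lin v (X n)) \<longlonglongrightarrow> S" "(\<lambda>n. lin v (Y n)) \<longlonglongrightarrow> T"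
    using assms closure_rangeE by metis
  then have "(\<lambda>n. lin v (X n @ Y n)) \<longlonglongrightarrow> S + T"
    unfolding lin_simps(3) by (rule tendsto_add)
  then show ?thesis by (rule closure_rangeI)
qed

lemma closure_mult:
  assumes "S \<in> closure (range (lin v))" "T \<in> closure (range (lin v))"
  shows "S o\<^sub>L T \<in> closure (range (lin v))"
proof -
  obtain X Y where "(\<lambda>n. lin v (X n)) \<longlonglongrightarrow> S" "(\<lambda>n. lin v (Y n)) \<longlonglongrightarrow> T"
    using assms closure_rangeE by metis
  then have "(\<lambda>n. lin v (fmult (X n) (Y n))) \<longlonglongrightarrow> (S o\<^sub>L T)"
    unfolding lin_fmult by (rule tendsto_blinfun_compose)
  then show ?thesis by (rule closure_rangeI)
qed

lemma cstar_subalgebra_closure: "cstar_subalgebra (closure (range (lin v)))"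
  unfolding cstar_subalgebra_def
proof (intro conjI ballI allI)
  let ?A = "closure (range (lin v))"
  show "?A \<subseteq> complex_ops"
    by (rule closure_minimal[OF _ closed_complex_ops]) auto
  then have cx: "T \<in> complex_ops" if "T \<in> ?A" for T using that by blast
  show "0 \<in> ?A" using closure_subset lin_simps(1)[of v] by (metis in_mono rangeI)
  show "closed ?A" by simp
  fix S T assume S: "S \<in> ?A" and T: "T \<in> ?A"
  show "S + T \<in> ?A" using S T by (rule closure_add)
  show "S o\<^sub>L T \<in> ?A"
    using S T by (rule closure_mult)
next
  let ?A = "closure (range (lin v))"
  fix T assume T: "T \<in> ?A"
  then obtain X where X: "(\<lambda>n. lin v (X n)) \<longlonglongrightarrow> T" by (rule closure_rangeE)
  have "(\<lambda>n. lin v (fscale c (X n))) \<longlonglongrightarrow> scale_op c T" for c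
    unfolding lin_fscale by (rule tendsto_scale_op[OF X])
  then show "scale_op c T \<in> ?A" for c by (rule closure_rangeI)
  have "(\<lambda>n. lin v (fstar st (X n))) \<longlonglongrightarrow> adj_op T"
    unfolding lin_fstar by (rule tendsto_adj_op[OF X]) simp
  then show "adj_op T \<in> ?A" by (rule closure_rangeI)
qed

text \<open>The index set is closed under product and involution, so linear combinations already
  form a star-algebra and only the closure is missing.\<close>

lemma cstar_generated_eq: "cstar_generated (range v) = closure (range (lin v))"
proof
  have "scale_op 1 T = T" for T :: "'h op" by (rule blinfun_eqI) simp
  then have "v i = lin v [(1, i)]" for i by simp
  then have "range v \<subseteq> closure (range (lin v))"
    using closure_subset by (metis (no_types, lifting) image_subset_iff rangeI subset_iff)
  then show "cstar_generated (range v) \<subseteq> closure (range (lin v))"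
    unfolding cstar_generated_def using cstar_subalgebra_closure by blast
  have "closure (range (lin v)) \<subseteq> A" if A: "cstar_subalgebra A" "range v \<subseteq> A" for A
  proof (rule closure_minimal)
    show "closed A" using A(1) by (simp add: cstar_subalgebra_def)
    have "lin v xs \<in> A" for xs
    proof (induction xs)
      case Nil then show ?case using A(1) by (simp add: cstar_subalgebra_def)
    next
      case (Cons y ys)
      have "scale_op (fst y) (v (snd y)) + lin v ys \<in> A"
        using A Cons unfolding cstar_subalgebra_def by blast
      then show ?case by (cases y) simp
    qed
    then show "range (lin v) \<subseteq> A" by auto
  qed
  then show "closure (range (lin v)) \<subseteq> cstar_generated (range v)"
    unfolding cstar_generated_def by blast
qed

end

text \<open>The graph of the isomorphism between the two closures: limits of one sequence of formal
  combinations, evaluated on both sides. Being symmetric in the two representations, it yields the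
  inverse map by the same lemmas.\<close>

definition lin_rel ::
    "('i \<Rightarrow> 'h::complex_hilbert op) \<Rightarrow> ('i \<Rightarrow> 'k::complex_hilbert op) \<Rightarrow> 'h op \<Rightarrow> 'k op \<Rightarrow> bool" where
  "lin_rel v w S T \<longleftrightarrow>
     (\<exists>X. (\<lambda>n. lin v (X n)) \<longlonglongrightarrow> S \<and> (\<lambda>n. lin w (X n)) \<longlonglongrightarrow> T)"

lemma lin_rel_sym: "lin_rel v w S T \<Longrightarrow> lin_rel w v T S"
  unfolding lin_rel_def by blast

lemma lin_rel_closure: "lin_rel v w S T \<Longrightarrow> T \<in> closure (range (lin w))"
  unfolding lin_rel_def using closure_rangeI[of "lin w"] by blast

text \<open>A difference of two values is the value of a single list (\<open>lin_diff\<close>), so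
  equality of norms carries the Cauchy property from one side to the other.\<close>

lemma lin_rel_total:
  assumes eq: "\<And>xs. norm (lin v xs) = norm (lin w xs)" and S: "S \<in> closure (range (lin v))"
  shows "\<exists>T. lin_rel v w S T"
proof -
  obtain X where X: "(\<lambda>n. lin v (X n)) \<longlonglongrightarrow> S"
    using S by (rule closure_rangeE)
  have d: "norm (lin w (X m) - lin w (X n)) = norm (lin v (X m) - lin v (X n))" for m n
    unfolding lin_diff[symmetric] by (rule eq[symmetric])
  have "Cauchy (\<lambda>n. lin w (X n))"
    using LIMSEQ_imp_Cauchy[OF X] unfolding Cauchy_iff d .
  then obtain T where "(\<lambda>n. lin w (X n)) \<longlonglongrightarrow> T"
    using Cauchy_convergent convergent_def by blast
  then show ?thesis unfolding lin_rel_def using X by blast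
qed

lemma lin_rel_unique:
  assumes eq: "\<And>xs. norm (lin v xs) = norm (lin w xs)"
    and "lin_rel v w S T" "lin_rel v w S T'"
  shows "T = T'"
proof -
  obtain X Y where X: "(\<lambda>n. lin v (X n)) \<longlonglongrightarrow> S" "(\<lambda>n. lin w (X n)) \<longlonglongrightarrow> T"
    and Y: "(\<lambda>n. lin v (Y n)) \<longlonglongrightarrow> S" "(\<lambda>n. lin w (Y n)) \<longlonglongrightarrow> T'"
    using assms(2,3) unfolding lin_rel_def by blast
  have d: "norm (lin w (X n) - lin w (Y n)) = norm (lin v (X n) - lin v (Y n))" for n
    unfolding lin_diff[symmetric] by (rule eq[symmetric])
  have "(\<lambda>n. norm (lin v (X n) - lin v (Y n))) \<longlonglongrightarrow> norm (S - S)"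
    by (rule tendsto_norm[OF tendsto_diff[OF X(1) Y(1)]])
  moreover have "(\<lambda>n. norm (lin v (X n) - lin v (Y n))) \<longlonglongrightarrow> norm (T - T')"
    unfolding d[symmetric] by (rule tendsto_norm[OF tendsto_diff[OF X(2) Y(2)]])
  ultimately have "norm (S - S) = norm (T - T')" by (rule LIMSEQ_unique)
  then show ?thesis by simp
qed

text \<open>Equal norms on finite combinations make the graph \<open>lin_rel\<close> functional and
  total in both directions. It respects the operations because each of them is the same list
  operation in both representations.\<close>

lemma star_isomorphic_closures:
  fixes v :: "'i::semigroup_mult \<Rightarrow> 'h::complex_hilbert op"
    and w :: "'i \<Rightarrow> 'k::complex_hilbert op"
  assumes v: "op_rep v st" and w: "op_rep w st"
    and eq: "\<And>xs. norm (lin v xs) = norm (lin w xs)"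
  shows "op_algebra (closure (range (lin v))) \<cong>\<^sub>* op_algebra (closure (range (lin w)))"
proof -
  interpret v: op_rep v st by (rule v)
  interpret w: op_rep w st by (rule w)
  let ?A = "closure (range (lin v))" and ?B = "closure (range (lin w))"
  define \<Phi> where "\<Phi> S = (SOME T. lin_rel v w S T)" for S
  have rel: "lin_rel v w S (\<Phi> S)" if "S \<in> ?A" for S
    unfolding \<Phi>_def using lin_rel_total[OF eq that] by (rule someI_ex)
  have \<Phi>: "\<Phi> S = T" if "lin_rel v w S T" for S T
    using rel lin_rel_unique[OF eq] that lin_rel_closure[OF lin_rel_sym[OF that]] by blast
  have "bij_betw \<Phi> ?A ?B"
  proof (rule bij_betwI')
    fix S T assume "S \<in> ?A" "T \<in> ?A"
    then show "\<Phi> S = \<Phi> T \<longleftrightarrow> S = T"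
      using rel lin_rel_sym lin_rel_unique[OF eq[symmetric]] by metis
  next
    show "\<Phi> S \<in> ?B" if "S \<in> ?A" for S using rel[OF that] by (rule lin_rel_closure)
    show "\<exists>S\<in>?A. T = \<Phi> S" if "T \<in> ?B" for T
      using lin_rel_total[OF eq[symmetric] that] \<Phi> lin_rel_sym lin_rel_closure by metis
  qed
  moreover have "star_hom (op_algebra ?A) (op_algebra ?B) \<Phi>"
    unfolding star_hom_def op_algebra_def star_algebra.simps
  proof (intro conjI ballI allI)
    show "\<Phi> ` ?A \<subseteq> ?B" using rel lin_rel_closure by blast
  next
    fix S T assume "S \<in> ?A" "T \<in> ?A"
    then obtain X Y where X: "(\<lambda>n. lin v (X n)) \<longlonglongrightarrow> S" "(\<lambda>n. lin w (X n)) \<longlonglongrightarrow> \<Phi> S"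
      and Y: "(\<lambda>n. lin v (Y n)) \<longlonglongrightarrow> T" "(\<lambda>n. lin w (Y n)) \<longlonglongrightarrow> \<Phi> T"
      using rel unfolding lin_rel_def by blast
    show "\<Phi> (S + T) = \<Phi> S + \<Phi> T"
      by (rule \<Phi>) (unfold lin_rel_def, rule exI[of _ "\<lambda>n. X n @ Y n"],
          simp add: tendsto_add X Y)
    show "\<Phi> (S o\<^sub>L T) = \<Phi> S o\<^sub>L \<Phi> T"
      by (rule \<Phi>) (unfold lin_rel_def, rule exI[of _ "\<lambda>n. fmult (X n) (Y n)"],
          simp add: v.lin_fmult w.lin_fmult tendsto_blinfun_compose X Y)
  next
    fix S c assume "S \<in> ?A"
    then obtain X where X: "(\<lambda>n. lin v (X n)) \<longlonglongrightarrow> S" "(\<lambda>n. lin w (X n)) \<longlonglongrightarrow> \<Phi> S"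
      using rel unfolding lin_rel_def by blast
    show "\<Phi> (scale_op c S) = scale_op c (\<Phi> S)"
      by (rule \<Phi>) (unfold lin_rel_def, rule exI[of _ "\<lambda>n. fscale c (X n)"],
          simp add: lin_fscale tendsto_scale_op X)
    show "\<Phi> (adj_op S) = adj_op (\<Phi> S)"
      by (rule \<Phi>) (unfold lin_rel_def, rule exI[of _ "\<lambda>n. fstar st (X n)"],
          simp add: v.lin_fstar w.lin_fstar tendsto_adj_op(1) X)
  qed
  ultimately show ?thesis
    unfolding star_isomorphic_def star_iso_def by (auto simp: op_algebra_def)
qed

section \<open>Functions on the spectrum\<close>

lemma idem_idem [simp]: "e * e = (e :: 's::inverse_semigroup idem)"
  by transfer (simp add: idempotents_def)

lemma char_fun_mult [simp]: "char_fun \<phi> (e * f) \<longleftrightarrow> char_fun \<phi> e \<and> char_fun \<phi> f"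
  using char_fun[of \<phi>] by blast

lemma char_fun_nonzero: "\<exists>e. char_fun \<phi> e"
  using char_fun[of \<phi>] by blast

lemma spectrum_eqI: "(\<And>e. char_fun \<phi> e = char_fun \<psi> e) \<Longrightarrow> \<phi> = \<psi>"
  by (simp add: char_fun_inject[symmetric] fun_eq_iff)

lemma mem_spectrum_D [simp]: "\<phi> \<in> spectrum_D e \<longleftrightarrow> char_fun \<phi> e"
  by (simp add: spectrum_D_def)

lemma open_char_fun_vimage: "open V \<Longrightarrow> open (char_fun -` V)"
  unfolding open_spectrum_def by blast

lemma open_Collect_char_fun: "open {\<phi>. char_fun \<phi> e = b}"
proof -
  have "open {f :: 'a idem \<Rightarrow> bool. \<forall>i\<in>{()}. f e \<in> {b}}"
    by (rule product_topology_basis') (auto simp: open_discrete)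
  then have "open (char_fun -` {f. \<forall>i\<in>{()}. f e \<in> {b}})" by (rule open_char_fun_vimage)
  then show ?thesis by (simp add: vimage_def)
qed

lemma open_spectrum_D [simp]: "open (spectrum_D e)"
  using open_Collect_char_fun[of e True] by (simp add: spectrum_D_def)

lemma closed_spectrum_D [simp]: "closed (spectrum_D e)"
proof -
  have "- spectrum_D e = {\<phi>. char_fun \<phi> e = False}" by auto
  then show ?thesis using open_Collect_char_fun[of e False] by (simp add: closed_def)
qed

text \<open>The characters in question correspond to the maps in \<open>K\<close>, a closed subset
  of a product of two-point spaces. Requiring the value at \<open>e\<close> to be true excludes the
  zero map by a closed condition; on the whole spectrum this exclusion is not a closed condition in
  general.\<close>

lemma compact_spectrum_D [simp]: "compact (spectrum_D e)"
proof (rule compactI)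
  fix C assume C: "\<forall>U\<in>C. open U" and cov: "spectrum_D e \<subseteq> \<Union>C"
  define K where "K = {f :: 'a idem \<Rightarrow> bool. f e \<and> (\<forall>a b. f (a * b) \<longleftrightarrow> f a \<and> f b)}"
  have ev: "open {f :: 'a idem \<Rightarrow> bool. f a = b}" for a b
    using product_topology_basis'[of "{()}" "\<lambda>_. {b}" "\<lambda>_. a"] by (simp add: open_discrete)
  have "closed {f :: 'a idem \<Rightarrow> bool. f (a * b) \<longleftrightarrow> f a \<and> f b}" for a b
  proof -
    have "- {f :: 'a idem \<Rightarrow> bool. f (a * b) \<longleftrightarrow> f a \<and> f b}
      = {f. f (a * b) = True} \<inter> ({f. f a = False} \<union> {f. f b = False})
        \<union> {f. f (a * b) = False} \<inter> {f. f a = True} \<inter> {f. f b = True}" by auto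
    also have "open \<dots>" by (intro open_Un open_Int ev)
    finally show ?thesis by (simp add: closed_def)
  qed
  then have "closed (\<Inter>a. \<Inter>b. {f :: 'a idem \<Rightarrow> bool. f (a * b) \<longleftrightarrow> f a \<and> f b})"
    by (intro closed_INT ballI)
  moreover have "closed {f :: 'a idem \<Rightarrow> bool. f e}"
  proof -
    have "- {f :: 'a idem \<Rightarrow> bool. f e} = {f. f e = False}" by auto
    then show ?thesis using ev[of e False] by (simp add: closed_def)
  qed
  moreover have "K = {f. f e} \<inter> (\<Inter>a. \<Inter>b. {f. f (a * b) \<longleftrightarrow> f a \<and> f b})"
    by (auto simp: K_def)
  ultimately have "closed K" by auto
  moreover have "compact (UNIV :: ('a idem \<Rightarrow> bool) set)"
  proof -
    have "compact_space (product_topology (\<lambda>i::'a idem. euclidean :: bool topology) UNIV)"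
      by (simp add: compact_space_product_topology) (simp add: compact_space_def finite_imp_compact)
    then show ?thesis unfolding euclidean_product_topology compact_space_def by simp
  qed
  ultimately have K: "compact K" using compact_Int_closed[of UNIV K] by simp
  have "\<forall>U\<in>C. \<exists>V. open V \<and> U = char_fun -` V" using C by (simp add: open_spectrum_def)
  then obtain V where "\<forall>U\<in>C. open (V U) \<and> U = char_fun -` V U"
    by (rule bchoice[THEN exE])
  then have V: "open (V U)" "\<phi> \<in> U \<longleftrightarrow> char_fun \<phi> \<in> V U" if "U \<in> C" for U \<phi>
    using that by blast+
  have "K \<subseteq> (\<Union>U\<in>C. V U)"
  proof
    fix f assume f: "f \<in> K"
    then have f': "char_fun (Abs_spectrum f) = f"
      by (intro Abs_spectrum_inverse) (auto simp: K_def)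
    then have "Abs_spectrum f \<in> spectrum_D e" using f by (simp add: K_def)
    then obtain U where "U \<in> C" "Abs_spectrum f \<in> U" using cov by blast
    then show "f \<in> (\<Union>U\<in>C. V U)" using V(2)[of U "Abs_spectrum f"] f' by auto
  qed
  then obtain C' where C': "C' \<subseteq> C" "finite C'" "K \<subseteq> (\<Union>U\<in>C'. V U)"
    using compactE_image[OF K, of C V] V(1) by blast
  have "spectrum_D e \<subseteq> \<Union>C'"
  proof
    fix \<phi> assume "\<phi> \<in> spectrum_D e"
    then have "char_fun \<phi> \<in> K" by (simp add: K_def)
    then obtain U where "U \<in> C'" "char_fun \<phi> \<in> V U" using C'(3) by blast
    then show "\<phi> \<in> \<Union>C'" using V(2) C'(1) by blast
  qed
  then show "\<exists>C'\<subseteq>C. finite C' \<and> spectrum_D e \<subseteq> \<Union>C'" using C' by blast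
qed

text \<open>A character is dominated on finitely many idempotents by one idempotent \<open>e\<close>, so that its
  values there are those of the principal character of \<open>e\<close>.\<close>

lemma char_fun_finite_meet:
  assumes "finite A" "char_fun \<phi> e1"
  shows "\<exists>e. char_fun \<phi> (e1 * e) \<and> (\<forall>a\<in>A. char_fun \<phi> a \<longrightarrow> e1 * e * a = e1 * e)"
  using assms(1)
proof induction
  case empty then show ?case using assms(2) by (auto intro!: exI[of _ e1])
next
  case (insert a A)
  then obtain e where e: "char_fun \<phi> (e1 * e)" "\<forall>a\<in>A. char_fun \<phi> a \<longrightarrow> e1 * e * a = e1 * e" by blast
  show ?case
  proof (cases "char_fun \<phi> a")
    case True
    have "e1 * (e * a) * b = e1 * (e * a)" if "b \<in> insert a A" "char_fun \<phi> b" for b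
    proof (cases "b = a")
      case True then show ?thesis by (simp add: mult.assoc)
    next
      case False
      then have "e1 * e * b = e1 * e" using e that by blast
      moreover have "e1 * (e * a) * b = e1 * e * b * a" by (simp add: mult_ac)
      ultimately show ?thesis by (simp add: mult.assoc)
    qed
    then show ?thesis using True e(1) by (intro exI[of _ "e * a"]) auto
  next
    case False then show ?thesis using e by blast
  qed
qed

text \<open>For finite \<open>F\<close> these compact open sets form a basis. A single positive
  condition is enough, since finitely many are combined by a meet.\<close>

definition basic_open :: "'s::inverse_semigroup idem \<Rightarrow> 's idem set \<Rightarrow> 's spectrum set" where
  "basic_open e F = {\<psi>. char_fun \<psi> e \<and> (\<forall>f\<in>F. \<not> char_fun \<psi> f)}"

lemma open_basic_open: "finite F \<Longrightarrow> open (basic_open e F)"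
proof -
  assume F: "finite F"
  have eq: "basic_open e F = spectrum_D e \<inter> (\<Inter>f\<in>F. - spectrum_D f)"
    by (auto simp: basic_open_def)
  show ?thesis unfolding eq
    by (intro open_Int open_INT ballI F open_spectrum_D open_Compl closed_spectrum_D)
qed

text \<open>The neighbourhood can be taken below a prescribed idempotent \<open>e1\<close> true at
  the character. Choosing \<open>e1\<close> in an ideal keeps the whole basic set within that
  ideal.\<close>

lemma basic_open_nbhd:
  assumes V: "open V" "\<phi> \<in> V" and e1: "char_fun \<phi> e1"
  shows "\<exists>e F. finite F \<and> \<phi> \<in> basic_open (e1 * e) F \<and> basic_open (e1 * e) F \<subseteq> V"
proof -
  obtain W where W: "open W" "V = char_fun -` W" using V(1) unfolding open_spectrum_def by blast
  have "openin (product_topology (\<lambda>i. euclidean) UNIV) W" "char_fun \<phi> \<in> W"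
    using W V by (simp_all add: euclidean_product_topology)
  then obtain X where X: "char_fun \<phi> \<in> (\<Pi>\<^sub>E i\<in>UNIV. X i)" "finite {i. X i \<noteq> UNIV}" "(\<Pi>\<^sub>E i\<in>UNIV. X
      i) \<subseteq> W"
    using product_topology_open_contains_basis[of "\<lambda>i. euclidean" UNIV W "char_fun \<phi>"] by auto
  define A where "A = {i. X i \<noteq> UNIV}"
  obtain e where e: "char_fun \<phi> (e1 * e)" "\<forall>a\<in>A. char_fun \<phi> a \<longrightarrow> e1 * e * a = e1 * e"
    using char_fun_finite_meet[OF _ e1, of A] X(2) unfolding A_def by blast
  \<comment> \<open>\<open>A\<close> holds the finitely many coordinates constrained by the product
    neighbourhood. Those true at \<open>\<phi>\<close> are implied by \<open>e1 * e\<close>, so only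
    the false ones have to be excluded.\<close>
  let ?F = "{a\<in>A. \<not> char_fun \<phi> a}"
  have "\<psi> \<in> V" if \<psi>: "\<psi> \<in> basic_open (e1 * e) ?F" for \<psi>
  proof -
    have "char_fun \<psi> a = char_fun \<phi> a" if "a \<in> A" for a
    proof (cases "char_fun \<phi> a")
      case True
      then have "e1 * e * a = e1 * e" using e that by blast
      then have "char_fun \<psi> (e1 * e * a)" using \<psi> by (simp add: basic_open_def)
      then show ?thesis using True by simp
    qed (use \<psi> that in \<open>auto simp: basic_open_def\<close>)
    then have "char_fun \<psi> a \<in> X a" for a
      using X(1) by (cases "a \<in> A") (auto simp: A_def PiE_iff)
    then show ?thesis using X(3) W(2) by auto
  qed
  moreover have "\<phi> \<in> basic_open (e1 * e) ?F" using e(1) by (simp add: basic_open_def)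
  ultimately show ?thesis using X(2) unfolding A_def
    by (intro exI[of _ e] exI[of _ ?F]) (auto simp: A_def)
qed

section \<open>Functions vanishing at infinity\<close>

lemma C0_I:
  assumes "continuous_on UNIV f" "\<And>e. 0 < e \<Longrightarrow> compact {x. e \<le> cmod (f x)}" "\<And>x. x \<notin> U \<Longrightarrow> f x = 0"
  shows "f \<in> C0 U"
  using assms by (simp add: C0_def)

lemma C0_continuous: "f \<in> C0 U \<Longrightarrow> continuous_on UNIV f"
  by (simp add: C0_def)

lemma C0_compact: "f \<in> C0 U \<Longrightarrow> 0 < e \<Longrightarrow> compact {x. e \<le> cmod (f x)}"
  by (simp add: C0_def)

lemma C0_outside: "f \<in> C0 U \<Longrightarrow> x \<notin> U \<Longrightarrow> f x = 0"
  by (simp add: C0_def)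

lemma C0_restrict: "f \<in> C0 V \<Longrightarrow> (\<And>x. x \<notin> U \<Longrightarrow> f x = 0) \<Longrightarrow> f \<in> C0 U"
  by (simp add: C0_def)

lemma C0_UNIV: "f \<in> C0 U \<Longrightarrow> f \<in> C0 UNIV"
  by (simp add: C0_def)

lemma compact_level_set:
  fixes f :: "'x::topological_space \<Rightarrow> complex"
  assumes K: "compact K" and f: "continuous_on UNIV f" and sub: "{x. e \<le> cmod (f x)} \<subseteq> K"
  shows "compact {x. e \<le> cmod (f x)}"
proof -
  have "closed {x. e \<le> cmod (f x)}"
    using f by (intro closed_Collect_le continuous_intros) auto
  then have "compact (K \<inter> {x. e \<le> cmod (f x)})" by (rule compact_Int_closed[OF K])
  then show ?thesis using sub by (simp add: Int_absorb1)
qed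

lemma C0_zero [simp]: "(\<lambda>x. 0) \<in> C0 U"
proof (rule C0_I)
  show "compact {x::'a. e \<le> cmod 0}" if "0 < e" for e using that by simp
qed auto

lemma C0_add:
  assumes f: "f \<in> C0 U" and g: "g \<in> C0 U" shows "(\<lambda>x. f x + g x) \<in> C0 U"
proof (rule C0_I)
  show c: "continuous_on UNIV (\<lambda>x. f x + g x)"
    by (intro continuous_intros C0_continuous[OF f] C0_continuous[OF g])
  fix e :: real assume e: "0 < e"
  have "{x. e \<le> cmod (f x + g x)} \<subseteq> {x. e/2 \<le> cmod (f x)} \<union> {x. e/2 \<le> cmod (g x)}"
  proof
    fix x assume "x \<in> {x. e \<le> cmod (f x + g x)}"
    then show "x \<in> {x. e/2 \<le> cmod (f x)} \<union> {x. e/2 \<le> cmod (g x)}"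
      using norm_triangle_ineq[of "f x" "g x"] by auto
  qed
  moreover have "compact ({x. e/2 \<le> cmod (f x)} \<union> {x. e/2 \<le> cmod (g x)})"
    using C0_compact[OF f, of "e/2"] C0_compact[OF g, of "e/2"] e by (intro compact_Un) auto
  ultimately show "compact {x. e \<le> cmod (f x + g x)}" using compact_level_set c by blast
qed (simp add: C0_outside[OF f] C0_outside[OF g])

lemma C0_dominated:
  assumes f: "f \<in> C0 U" and g: "continuous_on UNIV g" and B: "\<And>x. cmod (g x) \<le> B * cmod (f x)"
  shows "g \<in> C0 U"
proof (rule C0_I)
  show "g x = 0" if "x \<notin> U" for x using B[of x] C0_outside[OF f that] by simp
  fix e :: real assume e: "0 < e"
  \<comment> \<open>The maximum with 1 makes the bound positive, so that dividing by it is
    allowed.\<close>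
  define B' where "B' = max B 1"
  have B': "B' > 0" "cmod (g x) \<le> B' * cmod (f x)" for x
    using B[of x] mult_right_mono[of B B' "cmod (f x)"] by (auto simp: B'_def intro: order_trans)
  have "{x. e \<le> cmod (g x)} \<subseteq> {x. e / B' \<le> cmod (f x)}"
    using B' by (auto simp: divide_le_eq mult.commute intro: order_trans)
  then show "compact {x. e \<le> cmod (g x)}"
    using compact_level_set[OF C0_compact[OF f, of "e / B'"] g] e B'(1) by simp
qed (rule g)

lemma C0_scale:
  assumes f: "f \<in> C0 U" shows "(\<lambda>x. c * f x) \<in> C0 U"
  by (rule C0_dominated[OF f, where B="cmod c"])
    (auto intro!: continuous_intros C0_continuous[OF f] simp: norm_mult)

lemma C0_diff: "f \<in> C0 U \<Longrightarrow> g \<in> C0 U \<Longrightarrow> (\<lambda>x. f x - g x) \<in> C0 U"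
  using C0_add[of f U "\<lambda>x. -1 * g x"] C0_scale[of g U "-1"] by simp

lemma C0_cnj:
  assumes f: "f \<in> C0 U" shows "(\<lambda>x. cnj (f x)) \<in> C0 U"
  by (rule C0_dominated[OF f, where B=1]) (auto intro!: continuous_intros C0_continuous[OF f])

lemma C0_bounded:
  assumes f: "f \<in> C0 U"
  obtains B where "\<And>x. cmod (f x) \<le> B" "0 < B"
proof -
  have "compact (f ` {x. 1 \<le> cmod (f x)})"
    using C0_continuous[OF f] C0_compact[OF f, of 1]
    by (intro compact_continuous_image) (auto intro: continuous_on_subset)
  then have "bounded (f ` {x. 1 \<le> cmod (f x)})" by (rule compact_imp_bounded)
  then obtain B where B: "\<And>y. y \<in> f ` {x. 1 \<le> cmod (f x)} \<Longrightarrow> norm y \<le> B"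
    unfolding bounded_iff by auto
  have "cmod (f x) \<le> max B 1" for x
  proof (cases "1 \<le> cmod (f x)")
    case True
    then have "cmod (f x) \<le> B" by (intro B) auto
    then show ?thesis by simp
  qed simp
  then show thesis by (intro that[of "max B 1"]) auto
qed

lemma C0_mult:
  assumes "f \<in> C0 U" "g \<in> C0 V" shows "(\<lambda>x. f x * g x) \<in> C0 U"
proof -
  obtain B where B: "\<And>x. cmod (g x) \<le> B" using C0_bounded[OF assms(2)] by blast
  show ?thesis
  proof (rule C0_dominated[OF assms(1)])
    show "continuous_on UNIV (\<lambda>x. f x * g x)"
      by (intro continuous_on_mult C0_continuous[OF assms(1)] C0_continuous[OF assms(2)])
    show "cmod (f x * g x) \<le> B * cmod (f x)" for x
      using mult_right_mono[OF B[of x], of "cmod (f x)"] by (simp add: norm_mult mult.commute)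
  qed
qed

lemma C0_approx:
  assumes "\<And>e. 0 < e \<Longrightarrow> \<exists>g\<in>C0 U. \<forall>x. cmod (f x - g x) < e"
  shows "f \<in> C0 U"
proof (rule C0_I)
  have "\<exists>g\<in>C0 U. \<forall>x. cmod (f x - g x) < inverse (Suc n)" for n by (rule assms) simp
  then obtain g where g: "\<And>n. g n \<in> C0 U" "\<And>n x. cmod (f x - g n x) < inverse (Suc n)" by metis
  have "uniform_limit UNIV g f sequentially"
  proof (rule uniform_limitI)
    fix e :: real assume "0 < e"
    then have "\<forall>\<^sub>F n in sequentially. inverse (real (Suc n)) < e"
      using LIMSEQ_inverse_real_of_nat order_tendstoD(2) by blast
    then show "\<forall>\<^sub>F n in sequentially. \<forall>x\<in>UNIV. dist (g n x) (f x) < e"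
      by eventually_elim (metis g(2) dist_norm norm_minus_commute less_trans)
  qed
  then show c: "continuous_on UNIV f"
    by (rule uniform_limit_theorem[rotated]) (auto intro!: always_eventually C0_continuous g)
  fix e :: real assume e: "0 < e"
  obtain h where h: "h \<in> C0 U" "\<And>x. cmod (f x - h x) < e / 2" using assms[of "e/2"] e by auto
  have "{x. e \<le> cmod (f x)} \<subseteq> {x. e/2 \<le> cmod (h x)}"
  proof
    fix x assume "x \<in> {x. e \<le> cmod (f x)}"
    then show "x \<in> {x. e/2 \<le> cmod (h x)}"
      using norm_triangle_sub[of "f x" "h x"] h(2)[of x] by auto
  qed
  then show "compact {x. e \<le> cmod (f x)}"
    using compact_level_set[OF C0_compact[OF h(1), of "e/2"] c] e by simp
next
  fix x assume x: "x \<notin> U"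
  have "cmod (f x) < e" if e: "0 < e" for e
  proof -
    obtain g where "g \<in> C0 U" "cmod (f x - g x) < e" using assms[OF e] by blast
    then show ?thesis using C0_outside[OF _ x, of g] by simp
  qed
  from this[of "cmod (f x)"] show "f x = 0" by auto
qed

section \<open>Density of combinations of indicators\<close>

abbreviation chi :: "'s::inverse_semigroup idem \<Rightarrow> 's spectrum \<Rightarrow> complex" where
  "chi e \<equiv> indicator (spectrum_D e)"

lemma chi_mult: "chi (e * f) \<phi> = chi e \<phi> * chi f \<phi>"
  by (simp add: indicator_def)

lemma continuous_indicator_clopen:
  assumes "open U" "closed U"
  shows "continuous_on UNIV (indicator U :: _ \<Rightarrow> complex)"
proof -
  have eq: "indicator U = (\<lambda>x. if x \<in> U then 1 else 0 :: complex)"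
    by (auto simp: indicator_def)
  have "continuous_on (U \<union> - U) (\<lambda>x. if x \<in> U then 1 else 0 :: complex)"
    by (rule continuous_on_If) (use assms in \<open>auto simp: closed_Compl\<close>)
  then show ?thesis unfolding eq Compl_partition .
qed

lemma chi_C0: "chi e \<in> C0 (spectrum_D e)"
proof (rule C0_I)
  show c: "continuous_on UNIV (chi e)" by (rule continuous_indicator_clopen) auto
  fix r :: real assume "0 < r"
  then show "compact {x. r \<le> cmod (chi e x)}"
    by (intro compact_level_set[OF compact_spectrum_D[of e] c])
        (auto simp: indicator_def split: if_splits)
qed (simp add: indicator_def)

lemmas chi_C0_UNIV = C0_UNIV[OF chi_C0]

text \<open>Used with \<open>B\<close> an ideal of the semilattice: for all idempotents it gives a
  dense subspace of the functions on the spectrum, for \<open>ran_idems g\<close> one of the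
  functions on the domain belonging to g.\<close>

definition simple_on :: "'s::inverse_semigroup idem set \<Rightarrow> ('s spectrum \<Rightarrow> complex) set" where
  "simple_on B = {f. \<exists>xs. snd ` set xs \<subseteq> B \<and> f = (\<lambda>\<phi>. fsum (\<lambda>e. chi e \<phi>) xs)}"

lemma simple_onI: "snd ` set xs \<subseteq> B \<Longrightarrow> (\<lambda>\<phi>. fsum (\<lambda>e. chi e \<phi>) xs) \<in> simple_on B"
  unfolding simple_on_def by blast

lemma simple_on_zero: "(\<lambda>\<phi>. 0) \<in> simple_on B"
  using simple_onI[of "[]" B] by simp

lemma simple_on_chi: "e \<in> B \<Longrightarrow> chi e \<in> simple_on B"
  using simple_onI[of "[(1, e)]" B] by simp

lemma simple_on_add:
  assumes "f \<in> simple_on B" "g \<in> simple_on B" shows "(\<lambda>\<phi>. f \<phi> + g \<phi>) \<in> simple_on B"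
proof -
  obtain xs ys where "snd ` set xs \<subseteq> B" "snd ` set ys \<subseteq> B"
    and fg: "f = (\<lambda>\<phi>. fsum (\<lambda>e. chi e \<phi>) xs)" "g = (\<lambda>\<phi>. fsum (\<lambda>e. chi e \<phi>) ys)"
    using assms unfolding simple_on_def by blast
  then show ?thesis using simple_onI[of "xs @ ys" B] by auto
qed

lemma simple_on_scale:
  assumes "f \<in> simple_on B" shows "(\<lambda>\<phi>. c * f \<phi>) \<in> simple_on B"
proof -
  obtain xs where xs: "snd ` set xs \<subseteq> B" "f = (\<lambda>\<phi>. fsum (\<lambda>e. chi e \<phi>) xs)"
    using assms unfolding simple_on_def by blast
  have "snd ` set (fscale c xs) \<subseteq> B" using xs(1) by (force simp: fscale_def)
  from simple_onI[OF this] show ?thesis by (simp add: xs(2) fsum_fscale)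
qed

lemma simple_on_mult_chi:
  assumes "f \<in> simple_on B" and ideal: "\<And>e a. e \<in> B \<Longrightarrow> e * a \<in> B"
  shows "(\<lambda>\<phi>. f \<phi> * chi a \<phi>) \<in> simple_on B"
proof -
  obtain xs where xs: "snd ` set xs \<subseteq> B" "f = (\<lambda>\<phi>. fsum (\<lambda>e. chi e \<phi>) xs)"
    using assms(1) unfolding simple_on_def by blast
  have "snd ` set (fmult xs [(1, a)]) \<subseteq> B" using xs(1) ideal by (force simp: fmult_def)
  from simple_onI[OF this] show ?thesis by (simp add: xs(2) fsum_fmult chi_mult)
qed

text \<open>Each excluded idempotent \<open>a\<close> multiplies the indicator by
  \<open>1 - chi a\<close>; the product stays in the span because \<open>B\<close> is an
  ideal.\<close>

lemma simple_on_indicator: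
  assumes "e \<in> B" "finite F" and ideal: "\<And>e a. e \<in> B \<Longrightarrow> e * a \<in> B"
  shows "indicator (basic_open e F) \<in> simple_on B"
  using assms(2)
proof induction
  case empty
  have "basic_open e {} = spectrum_D e" by (auto simp: basic_open_def)
  then show ?case using simple_on_chi[OF assms(1)] by simp
next
  case (insert a F)
  let ?f = "indicator (basic_open e F) :: _ \<Rightarrow> complex"
  have "(\<lambda>\<phi>. ?f \<phi> + (-1) * (?f \<phi> * chi a \<phi>)) \<in> simple_on B"
    by (intro simple_on_add simple_on_scale simple_on_mult_chi[OF insert.IH ideal] insert.IH)
  moreover have "(\<lambda>\<phi>. ?f \<phi> + (-1) * (?f \<phi> * chi a \<phi>)) = indicator (basic_open e (insert a F))"
    by (auto simp: basic_open_def indicator_def)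
  ultimately show ?case by simp
qed

lemma simple_on_mult_basic:
  assumes f: "f \<in> simple_on B" and F: "finite F" and ideal: "\<And>e a. e \<in> B \<Longrightarrow> e * a \<in> B"
  shows "(\<lambda>\<phi>. f \<phi> * indicator (basic_open e F) \<phi>) \<in> simple_on B"
  using F
proof induction
  case empty
  have "basic_open e {} = spectrum_D e" by (auto simp: basic_open_def)
  then show ?case using simple_on_mult_chi[OF f ideal] by simp
next
  case (insert a F)
  let ?f = "\<lambda>\<phi>. f \<phi> * indicator (basic_open e F) \<phi>"
  have "(\<lambda>\<phi>. ?f \<phi> + (-1) * (?f \<phi> * chi a \<phi>)) \<in> simple_on B"
    by (intro simple_on_add simple_on_scale simple_on_mult_chi[OF insert.IH ideal] insert.IH)
  moreover have "(\<lambda>\<phi>. ?f \<phi> + (-1) * (?f \<phi> * chi a \<phi>))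
      = (\<lambda>\<phi>. f \<phi> * indicator (basic_open e (insert a F)) \<phi>)"
    by (auto simp: basic_open_def indicator_def)
  ultimately show ?case by simp
qed

lemma simple_on_C0: 
  assumes "f \<in> simple_on B" "\<And>e. e \<in> B \<Longrightarrow> spectrum_D e \<subseteq> U"
  shows "f \<in> C0 U"
proof -
  obtain xs where xs: "snd ` set xs \<subseteq> B" "f = (\<lambda>\<phi>. fsum (\<lambda>e. chi e \<phi>) xs)"
    using assms(1) unfolding simple_on_def by blast
  have "(\<lambda>\<phi>. fsum (\<lambda>e. chi e \<phi>) xs) \<in> C0 U" using xs(1)
  proof (induction xs)
    case (Cons x xs)
    have "chi (snd x) \<in> C0 U" using Cons.prems assms(2) C0_restrict[OF chi_C0[of "snd x"], of U]
      by (force simp: indicator_def)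
    then have "(\<lambda>\<phi>. fst x * chi (snd x) \<phi> + fsum (\<lambda>e. chi e \<phi>) xs) \<in> C0 U"
      using Cons by (intro C0_add C0_scale) auto
    then show ?case by (cases x) simp
  qed simp
  then show ?thesis using xs(2) by simp
qed

text \<open>Total disconnectedness replaces Stone-Weierstrass: the compact set where
  \<open>f\<close> is at least \<epsilon> in modulus is covered by finitely many basic sets on each
  of which \<open>f\<close> is nearly constant, and constants on basic sets are simple.\<close>

lemma simple_on_dense:
  fixes f :: "'s::inverse_semigroup spectrum \<Rightarrow> complex"
  assumes f: "f \<in> C0 U" and U: "U \<subseteq> (\<Union>e\<in>B. spectrum_D e)"
    and ideal: "\<And>e a. e \<in> B \<Longrightarrow> e * a \<in> B" and \<epsilon>: "0 < \<epsilon>"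
  shows "\<exists>g\<in>simple_on B. \<forall>\<phi>. cmod (f \<phi> - g \<phi>) < \<epsilon>"
proof -
  define K where "K = {\<phi>. \<epsilon> \<le> cmod (f \<phi>)}"
  have K: "compact K" unfolding K_def by (rule C0_compact[OF f \<epsilon>])
  have "\<exists>e F. e \<in> B \<and> finite F \<and> \<phi> \<in> basic_open e F \<and>
      (\<forall>\<psi>\<in>basic_open e F. cmod (f \<psi> - f \<phi>) < \<epsilon>)" if "\<phi> \<in> K" for \<phi>
  proof -
    have "\<phi> \<in> U" using that C0_outside[OF f] \<epsilon> unfolding K_def by force
    then obtain e1 where e1: "e1 \<in> B" "char_fun \<phi> e1" using U by auto
    have "open {\<psi>. cmod (f \<psi> - f \<phi>) < \<epsilon>}"
      by (intro open_Collect_less continuous_intros C0_continuous[OF f])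
    then obtain e F where "finite F" "\<phi> \<in> basic_open (e1 * e) F"
      "basic_open (e1 * e) F \<subseteq> {\<psi>. cmod (f \<psi> - f \<phi>) < \<epsilon>}"
      using basic_open_nbhd[OF _ _ e1(2), of "{\<psi>. cmod (f \<psi> - f \<phi>) < \<epsilon>}"] \<epsilon> by auto
    then show ?thesis using ideal[OF e1(1)] by blast
  qed
  then obtain e F where eF: "\<And>\<phi>. \<phi> \<in> K \<Longrightarrow> e \<phi> \<in> B" "\<And>\<phi>. \<phi> \<in> K \<Longrightarrow> finite (F \<phi>)"
      "\<And>\<phi>. \<phi> \<in> K \<Longrightarrow> \<phi> \<in> basic_open (e \<phi>) (F \<phi>)"
      "\<And>\<phi> \<psi>. \<phi> \<in> K \<Longrightarrow> \<psi> \<in> basic_open (e \<phi>) (F \<phi>) \<Longrightarrow> cmod (f \<psi> - f \<phi>) < \<epsilon>"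
    by metis
  define W where "W \<phi> = basic_open (e \<phi>) (F \<phi>)" for \<phi>
  obtain T where T: "T \<subseteq> K" "finite T" "K \<subseteq> (\<Union>\<phi>\<in>T. W \<phi>)"
    using compactE_image[OF K, of K W] eF(2,3) unfolding W_def
    by (metis (no_types, lifting) UN_I open_basic_open subsetI)
  \<comment> \<open>Vanishing outside the union is carried through the induction for the end: there
    \<open>f\<close> is smaller than \<epsilon>, so the value 0 is close enough.\<close>
  have "\<exists>g\<in>simple_on B. (\<forall>\<psi>\<in>(\<Union>\<phi>\<in>T. W \<phi>). cmod (f \<psi> - g \<psi>) < \<epsilon>) \<and> (\<forall>\<psi>. \<psi> \<notin> (\<Union>\<phi>\<in>T. W \<phi>) \<longrightarrow> g \<psi> = 0)"
    using T(2,1)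
  proof induction
    case empty then show ?case by (intro bexI[of _ "\<lambda>\<phi>. 0"] simple_on_zero) auto
  next
    case (insert \<phi> T)
    then obtain g where g: "g \<in> simple_on B" "\<forall>\<psi>\<in>(\<Union>\<phi>\<in>T. W \<phi>). cmod (f \<psi> - g \<psi>) < \<epsilon>"
      "\<forall>\<psi>. \<psi> \<notin> (\<Union>\<phi>\<in>T. W \<phi>) \<longrightarrow> g \<psi> = 0" by auto
    have \<phi>: "\<phi> \<in> K" using insert by simp
    \<comment> \<open>\<open>h\<close> overwrites \<open>g\<close> on \<open>W \<phi>\<close> by the
      constant \<open>f \<phi>\<close>, so the cover need not be made disjoint.\<close>
    define h where "h \<psi> = (g \<psi> + (-1) * (g \<psi> * indicator (W \<phi>) \<psi>)) + f \<phi> * indicator (W \<phi>) \<psi>" for \<psi>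
    have "h \<in> simple_on B"
      unfolding h_def W_def
      by (intro simple_on_add simple_on_scale simple_on_mult_basic[OF g(1) _ ideal]
          simple_on_indicator[OF _ _ ideal] eF \<phi> g(1))
    moreover have "h \<psi> = (if \<psi> \<in> W \<phi> then f \<phi> else g \<psi>)" for \<psi>
      by (simp add: h_def indicator_def)
    ultimately show ?case using g eF(4)[OF \<phi>] unfolding W_def by (intro bexI[of _ h]) auto
  qed
  then obtain g where g: "g \<in> simple_on B" "\<forall>\<psi>\<in>(\<Union>\<phi>\<in>T. W \<phi>). cmod (f \<psi> - g \<psi>) < \<epsilon>"
    "\<forall>\<psi>. \<psi> \<notin> (\<Union>\<phi>\<in>T. W \<phi>) \<longrightarrow> g \<psi> = 0" by auto
  have "cmod (f \<psi> - g \<psi>) < \<epsilon>" for \<psi>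
  proof (cases "\<psi> \<in> (\<Union>\<phi>\<in>T. W \<phi>)")
    case False
    then have "\<psi> \<notin> K" "g \<psi> = 0" using T(3) g(3) by auto
    then show ?thesis by (simp add: K_def)
  qed (use g in blast)
  then show ?thesis using g(1) by blast
qed

section \<open>The spectral isomorphism\<close>

lemma op_rep_semilattice: "semilattice_rep v \<Longrightarrow> op_rep v id"
  by unfold_locales (simp_all add: semilattice_rep_def)

lemma semilattice_rep_idem:
  assumes "semilattice_rep v" shows "blinfun_apply (v e) (blinfun_apply (v e) x)
      = blinfun_apply (v e) x"
proof -
  have "v (e * e) = v e o\<^sub>L v e" using assms unfolding semilattice_rep_def by blast
  then show ?thesis by (metis blinfun_apply_blinfun_compose idem_idem)
qed

lemma semilattice_rep_commute:
  assumes "semilattice_rep v"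
  shows "blinfun_apply (v e) (blinfun_apply (v f) x) = blinfun_apply (v f) (blinfun_apply (v e) x)"
proof -
  have "v (e * f) = v e o\<^sub>L v f" "v (f * e) = v f o\<^sub>L v e"
    using assms unfolding semilattice_rep_def by blast+
  then show ?thesis by (metis blinfun_apply_blinfun_compose mult.commute)
qed

lemma semilattice_rep_self_adj:
  assumes "semilattice_rep v"
  shows "cinner (blinfun_apply (v e) x) y = cinner x (blinfun_apply (v e) y)"
  using assms cinner_adj[of "v e" x y] unfolding semilattice_rep_def by simp

lemma norm_selfadjoint_idem_le:
  fixes P :: "'h::complex_hilbert op"
  assumes "\<And>x y. cinner (blinfun_apply P x) y = cinner x (blinfun_apply P y)"
    and "\<And>x. blinfun_apply P (blinfun_apply P x) = blinfun_apply P x"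
  shows "norm P \<le> 1"
proof (rule norm_blinfun_bound)
  fix x
  have "(norm (blinfun_apply P x))\<^sup>2 = Re (cinner (blinfun_apply P x) x)"
    by (simp add: norm_square_cinner assms)
  also have "\<dots> \<le> norm (blinfun_apply P x) * norm x"
    using complex_Re_le_cmod cinner_bound order_trans by blast
  finally show "norm (blinfun_apply P x) \<le> 1 * norm x"
    by (cases "norm (blinfun_apply P x) = 0") (auto simp: power2_eq_square mult_le_cancel_left)
qed simp

lemma norm_semilattice_rep_le: "semilattice_rep v \<Longrightarrow> norm (v e) \<le> 1"
  by (rule norm_selfadjoint_idem_le) (simp_all add: semilattice_rep_self_adj semilattice_rep_idem)

definition sfun :: "(complex \<times> 's::inverse_semigroup idem) list \<Rightarrow> 's spectrum \<Rightarrow> complex" where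
  "sfun xs \<phi> = fsum (\<lambda>e. chi e \<phi>) xs"

lemma sfun_simple: "sfun xs \<in> simple_on UNIV"
  using simple_onI[of xs UNIV] unfolding sfun_def[abs_def] by simp

lemma sfun_append: "sfun (xs @ ys) \<phi> = sfun xs \<phi> + sfun ys \<phi>"
  by (simp add: sfun_def)
lemma sfun_fscale: "sfun (fscale c xs) \<phi> = c * sfun xs \<phi>"
  by (simp add: sfun_def fsum_fscale)
lemma sfun_diff: "sfun (xs @ fscale (- 1) ys) \<phi> = sfun xs \<phi> - sfun ys \<phi>"
  by (simp add: sfun_append sfun_fscale)
lemma sfun_fmult: "sfun (fmult xs ys) \<phi> = sfun xs \<phi> * sfun ys \<phi>"
  unfolding sfun_def by (rule fsum_fmult) (rule chi_mult)
lemma sfun_fstar: "sfun (fstar id xs) \<phi> = cnj (sfun xs \<phi>)"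
proof -
  have "(\<lambda>e. cnj (chi (id e) \<phi>)) = (\<lambda>e. chi e \<phi>)" by (auto simp: indicator_def)
  then show ?thesis unfolding sfun_def fsum_fstar by simp
qed

lemma sfun_C0: "sfun xs \<in> C0 UNIV"
  by (rule simple_on_C0[OF sfun_simple]) simp

text \<open>A vector can be split by finitely many of the commuting projections \<open>v e\<close> into orthogonal
  joint eigenvectors \<open>\<xi>\<close>, and the \<open>e\<close> with \<open>v e \<xi> = \<xi>\<close> form a character.\<close>

lemma norm_lin_semilattice_rep_le:
  fixes v :: "'s::inverse_semigroup idem \<Rightarrow> 'h::complex_hilbert op"
  assumes v: "semilattice_rep v" and B: "\<And>\<phi>. cmod (sfun xs \<phi>) \<le> B"
  shows "norm (lin v xs) \<le> B"
proof -
  interpret op_rep v id by (rule op_rep_semilattice[OF v])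
  let ?T = "blinfun_apply (lin v xs)"
  have B0: "0 \<le> B" using B[of undefined] norm_ge_zero order_trans by blast
  have comm: "?T (blinfun_apply (v e) \<xi>) = blinfun_apply (v e) (?T \<xi>)" for e \<xi>
  proof (induction xs)
    case (Cons y ys)
    then show ?case
      by (cases y) (simp add: plus_blinfun.rep_eq blinfun.add_right complex_opsD[OF complex_ops]
          semilattice_rep_commute[OF v, of e])
  qed simp
  have eig: "norm (?T \<xi>) \<le> B * norm \<xi>"
    if \<xi>: "\<And>e. e \<in> snd ` set xs \<Longrightarrow> blinfun_apply (v e) \<xi> = \<xi> \<or> blinfun_apply (v e) \<xi> = 0" for \<xi>
  \<comment> \<open>If all occurring projections kill \<open>\<xi>\<close>, possibly no
    \<open>e\<close> fixes it and there is no character to evaluate at; but then the operator kills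
    \<open>\<xi>\<close> too.\<close>
  proof (cases "\<xi> = 0 \<or> (\<forall>e\<in>snd ` set xs. blinfun_apply (v e) \<xi> = 0)")
    case True
    have "blinfun_apply (lin v ys) \<xi> = 0" if "\<forall>e\<in>snd ` set ys. blinfun_apply (v e) \<xi> = 0" for ys
      using that by (induction ys) (auto simp: plus_blinfun.rep_eq)
    then have "?T \<xi> = 0" using True by auto
    then show ?thesis using B0 by simp
  next
    case False
    define f where "f e \<longleftrightarrow> blinfun_apply (v e) \<xi> = \<xi>" for e
    have ex: "\<exists>e. f e" using False \<xi> unfolding f_def by blast
    have m: "blinfun_apply (v (e * g)) \<xi> = blinfun_apply (v e) (blinfun_apply (v g) \<xi>)" for e g
      by (simp add: mult)
    have f1: "f e" if "f (e * g)" for e g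
    proof -
      have "blinfun_apply (v e) \<xi> = blinfun_apply (v e) (blinfun_apply (v (e * g)) \<xi>)"
        using that by (simp add: f_def)
      also have "\<dots> = blinfun_apply (v (e * g)) \<xi>" by (simp add: m semilattice_rep_idem[OF v])
      finally show ?thesis using that by (simp add: f_def)
    qed
    have "f (e * g) \<longleftrightarrow> f e \<and> f g" for e g
    proof
      assume "f (e * g)"
      then show "f e \<and> f g" using f1[of e g] f1[of g e] by (simp add: mult.commute)
    qed (simp add: f_def m)
    then have cf: "char_fun (Abs_spectrum f) = f" using ex by (intro Abs_spectrum_inverse) auto
    have "blinfun_apply (lin v ys) \<xi> = sfun ys (Abs_spectrum f) *\<^sub>C \<xi>"
      if "set ys \<subseteq> set xs" for ys
      using that
    proof (induction ys)
      case Nil then show ?case by (simp add: sfun_def)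
    next
      case (Cons y ys)
      obtain c e where y: "y = (c, e)" by (cases y)
      have "e \<in> snd ` set xs" using Cons.prems y by force
      then have "blinfun_apply (v e) \<xi> = chi e (Abs_spectrum f) *\<^sub>C \<xi>"
        using \<xi>[of e] False by (auto simp: indicator_def cf f_def)
      then show ?case
        using Cons by (simp add: y sfun_def plus_blinfun.rep_eq scaleC_add_left scaleC_scaleC)
    qed
    then have "norm (?T \<xi>) = cmod (sfun xs (Abs_spectrum f)) * norm \<xi>" by (simp add: norm_scaleC)
    then show ?thesis using B by (simp add: mult_right_mono)
  qed
  \<comment> \<open>\<open>F\<close> holds the idempotents for which \<open>\<xi>\<close> need not
    yet be an eigenvector with value 0 or 1. Splitting by one of them keeps both halves eigenvectors
    for the others, as the projections commute; the operator commutes with them too, so the images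
    of the halves remain orthogonal.\<close>
  have "norm (?T \<xi>) \<le> B * norm \<xi>"
    if "finite F" "\<And>e. e \<in> snd ` set xs - F \<Longrightarrow> blinfun_apply (v e) \<xi> = \<xi> \<or> blinfun_apply (v e) \<xi> = 0"
    for F \<xi>
    using that
  proof (induction F arbitrary: \<xi>)
    case empty then show ?case by (intro eig) auto
  next
    case (insert e F)
    let ?x = "blinfun_apply (v e) \<xi>" and ?y = "\<xi> - blinfun_apply (v e) \<xi>"
    have dec: "norm (?T z) \<le> B * norm z" if z: "z = ?x \<or> z = ?y" for z
    proof (rule insert.IH)
      fix g assume g: "g \<in> snd ` set xs - F"
      show "blinfun_apply (v g) z = z \<or> blinfun_apply (v g) z = 0"
      proof (cases "g = e")
        case True
        then show ?thesis using z by (auto simp: semilattice_rep_idem[OF v] blinfun.diff_right)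
      next
        case False
        then have "blinfun_apply (v g) \<xi> = \<xi> \<or> blinfun_apply (v g) \<xi> = 0"
          using g insert.prems by blast
        then show ?thesis
          using z by (auto simp: semilattice_rep_commute[OF v, of g e] blinfun.diff_right)
      qed
    qed
    have orth: "cinner (blinfun_apply (v e) a) (b - blinfun_apply (v e) b) = 0" for a b
      by (simp add: semilattice_rep_self_adj[OF v] blinfun.diff_right semilattice_rep_idem[OF v]
          cinner.zero_right)
    have pyth: "(norm z)\<^sup>2 = (norm (blinfun_apply (v e) z))\<^sup>2 + (norm (z - blinfun_apply (v e)
        z))\<^sup>2" for z
      using norm_sum_square[of "blinfun_apply (v e) z" "z - blinfun_apply (v e) z"] by
          (simp add: orth)
    have "(norm (?T \<xi>))\<^sup>2 = (norm (?T ?x))\<^sup>2 + (norm (?T ?y))\<^sup>2"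
      unfolding blinfun.diff_right comm by (rule pyth)
    also have "\<dots> \<le> (B * norm ?x)\<^sup>2 + (B * norm ?y)\<^sup>2"
      by (intro add_mono power_mono dec) auto
    also have "\<dots> = (B * norm \<xi>)\<^sup>2" unfolding power_mult_distrib pyth[of \<xi>] by
        (simp add: distrib_left)
    finally show ?case using B0 by (simp add: abs_le_square_iff[symmetric])
  qed
  from this[of "snd ` set xs"] show ?thesis by (intro norm_blinfun_bound[OF B0]) auto
qed

lemma universal_rep_shift:
  "universal_rep e = weighted_shift (\<lambda>v. if semilattice_rep v then v e else 0) id"
proof -
  let ?A = "\<lambda>v. if semilattice_rep v then v e else 0 :: (nat, complex) ell2 op"
  have A: "norm (?A v) \<le> 1" for v by (simp add: norm_semilattice_rep_le)
  have W: "ell2_fun (blinfun_apply (weighted_shift ?A id) \<xi>) v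
      = (if semilattice_rep v then blinfun_apply (v e) (ell2_fun \<xi> v) else 0)" for \<xi> v
    by (subst weighted_shift_apply[where A="?A", OF A]) auto
  show ?thesis
    unfolding universal_rep_def
  proof (rule the_equality)
    fix T :: "'a universal_space op"
    assume T: "\<forall>\<xi> v. ell2_fun (blinfun_apply T \<xi>) v
        = (if semilattice_rep v then blinfun_apply (v e) (ell2_fun \<xi> v) else 0)"
    show "T = weighted_shift ?A id"
      by (rule blinfun_eqI, rule ell2_eqI) (simp only: T W)
  qed (simp only: W, simp)
qed

lemma universal_rep_apply:
  "ell2_fun (blinfun_apply (universal_rep e) \<xi>) v
    = (if semilattice_rep v then blinfun_apply (v e) (ell2_fun \<xi> v) else 0)"
  unfolding universal_rep_shift
  by (subst weighted_shift_apply[where B=1]) (auto simp: norm_semilattice_rep_le)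

lemma semilattice_rep_universal: "semilattice_rep (universal_rep :: 's::inverse_semigroup idem \<Rightarrow> _)"
  unfolding semilattice_rep_def
proof (intro conjI allI)
  fix e f :: "'s idem"
  have z: "\<And>v. norm (if semilattice_rep v then v e else 0 :: (nat, complex) ell2 op) \<le> 1"
    by (simp add: norm_semilattice_rep_le)
  show "universal_rep e \<in> complex_ops"
    unfolding universal_rep_shift by (rule weighted_shift_complex[OF z])
        (auto simp: semilattice_rep_def)
  show "adj_op (universal_rep e) = universal_rep e"
    unfolding universal_rep_shift
    by (rule adj_weighted_shift[OF z _ z]) (auto simp: semilattice_rep_self_adj split: if_splits)
  show "universal_rep (e * f) = universal_rep e o\<^sub>L universal_rep f"
    by (rule blinfun_eqI, rule ell2_eqI) (simp add: universal_rep_apply semilattice_rep_def)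
qed

interpretation universal: op_rep universal_rep id
  by (rule op_rep_semilattice[OF semilattice_rep_universal])

lemma lin_universal_apply:
  "ell2_fun (blinfun_apply (lin universal_rep xs) \<xi>) v
    = (if semilattice_rep v then blinfun_apply (lin v xs) (ell2_fun \<xi> v) else 0)"
  by (induction xs)
    (auto simp: zero_ell2.rep_eq plus_ell2.rep_eq plus_blinfun.rep_eq universal_rep_apply
        scaleC_ell2.rep_eq)

text \<open>A character acting by scalars on the square-summable sequences is one of the summands of
  the universal representation; a unit vector placed in that summand shows its value.\<close>

lemma sfun_le_norm_universal: "cmod (sfun xs \<phi>) \<le> norm (lin universal_rep xs)"
proof -
  define v where "v e = (if char_fun \<phi> e then id_blinfun else 0 :: (nat, complex) ell2 op)" for e
  have adj_id: "adj_op id_blinfun = (id_blinfun :: (nat, complex) ell2 op)"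
    by (rule adj_op_eqI) simp
  have v: "semilattice_rep v"
    by (auto simp: semilattice_rep_def v_def complex_ops_def adj_id intro: blinfun_eqI)
  have lin: "blinfun_apply (lin v xs) x = sfun xs \<phi> *\<^sub>C x" for x
  proof (induction xs)
    case (Cons y xs)
    have "blinfun_apply (v e) x = chi e \<phi> *\<^sub>C x" for e by (simp add: v_def indicator_def)
    then show ?case
      using Cons by (cases y) (simp add: sfun_def plus_blinfun.rep_eq scaleC_add_left scaleC_scaleC)
  qed (simp add: sfun_def)
  define x where "x = (ell2_delta 0 :: (nat, complex) ell2)"
  have x: "norm x = 1" by (simp add: x_def ell2_delta_single norm_ell2_single)
  have "cmod (sfun xs \<phi>) = norm (ell2_fun (blinfun_apply (lin universal_rep xs) (ell2_single v x))
      v)"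
    by (simp add: lin_universal_apply v lin norm_scaleC ell2_single.rep_eq x)
  also have "\<dots> \<le> norm (blinfun_apply (lin universal_rep xs) (ell2_single v x))"
    by (rule norm_ell2_fun_le)
  also have "\<dots> \<le> norm (lin universal_rep xs) * norm (ell2_single v x)" by (rule norm_blinfun)
  finally show ?thesis by (simp add: norm_ell2_single x)
qed

text \<open>The graph of the Gelfand isomorphism, built like \<open>lin_rel\<close>. The estimates
  in the two directions, \<open>sfun_le_norm_universal\<close> and
  \<open>norm_lin_semilattice_rep_le\<close>, say that the universal norm is the supremum norm over
  characters.\<close>

definition sfun_rel :: "('s::inverse_semigroup spectrum \<Rightarrow> complex) \<Rightarrow> 's universal_space op \<Rightarrow> bool"
    where
  "sfun_rel f T \<longleftrightarrow> (\<exists>X. uniform_limit UNIV (\<lambda>n. sfun (X n)) f sequentially \<and>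
     (\<lambda>n. lin universal_rep (X n)) \<longlonglongrightarrow> T)"

lemma sfun_rel_le: "sfun_rel f T \<Longrightarrow> cmod (f \<phi>) \<le> norm T"
proof -
  assume "sfun_rel f T"
  then obtain X where X: "uniform_limit UNIV (\<lambda>n. sfun (X n)) f sequentially"
    "(\<lambda>n. lin universal_rep (X n)) \<longlonglongrightarrow> T" unfolding sfun_rel_def by blast
  have "(\<lambda>n. cmod (sfun (X n) \<phi>)) \<longlonglongrightarrow> cmod (f \<phi>)"
    by (rule tendsto_norm[OF tendsto_uniform_limitI[OF X(1)]]) simp
  then show ?thesis
    using tendsto_norm[OF X(2)] by (rule LIMSEQ_le) (auto intro: sfun_le_norm_universal)
qed

lemma sfun_rel_norm_le:
  assumes "sfun_rel f T" and B: "\<And>\<phi>. cmod (f \<phi>) \<le> B"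
  shows "norm T \<le> B"
proof (rule field_le_epsilon)
  obtain X where X: "uniform_limit UNIV (\<lambda>n. sfun (X n)) f sequentially"
    "(\<lambda>n. lin universal_rep (X n)) \<longlonglongrightarrow> T" using assms(1) unfolding sfun_rel_def by blast
  fix e :: real assume e: "0 < e"
  have "\<forall>\<^sub>F n in sequentially. norm (lin universal_rep (X n)) \<le> B + e"
    using uniform_limitD[OF X(1) e]
  proof eventually_elim
    case (elim n)
    have "cmod (sfun (X n) \<phi>) \<le> B + e" for \<phi>
    proof -
      have "dist (sfun (X n) \<phi>) (f \<phi>) < e" using elim by simp
      then show ?thesis
        using B[of \<phi>] norm_triangle_sub[of "sfun (X n) \<phi>" "f \<phi>"] by (simp add: dist_norm)
    qed
    then show ?case by (rule norm_lin_semilattice_rep_le[OF semilattice_rep_universal])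
  qed
  then show "norm T \<le> B + e"
    by (rule tendsto_upperbound[OF tendsto_norm[OF X(2)]]) simp
qed

lemma sfun_rel_diff:
  assumes "sfun_rel f T" "sfun_rel g S" shows "sfun_rel (\<lambda>\<phi>. f \<phi> - g \<phi>) (T - S)"
proof -
  obtain X Y where XY: "uniform_limit UNIV (\<lambda>n. sfun (X n)) f sequentially"
    "(\<lambda>n. lin universal_rep (X n)) \<longlonglongrightarrow> T"
    "uniform_limit UNIV (\<lambda>n. sfun (Y n)) g sequentially"
    "(\<lambda>n. lin universal_rep (Y n)) \<longlonglongrightarrow> S" using assms unfolding sfun_rel_def by blast
  show ?thesis unfolding sfun_rel_def
    by (rule exI[of _ "\<lambda>n. X n @ fscale (-1) (Y n)"])
      (simp only: sfun_diff[abs_def] lin_diff, intro conjI uniform_limit_minus tendsto_diff XY)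
qed

lemma sfun_rel_C0:
  assumes "sfun_rel f T" shows "f \<in> C0 UNIV"
proof (rule C0_approx)
  fix e :: real assume e: "0 < e"
  obtain X where X: "uniform_limit UNIV (\<lambda>n. sfun (X n)) f sequentially"
    using assms unfolding sfun_rel_def by blast
  obtain n where "\<forall>x\<in>UNIV. dist (sfun (X n) x) (f x) < e"
    using uniform_limitD[OF X e] eventually_happens sequentially_bot by blast
  then have "\<forall>x. cmod (f x - sfun (X n) x) < e" by (simp add: dist_norm norm_minus_commute)
  then show "\<exists>g\<in>C0 UNIV. \<forall>x. cmod (f x - g x) < e" using sfun_C0 by blast
qed

lemma sfun_rel_total:
  assumes f: "f \<in> C0 UNIV" shows "\<exists>T. sfun_rel f T"
proof -
  have "\<exists>xs. \<forall>\<phi>. cmod (f \<phi> - sfun xs \<phi>) < inverse (Suc n)" for n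
    using simple_on_dense[OF f, of UNIV "inverse (Suc n)"] char_fun_nonzero
    unfolding simple_on_def sfun_def by (fastforce simp del: of_nat_Suc)
  then obtain X where X: "\<And>n \<phi>. cmod (f \<phi> - sfun (X n) \<phi>) < inverse (Suc n)" by metis
  have ul: "uniform_limit UNIV (\<lambda>n. sfun (X n)) f sequentially"
  proof (rule uniform_limitI)
    fix e :: real assume "0 < e"
    then have "\<forall>\<^sub>F n in sequentially. inverse (real (Suc n)) < e"
      using LIMSEQ_inverse_real_of_nat order_tendstoD(2) by blast
    then show "\<forall>\<^sub>F n in sequentially. \<forall>x\<in>UNIV. dist (sfun (X n) x) (f x) < e"
      by eventually_elim (metis X dist_norm norm_minus_commute less_trans)
  qed
  have "Cauchy (\<lambda>n. lin universal_rep (X n))"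
  proof (rule CauchyI)
    fix e :: real assume e: "0 < e"
    obtain N where N: "\<And>n. N \<le> n \<Longrightarrow> \<forall>x\<in>UNIV. dist (sfun (X n) x) (f x) < e / 4"
      using uniform_limitD[OF ul, of "e/4"] e unfolding eventually_sequentially by auto
    have "norm (lin universal_rep (X m) - lin universal_rep (X n)) \<le> e / 2" if "N \<le> m" "N \<le> n"
        for m n
      unfolding lin_diff[symmetric]
    proof (rule norm_lin_semilattice_rep_le[OF semilattice_rep_universal])
      fix \<phi>
      have "dist (sfun (X m) \<phi>) (sfun (X n) \<phi>) < e / 2"
        by (rule dist_triangle_half_l[of _ "f \<phi>"]) (use N that in auto)
      then show "cmod (sfun (X m @ fscale (- 1) (X n)) \<phi>) \<le> e / 2"
        unfolding sfun_diff by (simp add: dist_norm)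
    qed
    then have "norm (lin universal_rep (X m) - lin universal_rep (X n)) < e" if "N \<le> m" "N \<le> n"
        for m n
      using that e by fastforce
    then show "\<exists>M. \<forall>m\<ge>M. \<forall>n\<ge>M. norm (lin universal_rep (X m) - lin universal_rep (X n)) < e"
      by blast
  qed
  then show ?thesis unfolding sfun_rel_def using ul Cauchy_convergent convergent_def by blast
qed

lemma sfun_rel_onto:
  assumes "T \<in> closure (range (lin universal_rep))" shows "\<exists>f. sfun_rel f T"
proof -
  obtain X where X: "(\<lambda>n. lin universal_rep (X n)) \<longlonglongrightarrow> T" using closure_rangeE[OF assms] by blast
  have "uniformly_Cauchy_on UNIV (\<lambda>n. sfun (X n))"
  proof (rule uniformly_Cauchy_onI)
    fix e :: real assume "0 < e"
    then obtain M where M: "\<And>m n. M \<le> m \<Longrightarrow> M \<le> n \<Longrightarrow>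
        norm (lin universal_rep (X m) - lin universal_rep (X n)) < e"
      using LIMSEQ_imp_Cauchy[OF X] unfolding Cauchy_iff by blast
    have "dist (sfun (X m) \<phi>) (sfun (X n) \<phi>) < e" if "M \<le> m" "M \<le> n" for m n \<phi>
      using sfun_le_norm_universal[of "X m @ fscale (- 1) (X n)" \<phi>] M[OF that]
      unfolding sfun_diff lin_diff dist_norm by linarith
    then show "\<exists>M. \<forall>x\<in>UNIV. \<forall>m\<ge>M. \<forall>n\<ge>M. dist (sfun (X m) x) (sfun (X n) x) < e" by blast
  qed
  then show ?thesis
    unfolding uniformly_convergent_eq_Cauchy[symmetric] uniformly_convergent_on_def sfun_rel_def
    using X by blast
qed

lemma sfun_rel_unique: "sfun_rel f T \<Longrightarrow> sfun_rel f S \<Longrightarrow> T = S"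
  using sfun_rel_norm_le[OF sfun_rel_diff, of f T f S 0] by simp

lemma sfun_rel_unique': "sfun_rel f T \<Longrightarrow> sfun_rel g T \<Longrightarrow> f = g"
  using sfun_rel_le[OF sfun_rel_diff, of f T g T] by (auto simp: fun_eq_iff)

lemma sfun_rel_add:
  assumes "sfun_rel f T" "sfun_rel g S" shows "sfun_rel (\<lambda>\<phi>. f \<phi> + g \<phi>) (T + S)"
proof -
  obtain X Y where XY: "uniform_limit UNIV (\<lambda>n. sfun (X n)) f sequentially"
    "(\<lambda>n. lin universal_rep (X n)) \<longlonglongrightarrow> T"
    "uniform_limit UNIV (\<lambda>n. sfun (Y n)) g sequentially"
    "(\<lambda>n. lin universal_rep (Y n)) \<longlonglongrightarrow> S" using assms unfolding sfun_rel_def by blast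
  show ?thesis unfolding sfun_rel_def
    by (rule exI[of _ "\<lambda>n. X n @ Y n"])
      (simp only: sfun_append[abs_def] lin_simps, intro conjI uniform_limit_add tendsto_add XY)
qed

lemma sfun_rel_mult:
  assumes "sfun_rel f T" "sfun_rel g S" shows "sfun_rel (\<lambda>\<phi>. f \<phi> * g \<phi>) (T o\<^sub>L S)"
proof -
  obtain X Y where XY: "uniform_limit UNIV (\<lambda>n. sfun (X n)) f sequentially"
    "(\<lambda>n. lin universal_rep (X n)) \<longlonglongrightarrow> T"
    "uniform_limit UNIV (\<lambda>n. sfun (Y n)) g sequentially"
    "(\<lambda>n. lin universal_rep (Y n)) \<longlonglongrightarrow> S" using assms unfolding sfun_rel_def by blast
  have "bounded (range f)" "bounded (range g)"
    using sfun_rel_le[OF assms(1)] sfun_rel_le[OF assms(2)] unfolding bounded_iff by auto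
  then have U: "uniform_limit UNIV (\<lambda>n \<phi>. sfun (X n) \<phi> * sfun (Y n) \<phi>) (\<lambda>\<phi>. f \<phi> * g \<phi>) sequentially"
    by (intro bounded_bilinear.bounded_uniform_limit[OF bounded_bilinear_mult] XY)
  show ?thesis unfolding sfun_rel_def
    by (rule exI[of _ "\<lambda>n. fmult (X n) (Y n)"])
      (simp only: sfun_fmult[abs_def] universal.lin_fmult, intro conjI U tendsto_blinfun_compose XY)
qed

lemma sfun_rel_scale:
  assumes "sfun_rel f T" shows "sfun_rel (\<lambda>\<phi>. c * f \<phi>) (scale_op c T)"
proof -
  obtain X where X: "uniform_limit UNIV (\<lambda>n. sfun (X n)) f sequentially"
    "(\<lambda>n. lin universal_rep (X n)) \<longlonglongrightarrow> T" using assms unfolding sfun_rel_def by blast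
  have U: "uniform_limit UNIV (\<lambda>n \<phi>. c * sfun (X n) \<phi>) (\<lambda>\<phi>. c * f \<phi>) sequentially"
    by (rule bounded_linear.uniform_limit[OF bounded_linear_mult_right X(1)])
  show ?thesis unfolding sfun_rel_def
    by (rule exI[of _ "\<lambda>n. fscale c (X n)"])
      (simp only: sfun_fscale[abs_def] lin_fscale, intro conjI U tendsto_scale_op X)
qed

lemma sfun_rel_star:
  assumes "sfun_rel f T" shows "sfun_rel (\<lambda>\<phi>. cnj (f \<phi>)) (adj_op T)"
proof -
  obtain X where X: "uniform_limit UNIV (\<lambda>n. sfun (X n)) f sequentially"
    "(\<lambda>n. lin universal_rep (X n)) \<longlonglongrightarrow> T" using assms unfolding sfun_rel_def by blast
  have U: "uniform_limit UNIV (\<lambda>n \<phi>. cnj (sfun (X n) \<phi>)) (\<lambda>\<phi>. cnj (f \<phi>)) sequentially"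
    by (rule bounded_linear.uniform_limit[OF bounded_linear_cnj X(1)])
  show ?thesis unfolding sfun_rel_def
    by (rule exI[of _ "\<lambda>n. fstar id (X n)"])
      (simp only: sfun_fstar[abs_def] universal.lin_fstar, intro conjI U tendsto_adj_op(1) X, simp)
qed

lemma sfun_rel_chi: "sfun_rel (chi e) (universal_rep e)"
proof -
  have "sfun [(1, e)] = chi e" by (simp add: sfun_def[abs_def])
  moreover have "scale_op 1 T = T" for T :: "'a universal_space op" by (rule blinfun_eqI) simp
  ultimately show ?thesis unfolding sfun_rel_def
    by (intro exI[of _ "\<lambda>_. [(1, e)]"]) (simp add: uniform_limit_const)
qed

text \<open>\<open>spectral_iso\<close> is chosen by \<open>SOME\<close>, so one map with the
  required properties has to be exhibited; the witness reads the graph \<open>sfun_rel\<close> as a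
  function.\<close>

lemma spectral_iso:
  "star_iso C0_algebra (semilattice_cstar TYPE('s::inverse_semigroup))
     (spectral_iso :: ('s spectrum \<Rightarrow> complex) \<Rightarrow> _)"
proof -
  define \<Phi> where "\<Phi> f = (SOME T. sfun_rel f T)" for f :: "'s spectrum \<Rightarrow> complex"
  have rel: "sfun_rel f (\<Phi> f)" if "f \<in> C0 UNIV" for f
    unfolding \<Phi>_def using sfun_rel_total[OF that] by (rule someI_ex)
  have \<Phi>: "\<Phi> f = T" if "sfun_rel f T" for f T
    using rel[OF sfun_rel_C0[OF that]] that by (rule sfun_rel_unique)
  have cl: "T \<in> closure (range (lin universal_rep))" if "sfun_rel f T"
      for f :: "'s spectrum \<Rightarrow> complex" and T
    using that closure_rangeI[of "lin universal_rep"] unfolding sfun_rel_def by blast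
  have "bij_betw \<Phi> (C0 UNIV) (closure (range (lin universal_rep)))"
  proof (rule bij_betwI')
    fix f g :: "'s spectrum \<Rightarrow> complex" assume "f \<in> C0 UNIV" "g \<in> C0 UNIV"
    then show "\<Phi> f = \<Phi> g \<longleftrightarrow> f = g" using rel sfun_rel_unique' by metis
  next
    show "\<Phi> f \<in> closure (range (lin universal_rep))" if "f \<in> C0 UNIV" for f
      using cl[OF rel[OF that]] .
    show "\<exists>f\<in>C0 UNIV. T = \<Phi> f" if "T \<in> closure (range (lin universal_rep))" for T
      using sfun_rel_onto[OF that] \<Phi> sfun_rel_C0 by metis
  qed
  moreover have "star_hom C0_algebra (op_algebra (closure (range (lin universal_rep)))) \<Phi>"
    unfolding star_hom_def op_algebra_def C0_algebra_def star_algebra.simps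
  proof (intro conjI ballI allI)
    show "\<Phi> ` C0 UNIV \<subseteq> closure (range (lin universal_rep))" using rel cl by blast
  next
    fix f g :: "'s spectrum \<Rightarrow> complex" assume fg: "f \<in> C0 UNIV" "g \<in> C0 UNIV"
    show "\<Phi> (\<lambda>x. f x + g x) = \<Phi> f + \<Phi> g"
      by (rule \<Phi>[OF sfun_rel_add[OF rel rel]]) (rule fg)+
    show "\<Phi> (\<lambda>x. f x * g x) = \<Phi> f o\<^sub>L \<Phi> g"
      by (rule \<Phi>[OF sfun_rel_mult[OF rel rel]]) (rule fg)+
  next
    fix f :: "'s spectrum \<Rightarrow> complex" and c assume f: "f \<in> C0 UNIV"
    show "\<Phi> (\<lambda>x. c * f x) = scale_op c (\<Phi> f)" by (rule \<Phi>[OF sfun_rel_scale[OF rel[OF f]]])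
    show "\<Phi> (\<lambda>x. cnj (f x)) = adj_op (\<Phi> f)" by (rule \<Phi>[OF sfun_rel_star[OF rel[OF f]]])
  qed
  ultimately have "star_iso C0_algebra (semilattice_cstar TYPE('s)) \<Phi>"
    unfolding star_iso_def semilattice_cstar_def universal.cstar_generated_eq
    by (simp add: C0_algebra_def op_algebra_def)
  moreover have "\<Phi> (chi e) = universal_rep e" for e by (rule \<Phi>[OF sfun_rel_chi])
  ultimately show ?thesis
    unfolding spectral_iso_def
    using someI[of "\<lambda>\<Phi>. star_iso C0_algebra (semilattice_cstar TYPE('s)) \<Phi> \<and>
      (\<forall>e. \<Phi> (chi e) = universal_rep e)" \<Phi>] by blast
qed

section \<open>Representations of commutative algebras and their strong extensions\<close>

lemma norm_blinfun_apply_le: "norm T \<le> B \<Longrightarrow> norm (blinfun_apply T x) \<le> B * norm x"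
  by (meson mult_right_mono norm_blinfun norm_ge_zero order_trans)

locale C0_rep =
  fixes \<rho> :: "('x::topological_space \<Rightarrow> complex) \<Rightarrow> 'h::complex_hilbert op"
  assumes hom: "star_hom C0_algebra (op_algebra complex_ops) \<rho>"
begin

lemma
  assumes "f \<in> C0 UNIV"
  shows complex: "\<rho> f \<in> complex_ops"
    and scale: "\<rho> (\<lambda>x. c * f x) = scale_op c (\<rho> f)"
    and star: "\<rho> (\<lambda>x. cnj (f x)) = adj_op (\<rho> f)"
  using hom assms unfolding star_hom_def C0_algebra_def op_algebra_def by auto

lemma
  assumes "f \<in> C0 UNIV" "g \<in> C0 UNIV"
  shows add: "\<rho> (\<lambda>x. f x + g x) = \<rho> f + \<rho> g"
    and mult: "\<rho> (\<lambda>x. f x * g x) = \<rho> f o\<^sub>L \<rho> g"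
  using hom assms unfolding star_hom_def C0_algebra_def op_algebra_def by auto

lemma zero: "\<rho> (\<lambda>x. 0) = 0"
proof -
  have "\<rho> (\<lambda>x. 0 * 0) = scale_op 0 (\<rho> (\<lambda>x. 0))" by (rule scale) simp
  also have "\<dots> = 0" by (rule blinfun_eqI) simp
  finally show ?thesis by simp
qed

lemma norm_square_apply:
  assumes f: "f \<in> C0 UNIV"
  shows "(norm (blinfun_apply (\<rho> f) \<xi>))\<^sup>2 = Re (cinner (blinfun_apply (\<rho> (\<lambda>x. cnj (f x) * f x)) \<xi>)
      \<xi>)"
  by (simp add: norm_square_cinner mult[OF C0_cnj[OF f] f] star[OF f] cinner_adj'[OF complex[OF f]])

text \<open>With \<open>g = 1 - sqrt (1 - |f|\<^sup>2)\<close>, which again vanishes at infinity, \<open>|f|\<^sup>2 = 2 g - g\<^sup>2\<close> gives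
  \<open>\<parallel>\<rho> f \<xi>\<parallel>\<^sup>2 = \<parallel>\<xi>\<parallel>\<^sup>2 - \<parallel>\<xi> - \<rho> g \<xi>\<parallel>\<^sup>2\<close>.\<close>

lemma contractive_aux:
  assumes f: "f \<in> C0 UNIV" and 1: "\<And>x. cmod (f x) \<le> 1"
  shows "norm (\<rho> f) \<le> 1"
proof (rule norm_blinfun_bound)
  fix \<xi>
  define s where "s x = sqrt (1 - (cmod (f x))\<^sup>2)" for x
  define g where "g x = complex_of_real (1 - s x)" for x
  have s: "0 \<le> s x" "s x \<le> 1" "1 - cmod (f x) \<le> s x" "(s x)\<^sup>2 = 1 - (cmod (f x))\<^sup>2" for x
  proof -
    have t: "0 \<le> cmod (f x)" "cmod (f x) \<le> 1" "(cmod (f x))\<^sup>2 \<le> 1"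
      using 1 by (auto simp: power_le_one)
    show "0 \<le> s x" "s x \<le> 1" "(s x)\<^sup>2 = 1 - (cmod (f x))\<^sup>2" using t by (auto simp: s_def)
    \<comment> \<open>This gives \<open>1 - s x \<le> cmod (f x)\<close>, the domination by
      \<open>f\<close> that puts \<open>g\<close> into \<open>C0 UNIV\<close>.\<close>
    have "(1 - cmod (f x))\<^sup>2 \<le> 1 - (cmod (f x))\<^sup>2"
      using mult_left_mono[OF t(2,1)] by (simp add: power2_eq_square algebra_simps)
    then show "1 - cmod (f x) \<le> s x" unfolding s_def by (rule real_le_rsqrt)
  qed
  have g: "g \<in> C0 UNIV"
  proof (rule C0_dominated[OF f, where B=1])
    show "continuous_on UNIV g"
      unfolding g_def s_def by (intro continuous_intros C0_continuous[OF f])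
    show "cmod (g x) \<le> 1 * cmod (f x)" for x
      unfolding g_def norm_of_real using s(2,3)[of x] by simp
  qed
  have eq: "(\<lambda>x. cnj (f x) * f x) = (\<lambda>x. 2 * g x + (-1) * (g x * g x))"
  proof
    fix x
    have "cnj (f x) * f x = complex_of_real ((cmod (f x))\<^sup>2)"
      by (subst complex_norm_square) (simp add: mult.commute)
    also have "(cmod (f x))\<^sup>2 = 2 * (1 - s x) + (-1) * ((1 - s x) * (1 - s x))"
      using s(4)[of x] by (simp add: power2_eq_square algebra_simps)
    finally show "cnj (f x) * f x = 2 * g x + (-1) * (g x * g x)" unfolding g_def by simp
  qed
  have gs: "adj_op (\<rho> g) = \<rho> g"
    using star[OF g] by (simp add: g_def[abs_def])
  have "\<rho> (\<lambda>x. cnj (f x) * f x) = scale_op 2 (\<rho> g) + scale_op (-1) (\<rho> g o\<^sub>L \<rho> g)"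
    unfolding eq by (simp only: add[OF C0_scale[OF g] C0_scale[OF C0_mult[OF g g]]]
        scale[OF g] scale[OF C0_mult[OF g g]] mult[OF g g])
  then have "(norm (blinfun_apply (\<rho> f) \<xi>))\<^sup>2
      = 2 * Re (cinner (blinfun_apply (\<rho> g) \<xi>) \<xi>) - Re (cinner (blinfun_apply (\<rho> g) (blinfun_apply
          (\<rho> g) \<xi>)) \<xi>)"
    unfolding norm_square_apply[OF f]
    by (simp add: plus_blinfun.rep_eq cinner_add_left cinner_scaleC_left)
  also have "\<dots> = (norm \<xi>)\<^sup>2 - (norm (\<xi> - blinfun_apply (\<rho> g) \<xi>))\<^sup>2"
    using cinner_adj[OF complex[OF g]] unfolding gs norm_diff_square
    by (simp add: norm_square_cinner)
  also have "\<dots> \<le> (norm \<xi>)\<^sup>2" by simp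
  finally show "norm (blinfun_apply (\<rho> f) \<xi>) \<le> 1 * norm \<xi>" by
      (simp add: abs_le_square_iff[symmetric])
qed simp

lemma contractive:
  assumes f: "f \<in> C0 UNIV" and B: "\<And>x. cmod (f x) \<le> B"
  shows "norm (\<rho> f) \<le> B"
proof (rule field_le_epsilon)
  fix e :: real assume e: "0 < e"
  have B0: "0 \<le> B" using B[of undefined] norm_ge_zero order_trans by blast
  \<comment> \<open>The extra \<open>e\<close> allows dividing by the bound even when
    \<open>B = 0\<close>.\<close>
  define b where "b = B + e"
  have b: "0 < b" using e B0 by (simp add: b_def)
  have "cmod (inverse (complex_of_real b) * f x) \<le> 1" for x
  proof -
    have "cmod (f x) \<le> b" using B[of x] e by (simp add: b_def)
    then have "inverse b * cmod (f x) \<le> inverse b * b" using b by (intro mult_left_mono) auto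
    then show ?thesis using b by (simp add: norm_mult norm_inverse)
  qed
  then have "norm (\<rho> (\<lambda>x. inverse (complex_of_real b) * f x)) \<le> 1"
    by (intro contractive_aux C0_scale f)
  then have "inverse b * norm (\<rho> f) \<le> 1"
    unfolding scale[OF f] norm_scale_op using b by (simp add: norm_inverse)
  then show "norm (\<rho> f) \<le> B + e" using b by (simp add: b_def field_simps)
qed

end

text \<open>On a small basic neighbourhood of the character, \<open>f\<close> is nearly the constant
  \<open>f \<phi>\<close>. The indicator \<open>u\<close> of that neighbourhood is a non-zero
  element of the algebra, so by injectivity \<open>\<rho> u\<close> has a non-zero vector in its
  range, and on it \<open>\<rho> f\<close> acts nearly as that scalar.\<close>

lemma faithful_spectrum_rep_lower:
  fixes \<rho> :: "('s::inverse_semigroup spectrum \<Rightarrow> complex) \<Rightarrow> 'h::complex_hilbert op"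
  assumes "C0_rep \<rho>" and inj: "inj_on \<rho> (C0 UNIV)" and f: "f \<in> C0 UNIV"
  shows "cmod (f \<phi>) \<le> norm (\<rho> f)"
proof (rule field_le_epsilon)
  interpret C0_rep \<rho> by (rule assms)
  fix e :: real assume e: "0 < e"
  obtain e1 where e1: "char_fun \<phi> e1" using char_fun_nonzero by blast
  have "open {\<psi>. cmod (f \<psi> - f \<phi>) < e}"
    by (intro open_Collect_less continuous_intros C0_continuous[OF f])
  then obtain a F where aF: "finite F" "\<phi> \<in> basic_open (e1 * a) F"
    "basic_open (e1 * a) F \<subseteq> {\<psi>. cmod (f \<psi> - f \<phi>) < e}"
    using basic_open_nbhd[OF _ _ e1, of "{\<psi>. cmod (f \<psi> - f \<phi>) < e}"] e by auto
  define u where "u = (indicator (basic_open (e1 * a) F) :: _ \<Rightarrow> complex)"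
  have u: "u \<in> C0 UNIV"
    unfolding u_def by (rule simple_on_C0[OF simple_on_indicator[where B=UNIV]]) (auto intro: aF)
  have "u \<phi> \<noteq> 0" using aF(2) by (simp add: u_def)
  then have "u \<noteq> (\<lambda>x. 0)" by auto
  then have "\<rho> u \<noteq> 0" using inj_onD[OF inj _ u C0_zero] zero by auto
  then obtain x where x: "blinfun_apply (\<rho> u) x \<noteq> 0" by (metis blinfun_eqI zero_blinfun.rep_eq)
  define y where "y = blinfun_apply (\<rho> u) x"
  have y: "norm y > 0" using x by (simp add: y_def)
  \<comment> \<open>Constants do not lie in the algebra in general, so the error
    \<open>f - f \<phi>\<close> is cut off by \<open>u\<close>; contractivity makes the norm of
    \<open>\<rho> g\<close> at most \<open>e\<close>.\<close>
  define g where "g \<psi> = f \<psi> * u \<psi> + (- f \<phi>) * u \<psi>" for \<psi>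
  have g: "g \<in> C0 UNIV" unfolding g_def by (intro C0_add C0_mult[OF f u] C0_scale u)
  have gb: "cmod (g \<psi>) \<le> e" for \<psi>
  proof (cases "\<psi> \<in> basic_open (e1 * a) F")
    case True
    then have "cmod (f \<psi> - f \<phi>) < e" using aF(3) by blast
    then show ?thesis using True by (simp add: g_def u_def)
  qed (use e in \<open>simp add: g_def u_def\<close>)
  have "(\<lambda>\<psi>. f \<psi> * u \<psi>) = (\<lambda>\<psi>. f \<phi> * u \<psi> + g \<psi> * u \<psi>)"
    by (auto simp: g_def u_def indicator_def)
  then have "\<rho> f o\<^sub>L \<rho> u = scale_op (f \<phi>) (\<rho> u) + (\<rho> g o\<^sub>L \<rho> u)"
    using mult[OF f u] mult[OF g u] scale[OF u] add[OF C0_scale[OF u] C0_mult[OF g u]] by metis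
  then have "blinfun_apply (\<rho> f) y = f \<phi> *\<^sub>C y + blinfun_apply (\<rho> g) y"
    unfolding y_def by (metis blinfun_apply_blinfun_compose plus_blinfun.rep_eq scale_op_apply)
  then have "f \<phi> *\<^sub>C y = blinfun_apply (\<rho> f) y - blinfun_apply (\<rho> g) y" by simp
  then have "cmod (f \<phi>) * norm y \<le> norm (blinfun_apply (\<rho> f) y) + norm (blinfun_apply (\<rho> g) y)"
    by (metis norm_scaleC norm_triangle_ineq4)
  also have "\<dots> \<le> norm (\<rho> f) * norm y + e * norm y"
  proof (rule add_mono)
    show "norm (blinfun_apply (\<rho> f) y) \<le> norm (\<rho> f) * norm y" by (rule norm_blinfun)
    have "norm (blinfun_apply (\<rho> g) y) \<le> norm (\<rho> g) * norm y" by (rule norm_blinfun)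
    also have "\<dots> \<le> e * norm y" by (intro mult_right_mono contractive[OF g] gb) simp
    finally show "norm (blinfun_apply (\<rho> g) y) \<le> e * norm y" .
  qed
  finally have "cmod (f \<phi>) * norm y \<le> (norm (\<rho> f) + e) * norm y" by (simp add: distrib_right)
  then show "cmod (f \<phi>) \<le> norm (\<rho> f) + e" using y by simp
qed

section \<open>Strong extension of a representation from an ideal\<close>

lemma approximate_unitD:
  assumes "approximate_unit D F"
  shows "\<forall>\<^sub>F e in F. e \<in> C0 D \<and> range e \<subseteq> complex_of_real ` {0..1}"
    and "a \<in> C0 D \<Longrightarrow> uniform_limit UNIV (\<lambda>e x. a x * e x) a F"
  using assms unfolding approximate_unit_def by blast+

text \<open>An abstract form of a representation of C_0(X_h) composed with the partial automorphism.
  The \<open>U n\<close> are compact open sets increasing to \<open>D\<close>; their indicators act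
  as increasing projections and take the place of a general net.\<close>

locale ideal_rep =
  fixes D :: "'x::topological_space set"
    and r :: "('x \<Rightarrow> complex) \<Rightarrow> 'h::complex_hilbert op"
    and U :: "nat \<Rightarrow> 'x set"
  assumes complex: "f \<in> C0 D \<Longrightarrow> r f \<in> complex_ops"
    and scale: "f \<in> C0 D \<Longrightarrow> r (\<lambda>x. c * f x) = scale_op c (r f)"
    and star: "f \<in> C0 D \<Longrightarrow> r (\<lambda>x. cnj (f x)) = adj_op (r f)"
    and add: "f \<in> C0 D \<Longrightarrow> g \<in> C0 D \<Longrightarrow> r (\<lambda>x. f x + g x) = r f + r g"
    and mult: "f \<in> C0 D \<Longrightarrow> g \<in> C0 D \<Longrightarrow> r (\<lambda>x. f x * g x) = r f o\<^sub>L r g"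
    and contractive: "f \<in> C0 D \<Longrightarrow> (\<And>x. cmod (f x) \<le> B) \<Longrightarrow> norm (r f) \<le> B"
    and U_C0: "indicator (U n) \<in> C0 D"
    and U_mono: "m \<le> n \<Longrightarrow> U m \<subseteq> U n"
    and U_open: "open (U n)"
    and U_cover: "(\<Union>n. U n) = D"
begin

abbreviation u :: "nat \<Rightarrow> 'x \<Rightarrow> complex" where "u n \<equiv> indicator (U n)"

lemma mult_u_C0: "a \<in> C0 UNIV \<Longrightarrow> (\<lambda>x. a x * u n x) \<in> C0 D"
  using C0_mult[OF U_C0] by (subst mult.commute) blast

lemma diff:
  assumes "f \<in> C0 D" "g \<in> C0 D" shows "r (\<lambda>x. f x - g x) = r f - r g"
  using add[OF assms(1) C0_scale[OF assms(2), of "-1"]] scale[OF assms(2), of "-1"]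
  by (simp add: scale_op_minus_one)

lemma u_mult: "m \<le> n \<Longrightarrow> u m x * u n x = u m x" "m \<le> n \<Longrightarrow> u n x * u m x = u m x"
  using U_mono by (auto simp: indicator_def)

lemma P_idem:
  "m \<le> n \<Longrightarrow> blinfun_apply (r (u m)) (blinfun_apply (r (u n)) \<xi>) = blinfun_apply (r (u m)) \<xi>"
  "m \<le> n \<Longrightarrow> blinfun_apply (r (u n)) (blinfun_apply (r (u m)) \<xi>) = blinfun_apply (r (u m)) \<xi>"
proof -
  assume le: "m \<le> n"
  have "r (u m) o\<^sub>L r (u n) = r (u m)" "r (u n) o\<^sub>L r (u m) = r (u m)"
    unfolding mult[OF U_C0 U_C0, symmetric] u_mult[OF le] by simp_all
  then show "blinfun_apply (r (u m)) (blinfun_apply (r (u n)) \<xi>) = blinfun_apply (r (u m)) \<xi>"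
    "blinfun_apply (r (u n)) (blinfun_apply (r (u m)) \<xi>) = blinfun_apply (r (u m)) \<xi>"
    by (metis blinfun_apply_blinfun_compose)+
qed

lemma P_self_adj: "cinner (blinfun_apply (r (u n)) x) y = cinner x (blinfun_apply (r (u n)) y)"
proof -
  have "(\<lambda>x. cnj (u n x)) = u n" by (auto simp: indicator_def)
  then have "adj_op (r (u n)) = r (u n)" using star[OF U_C0, of n] by simp
  then show ?thesis using cinner_adj[OF complex[OF U_C0], of n x y] by simp
qed

text \<open>For increasing projections Pythagoras gives the squared distance of two images as the
  difference of their squared norms, and these form a bounded increasing sequence.\<close>

lemma P_convergent: "convergent (\<lambda>n. blinfun_apply (r (u n)) \<xi>)"
proof -
  define p where "p n = blinfun_apply (r (u n)) \<xi>" for n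
  have pyth: "(norm (p n - p m))\<^sup>2 = (norm (p n))\<^sup>2 - (norm (p m))\<^sup>2" if "m \<le> n" for m n
  proof -
    have "cinner (p n) (p m) = cinner (p m) (p m)"
      unfolding p_def by (simp only: P_self_adj P_idem[OF that] P_idem[OF order_refl])
    then have "Re (cinner (p n) (p m)) = (norm (p m))\<^sup>2" by (simp add: norm_square_cinner)
    then show ?thesis by (simp add: norm_diff_square)
  qed
  define q where "q n = (norm (p n))\<^sup>2" for n
  have "incseq q"
  proof (rule incseq_SucI)
    fix n
    have "0 \<le> (norm (p (Suc n) - p n))\<^sup>2" by simp
    then show "q n \<le> q (Suc n)" unfolding q_def using pyth[of n "Suc n"] by simp
  qed
  moreover have "q n \<le> (norm \<xi>)\<^sup>2" for n
  proof -
    have "norm (r (u n)) \<le> 1" by (rule contractive[OF U_C0]) (simp add: indicator_def)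
    then have "norm (p n) \<le> 1 * norm \<xi>" unfolding p_def by (rule norm_blinfun_apply_le)
    then show ?thesis by (simp add: q_def)
  qed
  ultimately have "Bseq q" by (intro BseqI'[of _ "(norm \<xi>)\<^sup>2"]) (simp add: q_def)
  then have "convergent q" using \<open>incseq q\<close> by (intro Bseq_monoseq_convergent incseq_imp_monoseq)
  then have "Cauchy q" by (simp add: Cauchy_convergent_iff)
  have "Cauchy p"
  proof (rule CauchyI)
    fix e :: real assume e: "0 < e"
    then obtain M where M: "\<And>m n. M \<le> m \<Longrightarrow> M \<le> n \<Longrightarrow> norm (q m - q n) < e\<^sup>2"
      using \<open>Cauchy q\<close> unfolding Cauchy_iff by (meson zero_less_power)
    have lt: "norm (p n - p m) < e" if "M \<le> m" "m \<le> n" for m n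
    proof -
      have "(norm (p n - p m))\<^sup>2 < e\<^sup>2"
        using pyth[OF that(2)] M[of n m] that unfolding q_def by simp
      then show ?thesis using e by (simp add: power_less_imp_less_base)
    qed
    have "norm (p m - p n) < e" if "M \<le> m" "M \<le> n" for m n
      using lt[of m n] lt[of n m] that norm_minus_commute[of "p m" "p n"] by (cases "m \<le> n") auto
    then show "\<exists>M. \<forall>m\<ge>M. \<forall>n\<ge>M. norm (p m - p n) < e" by blast
  qed
  then show ?thesis unfolding p_def by (rule Cauchy_convergent)
qed

lemma mult_u_apply:
  assumes "f \<in> C0 D" shows "r (\<lambda>x. f x * u n x) = r f o\<^sub>L r (u n)"
  by (rule mult[OF assms U_C0])

lemma Cauchy_tail:
  assumes e: "0 < e"
  shows "\<exists>N. \<forall>m\<ge>N. norm (blinfun_apply (r (u m)) \<xi> - blinfun_apply (r (u N)) \<xi>) < e"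
  using convergent_Cauchy[OF P_convergent[of \<xi>]] e unfolding Cauchy_iff by blast

text \<open>For \<open>k \<le> m\<close> the operator of \<open>a * u k\<close> is that of
  \<open>a * u m\<close> applied after the projection of \<open>u k\<close>. Convergence is thus
  controlled by the projections alone, with a bound depending on \<open>a\<close> only through
  \<open>B\<close>.\<close>

lemma apply_tail_le:
  assumes a: "a \<in> C0 UNIV" and B: "\<And>x. cmod (a x) \<le> B" and "N \<le> m"
  shows "norm (blinfun_apply (r (\<lambda>x. a x * u m x)) \<xi> - blinfun_apply (r (\<lambda>x. a x * u N x)) \<xi>)
    \<le> B * norm (blinfun_apply (r (u m)) \<xi> - blinfun_apply (r (u N)) \<xi>)"
proof -
  have am: "(\<lambda>x. a x * u m x) \<in> C0 D" using a by (rule mult_u_C0)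
  have B0: "0 \<le> B" using B[of undefined] norm_ge_zero order_trans by blast
  have 1: "r (\<lambda>x. a x * u k x) = r (\<lambda>x. a x * u m x) o\<^sub>L r (u k)" if "k \<le> m" for k
  proof -
    have "(\<lambda>x. a x * u k x) = (\<lambda>x. a x * u m x * u k x)"
      using u_mult(2)[OF that] by (simp only: mult.assoc)
    then show ?thesis unfolding mult_u_apply[OF am, symmetric] by simp
  qed
  have "norm (r (\<lambda>x. a x * u m x)) \<le> B"
    by (rule contractive[OF am]) (use B B0 in \<open>auto simp: indicator_def\<close>)
  then have "norm (blinfun_apply (r (\<lambda>x. a x * u m x)) (blinfun_apply (r (u m)) \<xi> - blinfun_apply
      (r (u N)) \<xi>))
    \<le> B * norm (blinfun_apply (r (u m)) \<xi> - blinfun_apply (r (u N)) \<xi>)"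
    by (rule norm_blinfun_apply_le)
  moreover have ap: "blinfun_apply (r (\<lambda>x. a x * u k x)) \<xi>
      = blinfun_apply (r (\<lambda>x. a x * u m x)) (blinfun_apply (r (u k)) \<xi>)" if "k \<le> m" for k
    using arg_cong[OF 1[OF that], of "\<lambda>T. blinfun_apply T \<xi>"]
      unfolding blinfun_apply_blinfun_compose .
  ultimately show ?thesis
    unfolding blinfun.diff_right ap[OF order_refl, symmetric] ap[OF \<open>N \<le> m\<close>, symmetric] by simp
qed

text \<open>For \<open>r = \<pi> \<circ> \<alpha>\<close> with \<open>\<alpha>\<close> belonging to the inverse of \<open>h\<close> this is \<open>\<pi>\<^sub>h\<close> of the reduced crossed product.\<close>

definition ext :: "('x \<Rightarrow> complex) \<Rightarrow> 'h op" where
  "ext a = Blinfun (\<lambda>\<xi>. lim (\<lambda>n. blinfun_apply (r (\<lambda>x. a x * u n x)) \<xi>))"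

lemma ext_convergent:
  assumes a: "a \<in> C0 UNIV"
  shows "convergent (\<lambda>n. blinfun_apply (r (\<lambda>x. a x * u n x)) \<xi>)"
proof -
  obtain B where B: "\<And>x. cmod (a x) \<le> B" "0 < B" using C0_bounded[OF a] by blast
  have "Cauchy (\<lambda>n. blinfun_apply (r (\<lambda>x. a x * u n x)) \<xi>)" (is "Cauchy ?t")
  proof (rule CauchyI)
    fix e :: real assume e: "0 < e"
    obtain N where N: "\<And>m. N \<le> m \<Longrightarrow>
        norm (blinfun_apply (r (u m)) \<xi> - blinfun_apply (r (u N)) \<xi>) < e / (2 * B)"
      using Cauchy_tail[of "e / (2 * B)"] e B(2) by auto
    have t: "dist (?t m) (?t N) < e / 2" if "N \<le> m" for m
    proof -
      have "dist (?t m) (?t N) \<le> B * norm (blinfun_apply (r (u m)) \<xi> - blinfun_apply (r (u N)) \<xi>)"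
        unfolding dist_norm by (rule apply_tail_le[OF a B(1) that])
      also have "\<dots> < B * (e / (2 * B))" using N[OF that] B(2) by (rule mult_strict_left_mono)
      also have "\<dots> = e / 2" using B(2) by simp
      finally show ?thesis .
    qed
    have "norm (?t m - ?t n) < e" if "N \<le> m" "N \<le> n" for m n
      using dist_triangle_half_l[OF t[OF that(1)] t[OF that(2)]] by (simp add: dist_norm)
    then show "\<exists>M. \<forall>m\<ge>M. \<forall>n\<ge>M. norm (?t m - ?t n) < e" by blast
  qed
  then show ?thesis by (rule Cauchy_convergent)
qed

lemma norm_r_mult_u_le:
  assumes a: "a \<in> C0 UNIV" and B: "\<And>x. cmod (a x) \<le> B"
  shows "norm (r (\<lambda>x. a x * u n x)) \<le> B"
proof (rule contractive[OF mult_u_C0[OF a]])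
  have B0: "0 \<le> B" using B[of undefined] norm_ge_zero order_trans by blast
  show "cmod (a x * u n x) \<le> B" for x using B[of x] B0 by (auto simp: indicator_def)
qed

lemma
  assumes a: "a \<in> C0 UNIV" and B: "\<And>x. cmod (a x) \<le> B"
  shows ext_tendsto: "(\<lambda>n. blinfun_apply (r (\<lambda>x. a x * u n x)) \<xi>) \<longlonglongrightarrow> blinfun_apply (ext a) \<xi>"
    and norm_ext_le: "norm (ext a) \<le> B"
proof -
  let ?T = "\<lambda>\<xi>. lim (\<lambda>n. blinfun_apply (r (\<lambda>x. a x * u n x)) \<xi>)"
  have lim: "(\<lambda>n. blinfun_apply (r (\<lambda>x. a x * u n x)) \<xi>) \<longlonglongrightarrow> ?T \<xi>" for \<xi>
    using ext_convergent[OF a] by (simp add: convergent_LIMSEQ_iff)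
  have B0: "0 \<le> B" using B[of undefined] norm_ge_zero order_trans by blast
  have nb: "norm (?T \<xi>) \<le> B * norm \<xi>" for \<xi>
  proof (rule tendsto_upperbound[OF tendsto_norm[OF lim]])
    show "\<forall>\<^sub>F n in sequentially. norm (blinfun_apply (r (\<lambda>x. a x * u n x)) \<xi>) \<le> B * norm \<xi>"
      by (intro always_eventually allI norm_blinfun_apply_le norm_r_mult_u_le a B)
  qed simp
  have bl: "bounded_linear ?T"
  proof (rule bounded_linear_intro)
    fix x y and c :: real
    show "?T (x + y) = ?T x + ?T y"
      by (rule LIMSEQ_unique[OF lim]) (simp only: blinfun.add_right, intro tendsto_add lim)
    show "?T (c *\<^sub>R x) = c *\<^sub>R ?T x"
      by (rule LIMSEQ_unique[OF lim])
          (simp only: blinfun.scaleR_right, intro tendsto_scaleR tendsto_const lim)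
    show "norm (?T x) \<le> norm x * B" using nb by (simp add: mult.commute)
  qed
  have ap: "blinfun_apply (ext a) = ?T" unfolding ext_def
    by (rule bounded_linear_Blinfun_apply[OF bl])
  show "(\<lambda>n. blinfun_apply (r (\<lambda>x. a x * u n x)) \<xi>) \<longlonglongrightarrow> blinfun_apply (ext a) \<xi>"
    unfolding ap by (rule lim)
  show "norm (ext a) \<le> B" by (rule norm_blinfun_bound[OF B0]) (unfold ap, rule nb)
qed

lemma ext_lim:
  assumes "a \<in> C0 UNIV"
  shows "(\<lambda>n. blinfun_apply (r (\<lambda>x. a x * u n x)) \<xi>) \<longlonglongrightarrow> blinfun_apply (ext a) \<xi>"
  using C0_bounded[OF assms] ext_tendsto[OF assms] by metis

lemma ext_complex: assumes a: "a \<in> C0 UNIV" shows "ext a \<in> complex_ops"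
  unfolding complex_ops_def mem_Collect_eq
proof (intro allI)
  fix c x
  have "(\<lambda>n. blinfun_apply (r (\<lambda>x. a x * u n x)) (c *\<^sub>C x)) \<longlonglongrightarrow> c *\<^sub>C blinfun_apply (ext a) x"
    unfolding complex_opsD[OF complex[OF mult_u_C0[OF a]]]
    by (rule bounded_linear.tendsto[OF bounded_linear_scaleC ext_lim[OF a]])
  then show "blinfun_apply (ext a) (c *\<^sub>C x) = c *\<^sub>C blinfun_apply (ext a) x"
    by (rule LIMSEQ_unique[OF ext_lim[OF a]])
qed

lemma ext_add:
  assumes a: "a \<in> C0 UNIV" and b: "b \<in> C0 UNIV"
  shows "ext (\<lambda>x. a x + b x) = ext a + ext b"
proof (rule blinfun_eqI)
  fix \<xi>
  have "(\<lambda>n. blinfun_apply (r (\<lambda>x. (a x + b x) * u n x)) \<xi>)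
      \<longlonglongrightarrow> blinfun_apply (ext a) \<xi> + blinfun_apply (ext b) \<xi>"
    unfolding distrib_right add[OF mult_u_C0[OF a] mult_u_C0[OF b]] plus_blinfun.rep_eq
    by (intro tendsto_add ext_lim a b)
  then show "blinfun_apply (ext (\<lambda>x. a x + b x)) \<xi> = blinfun_apply (ext a + ext b) \<xi>"
    unfolding plus_blinfun.rep_eq by (rule LIMSEQ_unique[OF ext_lim[OF C0_add[OF a b]]])
qed

lemma ext_scale:
  assumes a: "a \<in> C0 UNIV"
  shows "ext (\<lambda>x. c * a x) = scale_op c (ext a)"
proof (rule blinfun_eqI)
  fix \<xi>
  have "(\<lambda>n. blinfun_apply (r (\<lambda>x. c * a x * u n x)) \<xi>) \<longlonglongrightarrow> c *\<^sub>C blinfun_apply (ext a) \<xi>"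
    unfolding mult.assoc scale[OF mult_u_C0[OF a]] scale_op_apply
    by (intro bounded_linear.tendsto[OF bounded_linear_scaleC] ext_lim a)
  then show "blinfun_apply (ext (\<lambda>x. c * a x)) \<xi> = blinfun_apply (scale_op c (ext a)) \<xi>"
    unfolding scale_op_apply by (rule LIMSEQ_unique[OF ext_lim[OF C0_scale[OF a]]])
qed

lemma ext_star:
  assumes a: "a \<in> C0 UNIV"
  shows "adj_op (ext a) = ext (\<lambda>x. cnj (a x))"
proof (rule adj_op_eqI)
  fix x y
  have cnj: "(\<lambda>x. cnj (a x) * u n x) = (\<lambda>x. cnj (a x * u n x))" for n by (auto simp: indicator_def)
  have 1: "(\<lambda>n. cinner (blinfun_apply (r (\<lambda>x. a x * u n x)) x) y)
      \<longlonglongrightarrow> cinner (blinfun_apply (ext a) x) y"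
    by (intro cinner.tendsto tendsto_const ext_lim a)
  have "(\<lambda>n. cinner x (blinfun_apply (r (\<lambda>x. cnj (a x) * u n x)) y)) \<longlonglongrightarrow>
      cinner x (blinfun_apply (ext (\<lambda>x. cnj (a x))) y)"
    by (intro cinner.tendsto tendsto_const ext_lim C0_cnj a)
  then show "cinner (blinfun_apply (ext a) x) y = cinner x (blinfun_apply (ext (\<lambda>x. cnj (a x))) y)"
    unfolding cnj star[OF mult_u_C0[OF a]] cinner_adj[OF complex[OF mult_u_C0[OF a]], symmetric]
    by (rule LIMSEQ_unique[OF 1])
qed

text \<open>Strong limits respect products when the left factors stay bounded, here by
  \<open>B\<close>; on each level the formula holds because \<open>u n\<close> is
  idempotent.\<close>

lemma ext_mult:
  assumes a: "a \<in> C0 UNIV" and b: "b \<in> C0 UNIV"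
  shows "ext (\<lambda>x. a x * b x) = ext a o\<^sub>L ext b"
proof (rule blinfun_eqI)
  fix \<xi>
  obtain B where B: "\<And>x. cmod (a x) \<le> B" "0 < B" using C0_bounded[OF a] by blast
  let ?R = "\<lambda>a n. r (\<lambda>x. a x * u n x)"
  have eq: "?R (\<lambda>x. a x * b x) n = ?R a n o\<^sub>L ?R b n" for n
    unfolding mult[OF mult_u_C0[OF a] mult_u_C0[OF b], symmetric]
    by (rule arg_cong[where f=r]) (auto simp: indicator_def)
  have "(\<lambda>n. blinfun_apply (?R a n) (blinfun_apply (?R b n) \<xi> - blinfun_apply (ext b) \<xi>)) \<longlonglongrightarrow> 0"
  proof (rule Lim_null_comparison)
    have "norm (blinfun_apply (?R a n) z) \<le> B * norm z" for n z
      by (intro norm_blinfun_apply_le norm_r_mult_u_le a B(1))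
    then show "\<forall>\<^sub>F n in sequentially. norm (blinfun_apply (?R a n) (blinfun_apply (?R b n) \<xi> -
        blinfun_apply (ext b) \<xi>))
        \<le> B * norm (blinfun_apply (?R b n) \<xi> - blinfun_apply (ext b) \<xi>)" by simp
    show "(\<lambda>n. B * norm (blinfun_apply (?R b n) \<xi> - blinfun_apply (ext b) \<xi>)) \<longlonglongrightarrow> 0"
      using tendsto_mult[OF tendsto_const[of B] tendsto_norm[OF LIM_zero[OF ext_lim[OF b, of \<xi>]]]]
        by simp
  qed
  from tendsto_add[OF this ext_lim[OF a, of "blinfun_apply (ext b) \<xi>"]]
  have "(\<lambda>n. blinfun_apply (?R (\<lambda>x. a x * b x) n) \<xi>) \<longlonglongrightarrow> blinfun_apply (ext a) (blinfun_apply
      (ext b) \<xi>)"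
    by (simp add: eq blinfun.diff_right)
  then show "blinfun_apply (ext (\<lambda>x. a x * b x)) \<xi> = blinfun_apply (ext a o\<^sub>L ext b) \<xi>"
    unfolding blinfun_apply_blinfun_compose
    by (rule LIMSEQ_unique[OF ext_lim[OF C0_mult[OF a b]]])
qed

text \<open>By compactness, the set where a function of the ideal is at least a given size in
  modulus lies in one of the \<open>U n\<close>. This also shows that approximate units exist,
  without which the condition in \<open>pa_rep\<close> would be vacuous.\<close>

lemma approximate_unit_u: "approximate_unit D (filtermap u sequentially)"
  unfolding approximate_unit_def
proof (intro conjI ballI)
  show "filtermap u sequentially \<noteq> bot" by (simp add: filtermap_bot_iff)
  have "range (u n) \<subseteq> complex_of_real ` {0..1}" for n
  proof
    fix z assume "z \<in> range (u n)"
    then have "z = complex_of_real 0 \<or> z = complex_of_real 1" by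
        (auto simp: indicator_def split: if_splits)
    then show "z \<in> complex_of_real ` {0..1}" by auto
  qed
  then show "\<forall>\<^sub>F e in filtermap u sequentially. e \<in> C0 D \<and> range e \<subseteq> complex_of_real ` {0..1}"
    by (simp add: eventually_filtermap U_C0)
  fix a assume a: "a \<in> C0 D"
  show "uniform_limit UNIV (\<lambda>e x. a x * e x) a (filtermap u sequentially)"
  proof (rule uniform_limitI)
    fix e :: real assume e: "0 < e"
    have sub: "{x. e \<le> cmod (a x)} \<subseteq> (\<Union>n\<in>UNIV. U n)"
    proof
      fix x assume "x \<in> {x. e \<le> cmod (a x)}"
      then have "a x \<noteq> 0" using e by auto
      then have "x \<in> D" using C0_outside[OF a] by blast
      then show "x \<in> (\<Union>n\<in>UNIV. U n)" using U_cover by simp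
    qed
    obtain C where "C \<subseteq> UNIV" and C: "finite C" "{x. e \<le> cmod (a x)} \<subseteq> (\<Union>n\<in>C. U n)"
      by (rule compactE_image[OF C0_compact[OF a e] U_open sub])
    obtain N where N: "\<And>n. n \<in> C \<Longrightarrow> n \<le> N" using C(1) finite_nat_set_iff_bounded_le by auto
    have "dist (a x * u n x) (a x) < e" if "N \<le> n" for n x
    proof (cases "x \<in> U n")
      case False
      have "x \<notin> U k" if "k \<in> C" for k
        using False U_mono[OF order_trans[OF N[OF that] \<open>N \<le> n\<close>]] by blast
      then have "\<not> e \<le> cmod (a x)" using C(2) by blast
      then show ?thesis using False by simp
    qed (use e in simp)
    then show "\<forall>\<^sub>F f in filtermap u sequentially. \<forall>x\<in>UNIV. dist (a x * f x) (a x) < e"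
      unfolding eventually_filtermap eventually_sequentially by blast
  qed
qed

lemma r_approximate_unit:
  assumes a: "a \<in> C0 D" and F: "approximate_unit D F"
  shows "((\<lambda>e. r (\<lambda>x. a x * e x)) \<longlongrightarrow> r a) F"
proof (rule tendstoI)
  fix d :: real assume d: "0 < d"
  then have "0 < d / 2" by simp
  from approximate_unitD(1)[OF F] uniform_limitD[OF approximate_unitD(2)[OF F a] this]
  show "\<forall>\<^sub>F e in F. dist (r (\<lambda>x. a x * e x)) (r a) < d"
  proof eventually_elim
    case (elim e)
    then have m: "(\<lambda>x. a x * e x) \<in> C0 D" using C0_mult[OF a] by blast
    have "norm (r (\<lambda>x. a x * e x - a x)) \<le> d / 2"
      by (rule contractive[OF C0_diff[OF m a]]) (use elim in \<open>auto simp: dist_norm intro: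
          less_imp_le\<close>)
    then show ?case unfolding diff[OF m a] dist_norm using d by simp
  qed
qed

text \<open>Every approximate unit gives the same limit as the sequence \<open>u\<close>. Both
  \<open>a\<close> and \<open>a * e\<close> are replaced by their cut-offs to \<open>U N\<close>, at
  a cost uniform in \<open>e\<close> because \<open>e\<close> is a contraction; the two cut-offs are
  close since the cut-off of \<open>a\<close> lies in the ideal, where \<open>e\<close> acts nearly
  as a unit.\<close>

lemma ext_approximate_unit:
  assumes a: "a \<in> C0 UNIV" and F: "approximate_unit D F"
  shows "((\<lambda>e. blinfun_apply (r (\<lambda>x. a x * e x)) \<xi>) \<longlongrightarrow> blinfun_apply (ext a) \<xi>) F"
proof (rule tendstoI)
  fix \<epsilon> :: real assume \<epsilon>: "0 < \<epsilon>"
  obtain B where B: "\<And>x. cmod (a x) \<le> B" "0 < B" using C0_bounded[OF a] by blast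
  obtain N where N: "\<And>m. N \<le> m \<Longrightarrow>
      norm (blinfun_apply (r (u m)) \<xi> - blinfun_apply (r (u N)) \<xi>) < \<epsilon> / (4 * B)"
    using Cauchy_tail[of "\<epsilon> / (4 * B)"] \<epsilon> B(2) by auto
  have tail: "norm (T - blinfun_apply (r (\<lambda>x. b x * u N x)) \<xi>) \<le> \<epsilon> / 4"
    if b: "b \<in> C0 UNIV" "\<And>x. cmod (b x) \<le> B"
      and T: "(\<lambda>n. blinfun_apply (r (\<lambda>x. b x * u n x)) \<xi>) \<longlonglongrightarrow> T" for b T
  proof (rule tendsto_upperbound[OF tendsto_norm[OF tendsto_diff[OF T tendsto_const]]])
    have "norm (blinfun_apply (r (\<lambda>x. b x * u m x)) \<xi> - blinfun_apply (r (\<lambda>x. b x * u N x)) \<xi>)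
        \<le> \<epsilon> / 4"
      if "N \<le> m" for m
    proof -
      have "norm (blinfun_apply (r (\<lambda>x. b x * u m x)) \<xi> - blinfun_apply (r (\<lambda>x. b x * u N x)) \<xi>)
          \<le> B * norm (blinfun_apply (r (u m)) \<xi> - blinfun_apply (r (u N)) \<xi>)"
        by (rule apply_tail_le[OF b that])
      also have "\<dots> \<le> B * (\<epsilon> / (4 * B))"
        using N[OF that] B(2) by (intro mult_left_mono) auto
      also have "\<dots> = \<epsilon> / 4" using B(2) by simp
      finally show ?thesis .
    qed
    then show "\<forall>\<^sub>F m in sequentially. norm (blinfun_apply (r (\<lambda>x. b x * u m x)) \<xi> - blinfun_apply
        (r (\<lambda>x. b x * u N x)) \<xi>) \<le> \<epsilon> / 4"
      unfolding eventually_sequentially by blast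
  qed simp
  \<comment> \<open>The 1 added to the norm keeps the quotient defined for
    \<open>\<xi> = 0\<close>.\<close>
  define \<delta> where "\<delta> = \<epsilon> / (4 * (norm \<xi> + 1))"
  have \<delta>: "0 < \<delta>" "\<delta> * norm \<xi> \<le> \<epsilon> / 4"
  proof -
    define c where "c = norm \<xi> + 1"
    have c: "0 < c" "norm \<xi> \<le> c" "\<delta> = \<epsilon> / (4 * c)" by (simp_all add: c_def \<delta>_def add_nonneg_pos)
    then show "0 < \<delta>" using \<epsilon> by simp
    have "\<delta> * norm \<xi> \<le> \<delta> * c" using \<open>0 < \<delta>\<close> c(2) by simp
    also have "\<dots> = \<epsilon> / 4" using c(1) by (simp add: c(3))
    finally show "\<delta> * norm \<xi> \<le> \<epsilon> / 4" .
  qed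
  have aN: "(\<lambda>x. a x * u N x) \<in> C0 D" by (rule mult_u_C0[OF a])
  note ul = approximate_unitD(2)[OF F aN]
  from approximate_unitD(1)[OF F] show "\<forall>\<^sub>F e in F. dist (blinfun_apply (r (\<lambda>x. a x * e x)) \<xi>)
      (blinfun_apply (ext a) \<xi>) < \<epsilon>"
    using uniform_limitD[OF ul \<delta>(1)]
  proof eventually_elim
    case (elim e)
    then have e: "e \<in> C0 D" by blast
    have e1: "cmod (e x) \<le> 1" for x
    proof -
      have "e x \<in> complex_of_real ` {0..1}" using elim by blast
      then show ?thesis by auto
    qed
    let ?b = "\<lambda>x. a x * e x"
    have bD: "?b \<in> C0 D" using C0_mult[OF e a] by (simp add: mult.commute)
    have bB: "cmod (?b x) \<le> B" for x
      using mult_mono[OF B(1)[of x] e1[of x]] B(2) by (simp add: norm_mult)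
    \<comment> \<open>\<open>?b\<close> lies in the ideal, so \<open>r ?b\<close> is itself a limit
      along \<open>u\<close> and the tail estimate applies to it with the same
      \<open>B\<close>.\<close>
    have "(\<lambda>n. blinfun_apply (r (\<lambda>x. ?b x * u n x)) \<xi>) \<longlonglongrightarrow> blinfun_apply (r ?b) \<xi>"
      by (rule bounded_linear.tendsto[OF blinfun.bounded_linear_left
            r_approximate_unit[OF bD approximate_unit_u, unfolded filterlim_filtermap]])
    from tail[OF C0_UNIV[OF bD] bB this]
    have 1: "norm (blinfun_apply (r ?b) \<xi> - blinfun_apply (r (\<lambda>x. ?b x * u N x)) \<xi>) \<le> \<epsilon> / 4" .
    have 2: "norm (blinfun_apply (ext a) \<xi> - blinfun_apply (r (\<lambda>x. a x * u N x)) \<xi>) \<le> \<epsilon> / 4"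
      by (rule tail[OF a B(1) ext_lim[OF a]])
    have m: "(\<lambda>x. ?b x * u N x) \<in> C0 D" by (rule mult_u_C0[OF C0_UNIV[OF bD]])
    have "norm (r (\<lambda>x. ?b x * u N x - a x * u N x)) \<le> \<delta>"
    proof (rule contractive[OF C0_diff[OF m aN]])
      fix x
      have "dist (a x * u N x * e x) (a x * u N x) < \<delta>" using elim by blast
      then show "cmod (?b x * u N x - a x * u N x) \<le> \<delta>" by (simp add: dist_norm mult_ac)
    qed
    from norm_blinfun_apply_le[OF this, of \<xi>]
    have "norm (blinfun_apply (r (\<lambda>x. ?b x * u N x)) \<xi> - blinfun_apply (r (\<lambda>x. a x * u N x)) \<xi>)
        \<le> \<delta> * norm \<xi>"
      unfolding diff[OF m aN] blinfun.diff_left .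
    with \<delta>(2) have 3: "norm (blinfun_apply (r (\<lambda>x. ?b x * u N x)) \<xi> - blinfun_apply
        (r (\<lambda>x. a x * u N x)) \<xi>) \<le> \<epsilon> / 4"
      by linarith
    have tri: "norm (p - s) \<le> norm (p - q) + norm (q - t) + norm (s - t)" for p q s t :: 'h
      using norm_triangle_ineq[of "p - q" "(q - t) - (s - t)"] norm_triangle_ineq4[of "q - t" "s -
          t"]
      by simp
  have "norm (blinfun_apply (r ?b) \<xi> - blinfun_apply (ext a) \<xi>) \<le> \<epsilon> / 4 + \<epsilon> / 4 + \<epsilon> / 4"
      using order_trans[OF tri add_mono[OF add_mono[OF 1 3] 2]] .
    also have "\<dots> < \<epsilon>" using \<epsilon> by simp
    finally show ?case by (simp add: dist_norm)
  qed
qed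

text \<open>Uniqueness for the description in \<open>pa_rep\<close>: the single approximate unit
  coming from \<open>u\<close> already determines \<open>T\<close>.\<close>

lemma ext_eqI:
  assumes a: "a \<in> C0 UNIV" and T: "T \<in> complex_ops"
    and lim: "\<And>F \<xi>. approximate_unit D F \<Longrightarrow>
      ((\<lambda>e. blinfun_apply (r (\<lambda>x. a x * e x)) \<xi>) \<longlongrightarrow> blinfun_apply T \<xi>) F"
  shows "T = ext a"
proof (rule blinfun_eqI)
  fix \<xi>
  have "filtermap u sequentially \<noteq> bot" by (simp add: filtermap_bot_iff)
  then show "blinfun_apply T \<xi> = blinfun_apply (ext a) \<xi>"
    by (rule tendsto_unique[OF _ lim[OF approximate_unit_u] ext_approximate_unit[OF a
        approximate_unit_u]])
qed

lemma ext_eq: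
  assumes a: "a \<in> C0 D" shows "ext a = r a"
proof (rule ext_eqI[symmetric, OF C0_UNIV[OF a] complex[OF a]])
  fix F \<xi> assume F: "approximate_unit D F"
  show "((\<lambda>e. blinfun_apply (r (\<lambda>x. a x * e x)) \<xi>) \<longlongrightarrow> blinfun_apply (r a) \<xi>) F"
    by (rule bounded_linear.tendsto[OF blinfun.bounded_linear_left r_approximate_unit[OF a F]])
qed

end

section \<open>The partial action of the maximal group image\<close>

lemma mg_left_cancel: "inverse g * (g * h) = (h :: 'g::mult_group)"
  by (simp add: left_inverse_group flip: mult.assoc)

lemma mg_inverse_inverse [simp]: "inverse (inverse g) = (g :: 'g::mult_group)"
  by (metis mg_left_cancel left_inverse_group mult_1_right)

lemma mg_right_inverse: "g * inverse g = (1 :: 'g::mult_group)"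
  by (metis left_inverse_group mg_inverse_inverse)

lemma mg_left_cancel': "g * (inverse g * h) = (h :: 'g::mult_group)"
  using mg_left_cancel[of "inverse g" h] by simp

lemma mg_inverse_mult: "inverse (g * h) = inverse h * inverse (g :: 'g::mult_group)"
proof -
  have "g * h * (inverse h * inverse g) = 1" by
      (simp add: mult.assoc mg_left_cancel' mg_right_inverse)
  then show ?thesis using mg_left_cancel[of "g * h" "inverse h * inverse g"] by simp
qed

lemma mg_mult_left_inj: "g * h = g * k \<longleftrightarrow> h = (k :: 'g::mult_group)"
  by (metis mg_left_cancel)

section \<open>Idempotents, conjugation and E-unitary semigroups\<close>

lemma idem_val_idem: "idem_val e * idem_val e = idem_val (e :: 's::inverse_semigroup idem)"
  using idem_val[of e] by (simp add: idempotents_def)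

lemma star_idem_val [simp]: "star (idem_val e) = idem_val (e :: 's::inverse_semigroup idem)"
  by (rule star_idem[OF idem_val_idem])

lemma idem_eqI: "idem_val e = idem_val f \<Longrightarrow> e = f"
  by (simp add: idem_val_inject)

lemma star_star_mult [simp]:
  fixes s :: "'s::inverse_semigroup"
  shows "s * (star s * s) = s" "s * (star s * (s * t)) = s * t"
    "star s * (s * star s) = star s" "star s * (s * (star s * t)) = star s * t"
  by (metis star_props mult.assoc)+

lemma idem_val_commute: "idem_val e * (star s * s)
    = star s * s * idem_val (e :: 's::inverse_semigroup idem)"
  by (rule idem_commute[OF idem_val_idem star_mult_self_idem(1)])

lemma idem_val_commute': "idem_val e * (star s * (s * t))
    = star s * (s * (idem_val (e :: 's::inverse_semigroup idem) * t))"
proof -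
  have "idem_val e * (star s * s) * t = star s * s * idem_val e * t" by
      (simp only: idem_val_commute)
  then show ?thesis by (simp only: mult.assoc)
qed

lemma idem_val_commute_star: "idem_val e * (s * (star s * t))
    = s * (star s * (idem_val (e :: 's::inverse_semigroup idem) * t))"
  using idem_val_commute'[of e "star s" t] by simp

lemma conj_idem_mult: "conj_idem s (e * f) = conj_idem s e * conj_idem s f"
proof (rule idem_eqI)
  have "idem_val e * (s * (star s * (idem_val f * s))) = idem_val e * (idem_val f * s)"
    unfolding idem_val_commute_star[symmetric, where e=f] by simp
  then show "idem_val (conj_idem s (e * f)) = idem_val (conj_idem s e * conj_idem s f)"
    by (simp add: conj_idem.rep_eq times_idem.rep_eq mult.assoc)
qed

lemma conj_idem_conj_idem: "conj_idem (s * t) e = conj_idem t (conj_idem s e)"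
  by (rule idem_eqI) (simp add: conj_idem.rep_eq star_mult mult.assoc)

lemma dom_conj_idem: "dom_idem s * conj_idem s e = conj_idem s e"
  by (rule idem_eqI) (simp add: conj_idem.rep_eq dom_idem.rep_eq times_idem.rep_eq mult.assoc)

lemma conj_idem_ran: "conj_idem s (dom_idem (star s)) = dom_idem s"
  by (rule idem_eqI) (simp add: conj_idem.rep_eq dom_idem.rep_eq mult.assoc)

lemma conj_idem_star: "conj_idem (star s) (conj_idem s e) = dom_idem (star s) * e"
proof (rule idem_eqI)
  have "s * (star s * (idem_val e * (s * star s))) = s * (star s * idem_val e)"
    using idem_val_commute[of e "star s"] by (simp add: mult.assoc)
  then show "idem_val (conj_idem (star s) (conj_idem s e)) = idem_val (dom_idem (star s) * e)"
    by (simp add: conj_idem.rep_eq dom_idem.rep_eq times_idem.rep_eq mult.assoc)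
qed

lemma dom_idem_mult: "dom_idem (s * t) = conj_idem t (dom_idem s)"
  by (rule idem_eqI) (simp add: conj_idem.rep_eq dom_idem.rep_eq star_mult mult.assoc)

lemma dom_idem_val [simp]: "dom_idem (idem_val e) = e"
  by (rule idem_eqI) (simp add: dom_idem.rep_eq idem_val_idem)

lemma conj_idem_val: "conj_idem (idem_val e) f = e * f"
proof (rule idem_eqI)
  have "idem_val e * idem_val f * idem_val e = idem_val e * idem_val f"
    using idem_commute[OF idem_val_idem[of f] idem_val_idem[of e]]
    by (simp add: mult.assoc) (simp add: idem_val_idem flip: mult.assoc)
  then show "idem_val (conj_idem (idem_val e) f) = idem_val (e * f)"
    by (simp add: conj_idem.rep_eq times_idem.rep_eq)
qed

lemma max_group_class_idem_val [simp]: "max_group_class (idem_val e) = 1"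
  by (rule max_group_class_idem[OF idem_val_idem])

lemma ran_idem_mult: "dom_idem (star (s * t)) = conj_idem (star s) (dom_idem (star t))"
  by (simp add: star_mult dom_idem_mult)

lemma E_unitary_class_one:
  assumes "E_unitary TYPE('s::inverse_semigroup)"
  shows "max_group_class (s :: 's) = 1 \<longleftrightarrow> s * s = s"
  using assms unfolding E_unitary_def idempotents_def by blast

text \<open>The element \<open>s * star t\<close> has trivial class, hence is an idempotent
  \<open>e\<close> with \<open>s = e * t\<close>; equality of the domain idempotents then makes
  \<open>e\<close> absorb into \<open>t\<close>.\<close>

lemma E_unitary_eqI:
  fixes s t :: "'s::inverse_semigroup"
  assumes E: "E_unitary TYPE('s)" and c: "max_group_class s = max_group_class t"
    and d: "dom_idem s = dom_idem t"
  shows "s = t"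
proof -
  have st: "star s * s = star t * t" using d by (metis dom_idem.rep_eq)
  define e where "e = s * star t"
  have e: "e * e = e"
    unfolding E_unitary_class_one[OF E, symmetric] e_def
    by (simp add: max_group_class_mult max_group_class_star c mg_right_inverse)
  have s: "s = e * t" unfolding e_def by (metis mult.assoc st star_props(1))
  then have "star s = star t * e" by (simp add: star_mult star_idem[OF e])
  then have "star t * (e * t) = star t * t"
    using s st e by (metis mult.assoc)
  then have "t * (star t * (e * t)) = t" by simp
  moreover have "t * (star t * (e * t)) = e * t"
    using conj_idem_aux(2)[OF e, of t] by (simp add: mult.assoc)
  ultimately show ?thesis using s by simp
qed

text \<open>Restricted to their common domain, two elements of one class become equal. So the maps
  \<open>beta s\<close> and \<open>beta t\<close> agree where both are defined, and their union is a
  function.\<close>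

lemma E_unitary_compat:
  fixes s t :: "'s::inverse_semigroup"
  assumes E: "E_unitary TYPE('s)" and c: "max_group_class s = max_group_class t"
  shows "conj_idem s e * (dom_idem s * dom_idem t) = conj_idem t e * (dom_idem s * dom_idem t)"
proof -
  define f where "f = dom_idem s * dom_idem t"
  have ds: "dom_idem (u * idem_val f) = dom_idem u * f" for u :: 's
    by (simp add: dom_idem_mult conj_idem_val mult.commute)
  have "s * idem_val f = t * idem_val f"
  proof (rule E_unitary_eqI[OF E])
    show "max_group_class (s * idem_val f) = max_group_class (t * idem_val f)"
      by (simp add: max_group_class_mult c)
    have "dom_idem s * f = f" "dom_idem t * f = f"
      unfolding f_def by (simp_all add: mult.left_commute flip: mult.assoc)
    then show "dom_idem (s * idem_val f) = dom_idem (t * idem_val f)" by (simp add: ds)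
  qed
  then have "conj_idem (idem_val f) (conj_idem s e) = conj_idem (idem_val f) (conj_idem t e)"
    by (simp flip: conj_idem_conj_idem)
  then show ?thesis by (simp add: conj_idem_val mult.commute flip: f_def)
qed

section \<open>The partial homeomorphisms and their union over a class\<close>

lemma mem_beta: "(\<phi>, \<psi>) \<in> beta s \<longleftrightarrow>
    char_fun \<phi> (dom_idem s) \<and> (\<forall>e. char_fun \<psi> e \<longleftrightarrow> char_fun \<phi> (conj_idem s e))"
  by (simp add: beta_def)

lemma beta_star_imp: "(\<phi>, \<psi>) \<in> beta s \<Longrightarrow> (\<psi>, \<phi>) \<in> beta (star s)"
proof -
  assume "(\<phi>, \<psi>) \<in> beta s"
  then have d: "char_fun \<phi> (dom_idem s)" and \<psi>: "\<And>e. char_fun \<psi> e \<longleftrightarrow> char_fun \<phi> (conj_idem s e)"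
    by (auto simp: mem_beta)
  have "char_fun \<phi> e \<longleftrightarrow> char_fun \<phi> (conj_idem s (conj_idem (star s) e))" for e
    using conj_idem_star[of "star s" e] d by simp
  then show ?thesis unfolding mem_beta using d by (simp add: \<psi> conj_idem_ran)
qed

lemma beta_star: "(\<psi>, \<phi>) \<in> beta (star s) \<longleftrightarrow> (\<phi>, \<psi>) \<in> beta s"
  using beta_star_imp[of \<psi> \<phi> "star s"] beta_star_imp[of \<phi> \<psi> s] by auto

lemma beta_total:
  assumes d: "char_fun \<phi> (dom_idem s)" shows "\<exists>\<psi>. (\<phi>, \<psi>) \<in> beta s"
proof -
  let ?f = "\<lambda>e. char_fun \<phi> (conj_idem s e)"
  have "?f (dom_idem (star s))" using d by (simp add: conj_idem_ran)
  then have "char_fun (Abs_spectrum ?f) = ?f"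
    by (intro Abs_spectrum_inverse) (auto simp: conj_idem_mult)
  then have "(\<phi>, Abs_spectrum ?f) \<in> beta s" using d by (simp add: mem_beta)
  then show ?thesis ..
qed

lemma beta_comp: "(\<phi>, \<psi>) \<in> beta t \<Longrightarrow> (\<psi>, \<omega>) \<in> beta s \<Longrightarrow> (\<phi>, \<omega>) \<in> beta (s * t)"
  by (simp add: mem_beta conj_idem_conj_idem dom_idem_mult)

lemma beta_ran: "(\<phi>, \<psi>) \<in> beta s \<Longrightarrow> char_fun \<psi> (dom_idem (star s))"
  by (simp add: mem_beta conj_idem_ran)

lemma mem_theta: "(\<phi>, \<psi>) \<in> theta g \<longleftrightarrow> (\<exists>s. max_group_class s = g \<and> (\<phi>, \<psi>) \<in> beta s)"
  by (auto simp: theta_def)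

lemma theta_inverse_iff: "(\<phi>, \<psi>) \<in> theta (inverse g) \<longleftrightarrow> (\<psi>, \<phi>) \<in> theta g"
proof -
  have "(\<psi>, \<phi>) \<in> theta (inverse g)" if "(\<phi>, \<psi>) \<in> theta g" for g :: "'a max_group" and \<phi> \<psi>
    using that beta_star max_group_class_star unfolding mem_theta by metis
  from this[of \<phi> \<psi> "inverse g"] this[of \<psi> \<phi> g] show ?thesis by auto
qed

lemma theta_comp: "(\<phi>, \<psi>) \<in> theta h \<Longrightarrow> (\<psi>, \<omega>) \<in> theta g \<Longrightarrow> (\<phi>, \<omega>) \<in> theta (g * h)"
  unfolding mem_theta using beta_comp max_group_class_mult by metis

lemma pa_dom_theta: "\<psi> \<in> pa_dom theta g \<longleftrightarrow> (\<exists>\<phi>. (\<phi>, \<psi>) \<in> theta g)"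
  unfolding pa_dom_def Domain_iff theta_inverse_iff ..

text \<open>An ideal of the semilattice whose sets \<open>spectrum_D e\<close> cover the open set
  attached to \<open>g\<close>; it turns questions about that set into questions about
  idempotents.\<close>

definition ran_idems :: "'s::inverse_semigroup max_group \<Rightarrow> 's idem set" where
  "ran_idems g = {dom_idem (star s) | s. max_group_class s = g}"

lemma pa_dom_ran_idems: "pa_dom theta g = (\<Union>e\<in>ran_idems g. spectrum_D e)"
proof -
  have "(\<exists>\<phi>. (\<phi>, \<psi>) \<in> theta g) \<longleftrightarrow> (\<exists>s. max_group_class s = g \<and> char_fun \<psi> (dom_idem (star s)))" for \<psi>
    unfolding mem_theta using beta_ran beta_total[of \<psi> "star _"] beta_star by metis
  then have "\<psi> \<in> pa_dom theta g \<longleftrightarrow> (\<exists>e\<in>ran_idems g. char_fun \<psi> e)" for \<psi>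
    unfolding pa_dom_theta ran_idems_def by blast
  then show ?thesis by auto
qed

lemma ran_idems_ideal: "e \<in> ran_idems g \<Longrightarrow> e * a \<in> ran_idems g"
proof -
  assume "e \<in> ran_idems g"
  then obtain s where s: "max_group_class s = g" "e = dom_idem (star s)" by
      (auto simp: ran_idems_def)
  have "e * a = dom_idem (star (idem_val a * s))"
    by (simp add: s ran_idem_mult conj_idem_val mult.commute)
  moreover have "max_group_class (idem_val a * s) = g" by (simp add: max_group_class_mult s)
  ultimately show ?thesis unfolding ran_idems_def by blast
qed

text \<open>Where \<open>beta s\<close> is defined it computes the whole union: the class member
  that witnesses the pair agrees with \<open>s\<close> on the common domain.\<close>

lemma theta_compat:
  assumes E: "E_unitary TYPE('s::inverse_semigroup)"
    and th: "(\<phi>, \<psi>) \<in> theta (max_group_class s)" and d: "char_fun \<phi> (dom_idem (s :: 's))"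
  shows "(\<phi>, \<psi>) \<in> beta s"
proof -
  obtain t where t: "max_group_class t = max_group_class s" "(\<phi>, \<psi>) \<in> beta t"
    using th unfolding mem_theta by blast
  have "char_fun \<phi> (conj_idem s e) \<longleftrightarrow> char_fun \<phi> (conj_idem t e)" for e
    using arg_cong[OF E_unitary_compat[OF E t(1)[symmetric], of e], of "char_fun \<phi>"] d t(2)
    by (simp add: mem_beta)
  then show ?thesis using t(2) d by (simp add: mem_beta)
qed

lemma beta_functional: "(\<phi>, \<psi>) \<in> beta s \<Longrightarrow> (\<phi>, \<psi>') \<in> beta s \<Longrightarrow> \<psi> = \<psi>'"
  by (rule spectrum_eqI) (simp add: mem_beta)

lemma theta_functional:
  assumes E: "E_unitary TYPE('s::inverse_semigroup)"
    and "(\<phi>, \<psi>) \<in> theta g" "(\<phi>, \<psi>') \<in> theta (g :: 's max_group)"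
  shows "\<psi> = \<psi>'"
proof -
  obtain s where s: "max_group_class s = g" "(\<phi>, \<psi>) \<in> beta s" using assms(2) unfolding mem_theta
    by blast
  have "(\<phi>, \<psi>') \<in> beta s" using s assms(3) by (intro theta_compat[OF E]) (auto simp: mem_beta)
  then show ?thesis using s(2) beta_functional by blast
qed

text \<open>The partial automorphism of the inverse of \<open>h\<close>, that is composition with
  \<open>theta h\<close>, extended by zero to characters outside the domain of
  \<open>theta h\<close>.\<close>

definition pull :: "'s::inverse_semigroup max_group \<Rightarrow> ('s spectrum \<Rightarrow> complex) \<Rightarrow> 's spectrum \<Rightarrow>
    complex" where
  "pull h = pa_alpha theta (inverse h)"

lemma pull_outside: "(\<And>\<psi>. (\<phi>, \<psi>) \<notin> theta h) \<Longrightarrow> pull h f \<phi> = 0"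
  by (simp add: pull_def pa_alpha_def pa_dom_theta theta_inverse_iff)

locale e_unitary =
  fixes ty :: "'s::{inverse_semigroup, countable} itself"
  assumes E: "E_unitary TYPE('s)"
begin

lemma pull_theta:
  assumes "(\<phi>, \<psi>) \<in> theta (h :: 's max_group)" shows "pull h f \<phi> = f \<psi>"
proof -
  have "(THE y. (y, \<phi>) \<in> theta (inverse h)) = \<psi>"
    by (rule the_equality) (use assms theta_functional[OF E] in \<open>auto simp: theta_inverse_iff\<close>)
  moreover have "\<phi> \<in> pa_dom theta (inverse h)"
    using assms by (auto simp: pa_dom_theta theta_inverse_iff)
  ultimately show ?thesis by (simp add: pull_def pa_alpha_def)
qed

lemma pull_cases:
  obtains (inside) \<psi> where "(\<phi>, \<psi>) \<in> theta (h :: 's max_group)" "\<And>f. pull h f \<phi> = f \<psi>"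
  | (outside) "\<And>\<psi>. (\<phi>, \<psi>) \<notin> theta h" "\<And>f. pull h f \<phi> = 0"
  using pull_theta pull_outside by metis

lemma
  fixes h :: "'s max_group"
  shows pull_add: "pull h (\<lambda>x. f x + g x) \<phi> = pull h f \<phi> + pull h g \<phi>"
    and pull_scale: "pull h (\<lambda>x. c * f x) \<phi> = c * pull h f \<phi>"
    and pull_mult: "pull h (\<lambda>x. f x * g x) \<phi> = pull h f \<phi> * pull h g \<phi>"
    and pull_cnj: "pull h (\<lambda>x. cnj (f x)) \<phi> = cnj (pull h f \<phi>)"
  by (cases rule: pull_cases[where \<phi>=\<phi> and h=h]; simp)+

lemma pull_bound:
  fixes h :: "'s max_group"
  assumes B: "\<And>x. cmod (f x) \<le> B" shows "cmod (pull h f \<phi>) \<le> B"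
proof (cases rule: pull_cases[where \<phi>=\<phi> and h=h])
  case (inside \<psi>)
  then show ?thesis using B by simp
next
  case outside
  have "0 \<le> B" using order_trans[OF norm_ge_zero B[of undefined]] .
  then show ?thesis using outside(2) by simp
qed

text \<open>An idempotent below \<open>s * star s\<close> defines a set inside the range of
  \<open>beta s\<close>, so there \<open>theta h\<close> may be replaced by \<open>beta s\<close> in
  both directions.\<close>

lemma pull_chi:
  assumes "e = dom_idem (star s) * e" "max_group_class s = (h :: 's max_group)"
  shows "pull h (chi e) = chi (conj_idem s e)"
proof
  fix \<phi>
  have le: "char_fun \<psi> e \<Longrightarrow> char_fun \<psi> (dom_idem (star s))" for \<psi> using assms(1) char_fun_mult
    by metis
  have dom: "char_fun \<phi> (conj_idem s e) \<Longrightarrow> char_fun \<phi> (dom_idem s)"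
    using dom_conj_idem char_fun_mult by metis
  show "pull h (chi e) \<phi> = chi (conj_idem s e) \<phi>"
  proof (cases rule: pull_cases[where \<phi>=\<phi> and h=h])
    case (inside \<psi>)
    have "char_fun \<psi> e \<longleftrightarrow> char_fun \<phi> (conj_idem s e)"
    proof
      assume e: "char_fun \<psi> e"
      have "(\<psi>, \<phi>) \<in> theta (max_group_class (star s))"
        using inside(1) by (simp add: max_group_class_star theta_inverse_iff assms(2))
      then have "(\<psi>, \<phi>) \<in> beta (star s)" using le[OF e] by (rule theta_compat[OF E])
      then have "(\<phi>, \<psi>) \<in> beta s" by (simp only: beta_star)
      then show "char_fun \<phi> (conj_idem s e)" using e by (simp add: mem_beta)
    next
      assume e: "char_fun \<phi> (conj_idem s e)"
      have "(\<phi>, \<psi>) \<in> beta s" using inside(1) dom[OF e] by (intro theta_compat[OF E])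
          (simp_all add: assms(2))
      then show "char_fun \<psi> e" using e by (simp add: mem_beta)
    qed
    then show ?thesis using inside(2) by (simp add: indicator_def)
  next
    case outside
    have "\<not> char_fun \<phi> (conj_idem s e)"
      using outside(1) dom beta_total assms(2) unfolding mem_theta by blast
    then show ?thesis using outside(2) by simp
  qed
qed

text \<open>Continuity of \<open>theta h\<close> is not treated directly: simple functions pull back
  to simple functions by \<open>pull_chi\<close>, and pulling back does not increase the supremum
  norm.\<close>

lemma pull_C0:
  fixes h :: "'s max_group"
  assumes f: "f \<in> C0 (pa_dom theta h)" shows "pull h f \<in> C0 UNIV"
proof (rule C0_approx)
  fix e :: real assume e: "0 < e"
  obtain g where g: "g \<in> simple_on (ran_idems h)" "\<And>\<phi>. cmod (f \<phi> - g \<phi>) < e"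
    using simple_on_dense[OF f _ ran_idems_ideal e] by (auto simp: pa_dom_ran_idems)
  obtain xs where xs: "snd ` set xs \<subseteq> ran_idems h" "g = (\<lambda>\<phi>. fsum (\<lambda>e. chi e \<phi>) xs)"
    using g(1) unfolding simple_on_def by blast
  have "pull h (\<lambda>\<phi>. fsum (\<lambda>e. chi e \<phi>) xs) \<in> C0 UNIV" using xs(1)
  proof (induction xs)
    case Nil
    have "pull h (\<lambda>\<phi>. 0) = (\<lambda>\<phi>. 0)" using pull_scale[of h 0 "\<lambda>_. 0"] by (simp add: fun_eq_iff)
    then show ?case by simp
  next
    case (Cons x xs)
    obtain c a where x: "x = (c, a)" by (cases x)
    obtain s where s: "max_group_class s = h" "a = dom_idem (star s)"
      using Cons.prems x by (auto simp: ran_idems_def)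
    have "pull h (chi a) \<in> C0 UNIV"
      using pull_chi[of a s h] s by (simp add: chi_C0_UNIV)
    then have "(\<lambda>\<phi>. c * pull h (chi a) \<phi> + pull h (\<lambda>\<phi>. fsum (\<lambda>e. chi e \<phi>) xs) \<phi>) \<in> C0 UNIV"
      using Cons by (intro C0_add C0_scale) auto
    moreover have "pull h (\<lambda>\<phi>. fsum (\<lambda>e. chi e \<phi>) (x # xs))
        = (\<lambda>\<phi>. c * pull h (chi a) \<phi> + pull h (\<lambda>\<phi>. fsum (\<lambda>e. chi e \<phi>) xs) \<phi>)"
      by (simp add: x pull_add pull_scale fun_eq_iff)
    ultimately show ?case by simp
  qed
  then have "pull h g \<in> C0 UNIV" by (simp add: xs(2))
  moreover have "cmod (pull h f \<phi> - pull h g \<phi>) < e" for \<phi>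
    by (cases rule: pull_cases[where \<phi>=\<phi> and h=h]) (use g(2) e in auto)
  ultimately show "\<exists>g\<in>C0 UNIV. \<forall>\<phi>. cmod (pull h f \<phi> - g \<phi>) < e" by blast
qed

text \<open>Countability of the semigroup lets one sequence list the ideal
  \<open>ran_idems h\<close>. \<open>from_nat_into\<close> may repeat elements, which is harmless
  for unions.\<close>

definition exhaustion :: "'s max_group \<Rightarrow> nat \<Rightarrow> 's spectrum set" where
  "exhaustion h n = (\<Union>i\<le>n. spectrum_D (from_nat_into (ran_idems h) i))"

lemma ran_idems_enum: "range (from_nat_into (ran_idems (h :: 's max_group))) = ran_idems h"
proof (rule range_from_nat_into)
  show "ran_idems h \<noteq> {}" using max_group_class_surj[of h] by (auto simp: ran_idems_def)
  have "ran_idems h = (\<lambda>s. dom_idem (star s)) ` {s. max_group_class s = h}" by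
      (auto simp: ran_idems_def)
  then show "countable (ran_idems h)" by (simp add: countableI_type)
qed

lemma exhaustion_simple: "indicator (exhaustion h n) \<in> simple_on (ran_idems h)"
proof (induction n)
  case 0
  show ?case using simple_on_chi[of "from_nat_into (ran_idems h) 0" "ran_idems h"]
      ran_idems_enum[of h]
    by (auto simp: exhaustion_def)
next
  case (Suc n)
  let ?f = "indicator (exhaustion h n) :: _ \<Rightarrow> complex" and ?e = "from_nat_into (ran_idems h)
      (Suc n)"
  have "?e \<in> ran_idems h" using ran_idems_enum by blast
  then have "(\<lambda>\<phi>. (?f \<phi> + (-1) * (?f \<phi> * chi ?e \<phi>)) + chi ?e \<phi>) \<in> simple_on (ran_idems h)"
    by (intro simple_on_add simple_on_scale simple_on_mult_chi[OF Suc ran_idems_ideal] Suc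
        simple_on_chi)
  moreover have "(\<lambda>\<phi>. (?f \<phi> + (-1) * (?f \<phi> * chi ?e \<phi>)) + chi ?e \<phi>)
      = indicator (exhaustion h (Suc n))"
    by (auto simp: exhaustion_def indicator_def atMost_Suc)
  ultimately show ?case by simp
qed

end

section \<open>Comparison of the two regular representations\<close>

lemma mg_inverse_mult_eq_self: "inverse g * h = h \<longleftrightarrow> g = (1 :: 'g::mult_group)"
proof
  assume "inverse g * h = h"
  then have "g * h = h" using mg_left_cancel'[of g h] by simp
  then have "g * h * inverse h = 1" by (simp add: mg_right_inverse)
  then show "g = 1" by (simp add: mult.assoc mg_right_inverse)
next
  assume "g = 1"
  moreover have "inverse 1 = (1 :: 'g)" using mg_right_inverse[of "1 :: 'g"] by simp
  ultimately show "inverse g * h = h" by simp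
qed

lemma scale_op_zero_left [simp]: "scale_op 0 T = 0"
  by (rule blinfun_eqI) simp

context op_rep
begin

text \<open>Index \<open>n\<close> stands for the power n + 1 of the formal adjoint times
  \<open>xs\<close>: without a unit in the semigroup there need not be a formal zeroth
  power.\<close>

primrec fpower :: "(complex \<times> 'i) list \<Rightarrow> nat \<Rightarrow> (complex \<times> 'i) list" where
  "fpower xs 0 = fmult (fstar st xs) xs"
| "fpower xs (Suc n) = fmult (fmult (fstar st xs) xs) (fpower xs n)"

lemma lin_fpower:
  "blinfun_apply (lin v (fpower xs n)) \<xi> = (blinfun_apply (adj_op (lin v xs) o\<^sub>L lin v xs) ^^ Suc
      n) \<xi>"
  by (induction n) (simp_all add: lin_fmult lin_fstar)

lemma norm_lin_fpower: "norm (lin v (fpower xs n)) \<le> ((norm (lin v xs))\<^sup>2) ^ Suc n"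
proof -
  have 1: "norm (adj_op (lin v xs) o\<^sub>L lin v xs) \<le> (norm (lin v xs))\<^sup>2"
    using norm_blinfun_compose[of "adj_op (lin v xs)" "lin v xs"]
      mult_right_mono[OF norm_adj_le[OF lin_complex_ops[of xs]] norm_ge_zero[of "lin v xs"]]
    by (simp add: power2_eq_square)
  show ?thesis
  proof (induction n)
    case 0 then show ?case using 1 by (simp add: lin_fmult lin_fstar)
  next
    case (Suc n)
    have "norm (lin v (fpower xs (Suc n)))
        \<le> norm (adj_op (lin v xs) o\<^sub>L lin v xs) * norm (lin v (fpower xs n))"
      using norm_blinfun_compose by (simp add: lin_fmult lin_fstar)
    also have "\<dots> \<le> (norm (lin v xs))\<^sup>2 * ((norm (lin v xs))\<^sup>2) ^ Suc n"
      by (intro mult_mono 1 Suc) auto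
    finally show ?case by simp
  qed
qed

end

text \<open>The squared norm of S^k \<xi> is the coefficient of S^(2k) at \<open>\<xi>\<close>. The
  bound \<open>C\<close> applied to this formal power, whose norm in \<open>w\<close> is at most the
  norm of \<open>lin w xs\<close> to the power 4k, gives the growth required by
  \<open>norm_le_by_growth\<close>.\<close>

lemma norm_lin_le_if_coefficients:
  fixes v :: "'i::semigroup_mult \<Rightarrow> 'h::complex_hilbert op"
    and w :: "'i \<Rightarrow> 'k::complex_hilbert op"
  assumes v: "op_rep v st" and w: "op_rep w st" and D: "closure (cspan D) = UNIV"
    and C: "\<And>\<xi>. \<xi> \<in> D \<Longrightarrow> \<exists>C. \<forall>ys. cmod (cinner (blinfun_apply (lin v ys) \<xi>) \<xi>) \<le> C * norm (lin w ys)"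
  shows "norm (lin v xs) \<le> norm (lin w xs)"
proof -
  interpret v: op_rep v st by (rule v)
  interpret w: op_rep w st by (rule w)
  define S where "S = adj_op (lin v xs) o\<^sub>L lin v xs"
  have sa: "cinner (blinfun_apply S x) y = cinner x (blinfun_apply S y)" for x y
    by (simp add: S_def cinner_adj[OF v.lin_complex_ops] cinner_adj'[OF v.lin_complex_ops])
  have pow: "cinner ((blinfun_apply S ^^ m) x) ((blinfun_apply S ^^ n) y)
      = cinner ((blinfun_apply S ^^ (n + m)) x) y" for m n x y
  proof (induction n arbitrary: m)
    case (Suc n)
    from Suc[of "Suc m"] show ?case by (simp add: sa)
  qed simp
  define M where "M = norm (lin w xs)"
  have "\<exists>C. \<forall>k. norm ((blinfun_apply S ^^ k) \<xi>) \<le> C * (M\<^sup>2) ^ k" if \<xi>: "\<xi> \<in> D" for \<xi>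
  proof -
    obtain C where C: "\<And>ys. cmod (cinner (blinfun_apply (lin v ys) \<xi>) \<xi>) \<le> C * norm (lin w ys)"
      using C[OF \<xi>] by blast
    \<comment> \<open>The maximum also covers exponent 0, where the coefficient is the squared norm
      of \<open>\<xi>\<close> and no formal power represents the operator.\<close>
    define C' where "C' = max C ((norm \<xi>)\<^sup>2)"
    have C0: "0 \<le> C'" "C \<le> C'" "(norm \<xi>)\<^sup>2 \<le> C'" by (auto simp: C'_def le_max_iff_disj)
    have "(norm ((blinfun_apply S ^^ k) \<xi>))\<^sup>2 \<le> (sqrt C' * (M\<^sup>2) ^ k)\<^sup>2" for k
    proof (cases k)
      case 0
      then show ?thesis using C0 by simp
    next
      case (Suc n)
      \<comment> \<open>With \<open>k = Suc n\<close> this index makes \<open>fpower\<close> the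
        power 2k.\<close>
      define l where "l = k + n"
      have kk: "k + k = Suc l" using Suc by (simp add: l_def)
      have "(norm ((blinfun_apply S ^^ k) \<xi>))\<^sup>2 = Re (cinner ((blinfun_apply S ^^ (k + k)) \<xi>) \<xi>)"
        unfolding norm_square_cinner pow ..
      also have "\<dots> = Re (cinner (blinfun_apply (lin v (v.fpower xs l)) \<xi>) \<xi>)"
        unfolding v.lin_fpower kk S_def ..
      also have "\<dots> \<le> C * norm (lin w (v.fpower xs l))"
        using C complex_Re_le_cmod order_trans by blast
      also have "\<dots> \<le> C' * norm (lin w (v.fpower xs l))"
        by (intro mult_right_mono C0) simp
      also have "\<dots> \<le> C' * (M\<^sup>2) ^ Suc l"
        unfolding M_def by (intro mult_left_mono w.norm_lin_fpower C0)
      also have "\<dots> = (sqrt C' * (M\<^sup>2) ^ k)\<^sup>2"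
        using C0(1) by (simp add: power_mult_distrib kk[symmetric] power_add power2_eq_square)
      finally show ?thesis .
    qed
    then have "norm ((blinfun_apply S ^^ k) \<xi>) \<le> sqrt C' * (M\<^sup>2) ^ k" for k
      by (rule power2_le_imp_le) (use C0(1) in simp)
    then show ?thesis by blast
  qed
  then show ?thesis
    unfolding M_def S_def by (intro norm_le_by_growth[OF v.lin_complex_ops D]) auto
qed

section \<open>The left regular representation\<close>

lemma star_mult_inj_on_ran:
  fixes s :: "'s::inverse_semigroup"
  assumes "s * star s * u = u" "s * star s * v = v" "star s * u = star s * v"
  shows "u = v"
proof -
  have "u = s * (star s * u)" using assms(1) by (simp only: mult.assoc)
  also have "\<dots> = v" unfolding assms(3) using assms(2) by (simp only: mult.assoc)
  finally show ?thesis .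
qed

text \<open>The operator is rewritten in output coordinates: \<open>u\<close> is reached exactly
  when \<open>s * star s * u = u\<close>, and then from \<open>star s * u\<close>. Totality of the
  basis vectors gives the uniqueness required by \<open>THE\<close>.\<close>

lemma left_regular_shift:
  fixes s :: "'s::inverse_semigroup"
  shows "left_regular_op s
    = weighted_shift (\<lambda>u. if s * star s * u = u then id_blinfun else 0) (\<lambda>u. star s * u)"
    and left_regular_apply: "ell2_fun (blinfun_apply (left_regular_op s) \<xi>) u
      = (if s * star s * u = u then ell2_fun \<xi> (star s * u) else 0)"
    and left_regular_complex: "left_regular_op s \<in> complex_ops"
proof -
  define A where "A u = (if s * star s * u = u then id_blinfun else 0 :: complex op)" for u
  define L where "L = weighted_shift A (\<lambda>u. star s * u)"
  have A: "norm (A u) \<le> 1" for u by (simp add: A_def norm_blinfun_id_le)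
  have inj: "inj_on (\<lambda>u. star s * u) {u. A u \<noteq> 0}"
    by (rule inj_onI, rule star_mult_inj_on_ran) (auto simp: A_def split: if_splits)
  have L: "ell2_fun (blinfun_apply L \<xi>) u = (if s * star s * u = u then ell2_fun \<xi> (star s * u)
      else 0)" for \<xi> u
    unfolding L_def by (subst weighted_shift_apply[OF A inj]) (simp add: A_def)
  have Lc: "L \<in> complex_ops"
    unfolding L_def by (rule weighted_shift_complex[OF A inj]) (simp add: A_def complex_ops_def)
  have Ld: "blinfun_apply L (ell2_delta t) = (if star s * s * t = t then ell2_delta (s * t) else
      0)" for t
  proof (rule ell2_eqI)
    fix u
    have "s * star s * u = u \<and> star s * u = t \<longleftrightarrow> star s * s * t = t \<and> u = s * t"
      by (auto simp: mult.assoc)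
    then show "ell2_fun (blinfun_apply L (ell2_delta t)) u
        = ell2_fun (if star s * s * t = t then ell2_delta (s * t) else 0) u"
      by (auto simp: L ell2_delta.rep_eq zero_ell2.rep_eq)
  qed
  have "left_regular_op s = L"
    unfolding left_regular_op_def
  proof (rule the_equality)
    show "L \<in> complex_ops \<and> (\<forall>t. blinfun_apply L (ell2_delta t) = (if star s * s * t
        = t then ell2_delta (s * t) else 0))"
      using Lc Ld by simp
    fix T assume T: "T \<in> complex_ops \<and> (\<forall>t. blinfun_apply T (ell2_delta t) = (if star s * s * t
        = t then ell2_delta (s * t) else 0))"
    show "T = L"
      by (rule ops_eq_on_total[OF _ Lc closure_cspan_deltas]) (use T Ld in auto)
  qed
  then show "left_regular_op s
    = weighted_shift (\<lambda>u. if s * star s * u = u then id_blinfun else 0) (\<lambda>u. star s * u)"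
    "ell2_fun (blinfun_apply (left_regular_op s) \<xi>) u
      = (if s * star s * u = u then ell2_fun \<xi> (star s * u) else 0)"
    "left_regular_op s \<in> complex_ops"
    using L Lc by (simp_all add: L_def A_def[abs_def])
qed

text \<open>Compares the support of the operator of a product with those of its factors; the forward
  direction rests on the commutation of the idempotents \<open>t * star t\<close> and
  \<open>star s * s\<close>.\<close>

lemma ran_mult_absorb_iff:
  fixes s t u :: "'s::inverse_semigroup"
  shows "s * t * star (s * t) * u = u \<longleftrightarrow> s * star s * u = u \<and> t * star t * (star s * u) = star s * u"
proof
  assume u: "s * t * star (s * t) * u = u"
  then have u': "s * (t * (star t * (star s * u))) = u" by (simp add: star_mult mult.assoc)
  have "s * star s * (s * z) = s * z" for z by (simp add: mult.assoc)
  from this[of "t * (star t * (star s * u))"] have 1: "s * star s * u = u" unfolding u' .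
  define p q w where "p = t * star t" and "q = star s * s" and "w = star s * u"
  have pp: "p * (p * z) = p * z" for z by (simp add: p_def mult.assoc)
  have pq: "p * (q * z) = q * (p * z)" for z
  proof -
    have "p * q = q * p" unfolding p_def q_def by (rule idem_commute) (rule star_mult_self_idem)+
    then show ?thesis by (metis mult.assoc)
  qed
  have w: "q * (p * w) = w"
    using arg_cong[OF u', of "(*) (star s)"] unfolding p_def q_def w_def by (simp add: mult.assoc)
  have "p * w = p * (q * (p * w))" unfolding w ..
  also have "\<dots> = w" unfolding pq pp by (rule w)
  finally have "t * star t * (star s * u) = star s * u" unfolding p_def w_def .
  then show "s * star s * u = u \<and> t * star t * (star s * u) = star s * u" using 1 by blast
next
  assume "s * star s * u = u \<and> t * star t * (star s * u) = star s * u"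
  then show "s * t * star (s * t) * u = u" by (metis mult.assoc star_mult)
qed

lemma op_rep_left_regular: "op_rep (left_regular_op :: 's::inverse_semigroup \<Rightarrow> _) star"
proof
  fix s t :: 's
  show "left_regular_op s \<in> complex_ops" by (rule left_regular_complex)
  show "left_regular_op (s * t) = left_regular_op s o\<^sub>L left_regular_op t"
  proof (rule blinfun_eqI, rule ell2_eqI)
    fix \<xi> u
    have "star (s * t) * u = star t * (star s * u)" by (simp add: star_mult mult.assoc)
    then show "ell2_fun (blinfun_apply (left_regular_op (s * t)) \<xi>) u
        = ell2_fun (blinfun_apply (left_regular_op s o\<^sub>L left_regular_op t) \<xi>) u"
      unfolding left_regular_apply ran_mult_absorb_iff blinfun_apply_blinfun_compose by simp
  qed
  define A where "A s u = (if s * star s * u = u then id_blinfun else 0 :: complex op)"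
      for s u :: 's
  have A: "norm (A s u) \<le> 1" for s u by (simp add: A_def norm_blinfun_id_le)
  have inj: "inj_on (\<lambda>u. star s * u) {u. A s u \<noteq> 0}" for s
    by (rule inj_onI, rule star_mult_inj_on_ran) (auto simp: A_def split: if_splits)
  have nz: "A s u \<noteq> 0 \<longleftrightarrow> s * star s * u = u" for s u
  proof -
    have "(id_blinfun :: complex op) \<noteq> 0"
    proof
      assume "(id_blinfun :: complex op) = 0"
      from arg_cong[OF this, of "\<lambda>T. blinfun_apply T 1"] show False by simp
    qed
    then show ?thesis by (simp add: A_def)
  qed
  have sh: "left_regular_op s = weighted_shift (A s) (\<lambda>u. star s * u)" for s
    unfolding left_regular_shift A_def ..
  have inv: "A (star s) (star s * u) \<noteq> 0 \<and> star (star s) * (star s * u) = u"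
    if "A s u \<noteq> 0" for s u
    using that unfolding nz by (simp add: mult.assoc)
  show "adj_op (left_regular_op s) = left_regular_op (star s)"
    unfolding sh
  proof (rule adj_weighted_shift[OF A inj A inj inv])
    fix u assume "A (star s) u \<noteq> 0"
    then show "A s (star (star s) * u) \<noteq> 0 \<and> star s * (star (star s) * u) = u"
      using inv[of "star s" u] by simp
  next
    fix u x y assume "A s u \<noteq> 0"
    then show "cinner (blinfun_apply (A s u) x) y
        = cinner x (blinfun_apply (A (star s) (star s * u)) y)"
      using inv[of s u] unfolding nz by (simp add: A_def)
  qed
qed

text \<open>The conditional expectation onto the span of the idempotents, evaluated at a character \<open>b\<close>.\<close>

definition diag :: "('s::inverse_semigroup idem \<Rightarrow> bool) \<Rightarrow> (complex \<times> 's) list \<Rightarrow> complex" where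
  "diag b = fsum (\<lambda>s. if s * s = s \<and> b (dom_idem s) then 1 else 0)"

lemma diag_cong:
  assumes "\<And>s. s \<in> snd ` set xs \<Longrightarrow> b (dom_idem s) = b' (dom_idem s)"
  shows "diag b xs = diag b' xs"
  using assms by (induction xs) (auto simp: diag_def)

lemma diag_C0: "(\<lambda>\<phi>. diag (char_fun \<phi>) xs) \<in> C0 UNIV"
proof (induction xs)
  case (Cons x xs)
  obtain c s where x: "x = (c, s)" by (cases x)
  let ?f = "\<lambda>\<phi>. (if s * s = s then c else 0) * chi (dom_idem s) \<phi>"
  have "(\<lambda>\<phi>. ?f \<phi> + diag (char_fun \<phi>) xs) \<in> C0 UNIV"
    by (intro C0_add C0_scale chi_C0_UNIV Cons)
  moreover have "(\<lambda>\<phi>. ?f \<phi> + diag (char_fun \<phi>) xs) = (\<lambda>\<phi>. diag (char_fun \<phi>) (x # xs))"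
    by (auto simp: x diag_def indicator_def)
  ultimately show ?case by simp
qed (simp add: diag_def)

context e_unitary
begin

text \<open>If \<open>s * t = t\<close>, the class of \<open>s\<close> is trivial by cancellation in
  the group, so \<open>s\<close> is idempotent because S is E-unitary. Diagonal coefficients
  therefore see only idempotents.\<close>

lemma fixed_iff:
  "star s * s * t = t \<and> s * t = t \<longleftrightarrow>
     s * s = s \<and> dom_idem s * dom_idem (star t) = dom_idem (star (t :: 's))"
proof
  assume st: "star s * s * t = t \<and> s * t = t"
  then have "max_group_class s * max_group_class t = max_group_class t"
    by (metis max_group_class_mult)
  then have "max_group_class s = 1" by (metis mg_right_inverse mult.assoc mult_1_right)
  then have s: "s * s = s" using E_unitary_class_one[OF E] by blast
  moreover have "dom_idem s * dom_idem (star t) = dom_idem (star t)"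
    by (rule idem_eqI) (use st in \<open>simp add: dom_idem.rep_eq times_idem.rep_eq flip: mult.assoc\<close>)
  ultimately show "s * s = s \<and> dom_idem s * dom_idem (star t) = dom_idem (star t)" by blast
next
  assume a: "s * s = s \<and> dom_idem s * dom_idem (star t) = dom_idem (star t)"
  then have ss: "star s = s" by (simp add: star_idem)
  have "star s * s * (t * star t) = t * star t"
    using arg_cong[OF conjunct2[OF a], of idem_val] by (simp add: dom_idem.rep_eq times_idem.rep_eq)
  then have "star s * s * t = t" by (metis mult.assoc star_props(1))
  then show "star s * s * t = t \<and> s * t = t" using a ss by simp
qed

text \<open>The predicate on the right is the principal character of \<open>t * star t\<close>, true
  on the idempotents above it; the coefficient at \<open>t\<close> is the value of the expectation
  there.\<close>

lemma left_regular_diag: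
  "ell2_fun (blinfun_apply (lin left_regular_op xs) (ell2_delta t)) t
    = diag (\<lambda>e. e * dom_idem (star t) = dom_idem (star (t :: 's))) xs"
proof (induction xs)
  case (Cons x xs)
  obtain c s where x: "x = (c, s)" by (cases x)
  \<comment> \<open>In output coordinates the condition for a coefficient is being fixed by
    \<open>star s\<close>; it is the same as being fixed by \<open>s\<close>.\<close>
  have "s * star s * t = t \<and> star s * t = t \<longleftrightarrow> star s * s * t = t \<and> s * t = t"
    by (metis mult.assoc star_props)
  then have "ell2_fun (blinfun_apply (left_regular_op s) (ell2_delta t)) t
      = (if s * s = s \<and> dom_idem s * dom_idem (star t) = dom_idem (star t) then 1 else 0)"
    unfolding fixed_iff[symmetric] by (auto simp: left_regular_apply ell2_delta.rep_eq)
  then show ?case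
    using Cons by (simp add: x diag_def plus_blinfun.rep_eq plus_ell2.rep_eq scaleC_ell2.rep_eq
        scaleC_complex_def)
qed (simp add: diag_def zero_ell2.rep_eq)

text \<open>Principal characters are dense in the spectrum.\<close>

lemma diag_le_norm_left_regular: "cmod (diag (char_fun \<phi>) xs)
    \<le> norm (lin (left_regular_op :: 's \<Rightarrow> _) xs)"
proof -
  obtain e1 where "char_fun \<phi> e1" using char_fun_nonzero by blast
  from char_fun_finite_meet[OF _ this, of "dom_idem ` snd ` set xs"] obtain e
    where e: "char_fun \<phi> (e1 * e)" "\<forall>a\<in>dom_idem ` snd ` set xs. char_fun \<phi> a \<longrightarrow> e1 * e * a = e1 * e"
    by auto
  \<comment> \<open>An idempotent basis vector whose principal character agrees with
    \<open>\<phi>\<close> on all domain idempotents occurring in \<open>xs\<close>.\<close>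
  define t where "t = idem_val (e1 * e)"
  have t: "dom_idem (star t) = e1 * e" by (simp only: t_def star_idem_val dom_idem_val)
  have "diag (char_fun \<phi>) xs = diag (\<lambda>a. a * dom_idem (star t) = dom_idem (star t)) xs"
  proof (rule diag_cong)
    fix s assume s: "s \<in> snd ` set xs"
    show "char_fun \<phi> (dom_idem s) = (dom_idem s * dom_idem (star t) = dom_idem (star t))"
      unfolding t using e s char_fun_mult by (metis imageI mult.commute)
  qed
  also have "\<dots> = ell2_fun (blinfun_apply (lin left_regular_op xs) (ell2_delta t)) t"
    by (rule left_regular_diag[symmetric])
  also have "cmod \<dots> \<le> norm (blinfun_apply (lin left_regular_op xs) (ell2_delta t))"
    by (rule norm_ell2_fun_le)
  also have "\<dots> \<le> norm (lin left_regular_op xs) * norm (ell2_delta t)" by (rule norm_blinfun)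
  finally show ?thesis by (simp add: ell2_delta_single norm_ell2_single)
qed

end

section \<open>The regular representation of the crossed product\<close>

locale covariant = e_unitary ty + C0_rep \<rho>
  for ty :: "'s::{inverse_semigroup, countable} itself"
    and \<rho> :: "('s spectrum \<Rightarrow> complex) \<Rightarrow> 'h::complex_hilbert op" +
  assumes inj: "inj_on \<rho> (C0 UNIV)"
begin

sublocale ideal: ideal_rep "pa_dom theta h" "\<lambda>f. \<rho> (pull h f)" "exhaustion h"
    for h :: "'s max_group"
proof
  fix f g :: "'s spectrum \<Rightarrow> complex" and c and B :: real and m n :: nat
  show "\<rho> (pull h f) \<in> complex_ops" if "f \<in> C0 (pa_dom theta h)"
    by (rule complex[OF pull_C0[OF that]])
  show "\<rho> (pull h (\<lambda>x. c * f x)) = scale_op c (\<rho> (pull h f))" if "f \<in> C0 (pa_dom theta h)"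
    unfolding pull_scale[abs_def] by (rule scale[OF pull_C0[OF that]])
  show "\<rho> (pull h (\<lambda>x. cnj (f x))) = adj_op (\<rho> (pull h f))" if "f \<in> C0 (pa_dom theta h)"
    unfolding pull_cnj[abs_def] by (rule star[OF pull_C0[OF that]])
  show "norm (\<rho> (pull h f)) \<le> B" if "f \<in> C0 (pa_dom theta h)" "\<And>x. cmod (f x) \<le> B"
    by (rule contractive[OF pull_C0[OF that(1)] pull_bound[OF that(2)]])
  show "\<rho> (pull h (\<lambda>x. f x + g x)) = \<rho> (pull h f) + \<rho> (pull h g)"
    if "f \<in> C0 (pa_dom theta h)" "g \<in> C0 (pa_dom theta h)"
    unfolding pull_add[abs_def] by (rule add[OF pull_C0[OF that(1)] pull_C0[OF that(2)]])
  show "\<rho> (pull h (\<lambda>x. f x * g x)) = \<rho> (pull h f) o\<^sub>L \<rho> (pull h g)"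
    if "f \<in> C0 (pa_dom theta h)" "g \<in> C0 (pa_dom theta h)"
    unfolding pull_mult[abs_def] by (rule mult[OF pull_C0[OF that(1)] pull_C0[OF that(2)]])
  show "indicator (exhaustion h n) \<in> C0 (pa_dom theta h)"
    by (rule simple_on_C0[OF exhaustion_simple]) (auto simp: pa_dom_ran_idems)
  show "exhaustion h m \<subseteq> exhaustion h n" if "m \<le> n" using that unfolding exhaustion_def
    by (meson UN_mono atMost_subset_iff order_refl)
  show "open (exhaustion h n)" unfolding exhaustion_def by (intro open_UN ballI open_spectrum_D)
  have "(\<Union>n. exhaustion h n) = (\<Union>i. spectrum_D (from_nat_into (ran_idems h) i))"
    unfolding exhaustion_def by blast
  also have "\<dots> = (\<Union>e\<in>range (from_nat_into (ran_idems h)). spectrum_D e)" by blast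
  finally show "(\<Union>n. exhaustion h n) = pa_dom theta h" unfolding ran_idems_enum pa_dom_ran_idems .
qed

abbreviation rep :: "'s max_group \<Rightarrow> ('s spectrum \<Rightarrow> complex) \<Rightarrow> 'h op" where
  "rep h \<equiv> ideal.ext h"

lemma pa_rep_eq:
  assumes a: "a \<in> C0 UNIV" shows "pa_rep theta \<rho> h a = rep h a"
  unfolding pa_rep_def
proof (rule the_equality)
  show "rep h a \<in> complex_ops \<and> (\<forall>F. approximate_unit (pa_dom theta h) F \<longrightarrow>
      (\<forall>\<xi>. ((\<lambda>e. blinfun_apply (\<rho> (pa_alpha theta (inverse h) (\<lambda>x. a x * e x))) \<xi>)
        \<longlongrightarrow> blinfun_apply (rep h a) \<xi>) F))"
    using ideal.ext_complex[OF a] ideal.ext_approximate_unit[OF a] unfolding pull_def by blast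
  fix T assume T: "T \<in> complex_ops \<and> (\<forall>F. approximate_unit (pa_dom theta h) F \<longrightarrow>
      (\<forall>\<xi>. ((\<lambda>e. blinfun_apply (\<rho> (pa_alpha theta (inverse h) (\<lambda>x. a x * e x))) \<xi>)
        \<longlongrightarrow> blinfun_apply T \<xi>) F))"
  show "T = rep h a"
    by (rule ideal.ext_eqI[OF a]) (use T in \<open>auto simp: pull_def\<close>)
qed

lemma rep_bounded:
  assumes a: "a \<in> C0 UNIV" obtains B where "\<And>h. norm (rep h a) \<le> B"
  using C0_bounded[OF a] ideal.norm_ext_le[OF a] by metis

abbreviation reg :: "'s max_group \<Rightarrow> ('s spectrum \<Rightarrow> complex) \<Rightarrow> ('s max_group, 'h) ell2 op" where
  "reg \<equiv> regular_rep theta \<rho>"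

lemma inj_left_mult: "inj_on (\<lambda>h. inverse g * h) (A :: 's max_group set)"
  by (rule inj_onI) (simp add: mg_mult_left_inj)

lemma regular_rep_apply:
  assumes a: "a \<in> C0 UNIV"
  shows regular_rep_eq: "reg g a = weighted_shift (\<lambda>h. rep h a) (\<lambda>h. inverse g * h)"
    and "ell2_fun (blinfun_apply (reg g a) \<xi>) h
      = blinfun_apply (rep h a) (ell2_fun \<xi> (inverse g * h))"
proof -
  obtain B where B: "\<And>h. norm (rep h a) \<le> B" using rep_bounded[OF a] by blast
  note W = weighted_shift_apply[where A="\<lambda>h. rep h a" and \<tau>="\<lambda>h. inverse g * h", OF B inj_left_mult]
  show eq: "reg g a = weighted_shift (\<lambda>h. rep h a) (\<lambda>h. inverse g * h)"
    unfolding regular_rep_def pa_rep_eq[OF a]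
  proof (rule the_equality)
    fix T assume T: "\<forall>\<xi> h. ell2_fun (blinfun_apply T \<xi>) h
        = blinfun_apply (rep h a) (ell2_fun \<xi> (inverse g * h))"
    show "T = weighted_shift (\<lambda>h. rep h a) (\<lambda>h. inverse g * h)"
      by (rule blinfun_eqI, rule ell2_eqI) (simp only: T W)
  qed (simp only: W, simp)
  show "ell2_fun (blinfun_apply (reg g a) \<xi>) h
      = blinfun_apply (rep h a) (ell2_fun \<xi> (inverse g * h))"
    unfolding eq by (rule W)
qed

lemma norm_regular_rep_le:
  assumes a: "a \<in> C0 UNIV" and B: "\<And>x. cmod (a x) \<le> B"
  shows "norm (reg g a) \<le> B"
  unfolding regular_rep_eq[OF a]
  by (rule norm_weighted_shift[OF ideal.norm_ext_le[OF a B] inj_left_mult])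

lemma regular_rep_add:
  assumes "a \<in> C0 UNIV" "b \<in> C0 UNIV"
  shows "reg g (\<lambda>x. a x + b x) = reg g a + reg g b"
  by (rule blinfun_eqI, rule ell2_eqI)
    (simp add: regular_rep_apply(2) assms C0_add ideal.ext_add plus_blinfun.rep_eq plus_ell2.rep_eq)

lemma regular_rep_scale:
  assumes "a \<in> C0 UNIV"
  shows "reg g (\<lambda>x. c * a x) = scale_op c (reg g a)"
  by (rule blinfun_eqI, rule ell2_eqI)
    (simp add: regular_rep_apply(2) assms C0_scale ideal.ext_scale scaleC_ell2.rep_eq)

text \<open>The existential form gives the value 0 also at characters that \<open>theta k\<close>
  does not move at all.\<close>

lemma pull_indicator:
  "pull k (\<lambda>x. chi e x * indicator (exhaustion k n) x) \<phi>
    = (if \<exists>\<psi>. (\<phi>, \<psi>) \<in> theta (k :: 's max_group) \<and> char_fun \<psi> e \<and> \<psi> \<in> exhaustion k n then 1 else 0)"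
proof (cases rule: pull_cases[where \<phi>=\<phi> and h=k])
  case (inside \<psi>)
  then have "(\<exists>\<psi>'. (\<phi>, \<psi>') \<in> theta k \<and> char_fun \<psi>' e \<and> \<psi>' \<in> exhaustion k n)
      \<longleftrightarrow> char_fun \<psi> e \<and> \<psi> \<in> exhaustion k n"
    using theta_functional[OF E] by blast
  then show ?thesis using inside(2) by (simp add: indicator_def)
qed simp

text \<open>\<open>T\<close> and \<open>T'\<close> are strong limits of projections onto increasing compact open sets exhausting
  the same open set of characters, and by compactness the two sequences are cofinal.\<close>

lemma rep_covariant_absorb:
  fixes s :: 's and k :: "'s max_group" and e :: "'s idem"
  assumes e: "dom_idem s * e = e"
  defines "T \<equiv> rep k (chi e)"
    and "T' \<equiv> rep (max_group_class s * k) (chi (conj_idem (star s) e))"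
  shows "T' o\<^sub>L T = T" "T o\<^sub>L T' = T"
proof -
  let ?g = "max_group_class s" and ?e = "conj_idem (star s) e"
  define f where "f n = pull k (\<lambda>x. chi e x * indicator (exhaustion k n) x)" for n
  define f' where "f' n = pull (?g * k) (\<lambda>x. chi ?e x * indicator (exhaustion (?g * k) n) x)" for n
  have C0: "f n \<in> C0 UNIV" "f' n \<in> C0 UNIV" for n
    unfolding f_def f'_def by (rule pull_C0[OF ideal.mult_u_C0[OF chi_C0_UNIV]])+
  have lim: "(\<lambda>n. blinfun_apply (\<rho> (f n)) \<xi>) \<longlonglongrightarrow> blinfun_apply T \<xi>"
    "(\<lambda>n. blinfun_apply (\<rho> (f' n)) \<xi>) \<longlonglongrightarrow> blinfun_apply T' \<xi>" for \<xi>
    unfolding f_def f'_def T_def T'_def by (rule ideal.ext_lim[OF chi_C0_UNIV])+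
  \<comment> \<open>\<open>?e\<close> is \<open>s * e * star s\<close>; conjugating back returns
    \<open>e\<close> because \<open>e\<close> lies below the domain idempotent of
    \<open>s\<close>.\<close>
  have cancel: "conj_idem s ?e = e" using conj_idem_star[of "star s" e] e by simp
  have f'_mono: "f' m \<phi> \<noteq> 0 \<Longrightarrow> m \<le> n \<Longrightarrow> f' n \<phi> = 1" for m n \<phi>
    using ideal.U_mono[of m n "?g * k"] unfolding f'_def pull_indicator by (auto split: if_splits)
  have cofinal: "\<exists>N. \<forall>m\<ge>N. \<forall>\<phi>. f n \<phi> * f' m \<phi> = f n \<phi>" for n
  proof -
    \<comment> \<open>A character sent by \<open>theta k\<close> into \<open>spectrum_D e\<close> is
      sent on by \<open>beta s\<close>, so \<open>theta (?g * k)\<close> takes it into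
      \<open>spectrum_D ?e\<close> and into some stage of the second exhaustion. The functions take
      only the values 0 and 1; the strict threshold 1/2 makes the covering sets open.\<close>
    have cover: "{\<phi>. 1 \<le> cmod (f n \<phi>)} \<subseteq> (\<Union>m\<in>UNIV. {\<phi>. 1/2 < cmod (f' m \<phi>)})"
    proof
      fix \<phi> assume "\<phi> \<in> {\<phi>. 1 \<le> cmod (f n \<phi>)}"
      then obtain \<psi> where \<psi>: "(\<phi>, \<psi>) \<in> theta k" "char_fun \<psi> e"
        unfolding f_def pull_indicator by (auto split: if_splits)
      then have "char_fun \<psi> (dom_idem s)" using e char_fun_mult by metis
      then obtain \<omega> where \<omega>: "(\<psi>, \<omega>) \<in> beta s" using beta_total by blast
      then have th: "(\<phi>, \<omega>) \<in> theta (?g * k)" using theta_comp[OF \<psi>(1)] mem_theta by blast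
      have "char_fun \<omega> ?e" using \<omega> \<psi>(2) cancel by (simp add: mem_beta)
      moreover obtain m where "\<omega> \<in> exhaustion (?g * k) m"
        using th ideal.U_cover[of "?g * k"] pa_dom_theta by blast
      ultimately have "f' m \<phi> = 1" unfolding f'_def pull_indicator using th by auto
      then show "\<phi> \<in> (\<Union>m\<in>UNIV. {\<phi>. 1/2 < cmod (f' m \<phi>)})" by (intro UN_I[of m]) auto
    qed
    have op: "open {\<phi>. 1/2 < cmod (f' m \<phi>)}" for m
      by (intro open_Collect_less continuous_intros C0_continuous[OF C0(2)])
    have cp: "compact {\<phi>. 1 \<le> cmod (f n \<phi>)}" by (rule C0_compact[OF C0(1)]) simp
    obtain C where "C \<subseteq> UNIV" and C: "finite C"
      "{\<phi>. 1 \<le> cmod (f n \<phi>)} \<subseteq> (\<Union>m\<in>C. {\<phi>. 1/2 < cmod (f' m \<phi>)})"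
      by (rule compactE_image[OF cp op cover])
    obtain N where N: "\<And>m. m \<in> C \<Longrightarrow> m \<le> N" using C(1) finite_nat_set_iff_bounded_le by auto
    have "f n \<phi> * f' m \<phi> = f n \<phi>" if "N \<le> m" for m \<phi>
    proof (cases "f n \<phi> = 0")
      case False
      then have "1 \<le> cmod (f n \<phi>)" unfolding f_def pull_indicator by (auto split: if_splits)
      then have "\<phi> \<in> (\<Union>m\<in>C. {\<phi>. 1/2 < cmod (f' m \<phi>)})" using C(2) by blast
      then obtain j where j: "j \<in> C" "1/2 < cmod (f' j \<phi>)" by blast
      then have "f' j \<phi> \<noteq> 0" by auto
      then have "f' m \<phi> = 1" using f'_mono N[OF j(1)] that order_trans by blast
      then show ?thesis by simp
    qed simp
    then show ?thesis by blast
  qed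
  have "blinfun_apply T' (blinfun_apply (\<rho> (f n)) \<xi>) = blinfun_apply (\<rho> (f n)) \<xi>"
    and "blinfun_apply (\<rho> (f n)) (blinfun_apply T' \<xi>) = blinfun_apply (\<rho> (f n)) \<xi>" for n \<xi>
  proof -
    obtain N where N: "\<And>m. N \<le> m \<Longrightarrow> (\<lambda>\<phi>. f n \<phi> * f' m \<phi>) = f n" using cofinal[of n] by blast
    have p: "\<rho> (f n) o\<^sub>L \<rho> (f' m) = \<rho> (f n)" "\<rho> (f' m) o\<^sub>L \<rho> (f n) = \<rho> (f n)" if "N \<le> m" for m
      using mult[OF C0(1)[of n] C0(2)[of m]] mult[OF C0(2)[of m] C0(1)[of n]] N[OF that]
      by (simp_all add: mult.commute)
    have p': "blinfun_apply (\<rho> (f n)) (blinfun_apply (\<rho> (f' m)) \<xi>) = blinfun_apply (\<rho> (f n)) \<xi>"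
      "blinfun_apply (\<rho> (f' m)) (blinfun_apply (\<rho> (f n)) \<xi>) = blinfun_apply (\<rho> (f n)) \<xi>"
          if "N \<le> m" for m
      using p[OF that] by (metis blinfun_apply_blinfun_compose)+
    have "(\<lambda>m. blinfun_apply (\<rho> (f' m)) (blinfun_apply (\<rho> (f n)) \<xi>)) \<longlonglongrightarrow> blinfun_apply (\<rho> (f n)) \<xi>"
      by (rule tendsto_eventually) (use p' in \<open>auto simp: eventually_sequentially\<close>)
    then show "blinfun_apply T' (blinfun_apply (\<rho> (f n)) \<xi>) = blinfun_apply (\<rho> (f n)) \<xi>"
      by (rule LIMSEQ_unique[OF lim(2)])
    have "(\<lambda>m. blinfun_apply (\<rho> (f n)) (blinfun_apply (\<rho> (f' m)) \<xi>)) \<longlonglongrightarrow> blinfun_apply (\<rho> (f n)) \<xi>"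
      by (rule tendsto_eventually) (use p' in \<open>auto simp: eventually_sequentially\<close>)
    then show "blinfun_apply (\<rho> (f n)) (blinfun_apply T' \<xi>) = blinfun_apply (\<rho> (f n)) \<xi>"
      by (rule LIMSEQ_unique[OF bounded_linear.tendsto[OF blinfun.bounded_linear_right lim(2)]])
  qed
  note absorb = this
  show "T' o\<^sub>L T = T"
  proof (rule blinfun_eqI)
    fix \<xi>
    have "(\<lambda>n. blinfun_apply (\<rho> (f n)) \<xi>) \<longlonglongrightarrow> blinfun_apply T' (blinfun_apply T \<xi>)"
      using bounded_linear.tendsto[OF blinfun.bounded_linear_right lim(1)[of \<xi>], of T']
        unfolding absorb(1) .
    then show "blinfun_apply (T' o\<^sub>L T) \<xi> = blinfun_apply T \<xi>"
      unfolding blinfun_apply_blinfun_compose by (rule LIMSEQ_unique[OF _ lim(1)])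
  qed
  show "T o\<^sub>L T' = T"
  proof (rule blinfun_eqI)
    fix \<xi>
    have "(\<lambda>n. blinfun_apply (\<rho> (f n)) \<xi>) \<longlonglongrightarrow> blinfun_apply T (blinfun_apply T' \<xi>)"
      using lim(1)[of "blinfun_apply T' \<xi>"] unfolding absorb(2) .
    then show "blinfun_apply (T o\<^sub>L T') \<xi> = blinfun_apply T \<xi>"
      unfolding blinfun_apply_blinfun_compose by (rule LIMSEQ_unique[OF _ lim(1)])
  qed
qed

text \<open>Absorption is applied to \<open>s\<close> and, from the other side, to
  \<open>star s\<close>; the same product then equals each of the two projections. This covariance
  makes the operators \<open>W\<close> multiplicative although \<theta> is only a partial
  action.\<close>

lemma rep_covariant:
  fixes s :: 's
  assumes e: "dom_idem s * e = e"
  shows "rep (max_group_class s * k) (chi (conj_idem (star s) e)) = rep k (chi e)"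
proof -
  let ?k = "max_group_class s * k" and ?e = "conj_idem (star s) e"
  have k: "max_group_class (star s) * ?k = k" by (simp add: max_group_class_star mg_left_cancel)
  have cancel: "conj_idem (star (star s)) ?e = e" using conj_idem_star[of "star s" e] e by simp
  have "rep ?k (chi ?e) o\<^sub>L rep k (chi e) = rep k (chi e)" by (rule rep_covariant_absorb(1)[OF e])
  moreover have "rep ?k (chi ?e) o\<^sub>L rep k (chi e) = rep ?k (chi ?e)"
    using rep_covariant_absorb(2)[OF dom_conj_idem[of "star s" e], of ?k] unfolding k cancel .
  ultimately show ?thesis by simp
qed

definition W :: "'s \<Rightarrow> ('s max_group, 'h) ell2 op" where
  "W s = reg (max_group_class s) (chi (dom_idem (star s)))"

lemma W_apply: "ell2_fun (blinfun_apply (W s) \<xi>) h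
    = blinfun_apply (rep h (chi (dom_idem (star s)))) (ell2_fun \<xi> (inverse (max_group_class s) *
        h))"
  unfolding W_def by (rule regular_rep_apply[OF chi_C0_UNIV])

lemma rep_chi_ran: "rep h (chi (dom_idem (star s))) = rep (inverse (max_group_class s) * h)
    (chi (dom_idem s))"
proof -
  have "dom_idem s * dom_idem s = dom_idem s" by simp
  from rep_covariant[OF this, of "inverse (max_group_class s) * h"]
  show ?thesis using conj_idem_ran[of "star s"] by (simp add: mg_left_cancel')
qed

lemma rep_chi_self_adj: "cinner (blinfun_apply (rep h (chi e)) x) y
    = cinner x (blinfun_apply (rep h (chi e)) y)"
proof -
  have "(\<lambda>x. cnj (chi e x)) = chi e" by (auto simp: indicator_def)
  then have "adj_op (rep h (chi e)) = rep h (chi e)"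
    using ideal.ext_star[OF chi_C0_UNIV, of h e] by simp
  then show ?thesis using cinner_adj[OF ideal.ext_complex[OF chi_C0_UNIV], of h e x y] by simp
qed

text \<open>For products, the projection of \<open>s * t\<close> at \<open>h\<close> is moved by
  covariance to the inverse of the class of \<open>s\<close> times \<open>h\<close>. There it splits
  into the projections of the domain of \<open>s\<close> and the range of \<open>t\<close>, and
  moving the former back to \<open>h\<close> gives the weight of \<open>W s\<close>.\<close>

lemma op_rep_W: "op_rep W star"
proof
  fix s t :: 's
  have B: "norm (rep h (chi e)) \<le> 1" for h e
    by (rule ideal.norm_ext_le[OF chi_C0_UNIV]) (simp add: indicator_def)
  have sh: "W s = weighted_shift (\<lambda>h. rep h (chi (dom_idem (star s)))) (\<lambda>h. inverse
      (max_group_class s) * h)" for s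
    unfolding W_def by (rule regular_rep_eq[OF chi_C0_UNIV])
  show "W s \<in> complex_ops"
    unfolding sh by (rule weighted_shift_complex[OF B inj_left_mult ideal.ext_complex[OF
        chi_C0_UNIV]])
  show "W (s * t) = W s o\<^sub>L W t"
  proof (rule blinfun_eqI, rule ell2_eqI)
    fix \<xi> h
    let ?g = "max_group_class s" and ?k = "max_group_class t"
    let ?h = "inverse ?g * h" and ?e = "dom_idem s * dom_idem (star t)"
    have "conj_idem (star s) ?e = conj_idem (star s) (dom_idem (star t))"
      using conj_idem_ran[of "star s"] by (simp add: conj_idem_mult dom_conj_idem)
    moreover have "dom_idem s * ?e = ?e" by (simp flip: mult.assoc)
    ultimately have "rep h (chi (dom_idem (star (s * t)))) = rep ?h (chi ?e)"
      using rep_covariant[of s ?e ?h] by (simp add: ran_idem_mult mg_left_cancel')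
    also have "chi ?e = (\<lambda>x. chi (dom_idem s) x * chi (dom_idem (star t)) x)"
      by (rule ext) (rule chi_mult)
    also have "rep ?h \<dots> = rep ?h (chi (dom_idem s)) o\<^sub>L rep ?h (chi (dom_idem (star t)))"
      by (rule ideal.ext_mult[OF chi_C0_UNIV chi_C0_UNIV])
    also have "rep ?h (chi (dom_idem s)) = rep h (chi (dom_idem (star s)))"
      by (rule rep_chi_ran[symmetric])
    finally show "ell2_fun (blinfun_apply (W (s * t)) \<xi>) h = ell2_fun (blinfun_apply (W s o\<^sub>L W t)
        \<xi>) h"
      by (simp add: W_apply max_group_class_mult mg_inverse_mult mult.assoc)
  qed
  show "adj_op (W s) = W (star s)"
    unfolding sh
  proof (rule adj_weighted_shift[OF B inj_left_mult B inj_left_mult])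
    fix h
    show "rep (inverse (max_group_class s) * h) (chi (dom_idem (star (star s)))) \<noteq> 0 \<and>
        inverse (max_group_class (star s)) * (inverse (max_group_class s) * h) = h"
      if "rep h (chi (dom_idem (star s))) \<noteq> 0"
      using that by (simp add: rep_chi_ran max_group_class_star mg_left_cancel')
    show "rep (inverse (max_group_class (star s)) * h) (chi (dom_idem (star s))) \<noteq> 0 \<and>
        inverse (max_group_class s) * (inverse (max_group_class (star s)) * h) = h"
      if "rep h (chi (dom_idem (star (star s)))) \<noteq> 0"
      using that rep_chi_ran[of h "star s"] by (simp add: max_group_class_star mg_left_cancel)
    show "cinner (blinfun_apply (rep h (chi (dom_idem (star s)))) x) y
        = cinner x (blinfun_apply (rep (inverse (max_group_class s) * h)
            (chi (dom_idem (star (star s))))) y)" for x y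
      using rep_chi_ran[of h s] by (simp add: rep_chi_self_adj)
  qed
qed

text \<open>Returning to the coordinate \<open>h\<close> forces the class of \<open>s\<close> to be
  trivial, hence \<open>s\<close> to be idempotent. What remains is the extended representation at
  \<open>h\<close>, applied to the expectation viewed as a function of the character.\<close>

lemma W_diag:
  "ell2_fun (blinfun_apply (lin W xs) (ell2_single h x)) h
    = blinfun_apply (rep h (\<lambda>\<phi>. diag (char_fun \<phi>) xs)) x"
proof (induction xs)
  case Nil
  have "rep h (\<lambda>x. 0 * 0) = scale_op 0 (rep h (\<lambda>x. 0))" by (rule ideal.ext_scale) simp
  then show ?case by (simp add: diag_def zero_ell2.rep_eq)
next
  case (Cons y xs)
  obtain c s where y: "y = (c, s)" by (cases y)
  let ?c = "if s * s = s then c else 0"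
  have "(\<lambda>\<phi>. diag (char_fun \<phi>) (y # xs)) = (\<lambda>\<phi>. ?c * chi (dom_idem s) \<phi> + diag (char_fun \<phi>) xs)"
    by (auto simp: y diag_def indicator_def)
  then have r: "rep h (\<lambda>\<phi>. diag (char_fun \<phi>) (y # xs))
      = scale_op ?c (rep h (chi (dom_idem s))) + rep h (\<lambda>\<phi>. diag (char_fun \<phi>) xs)"
    by (simp only: ideal.ext_add[OF C0_scale[OF chi_C0_UNIV] diag_C0] ideal.ext_scale[OF
        chi_C0_UNIV])
  have "inverse (max_group_class s) * h = h \<longleftrightarrow> s * s = s"
    unfolding E_unitary_class_one[OF E, symmetric] by (rule mg_inverse_mult_eq_self)
  then have "c *\<^sub>C ell2_fun (blinfun_apply (W s) (ell2_single h x)) h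
      = ?c *\<^sub>C blinfun_apply (rep h (chi (dom_idem s))) x"
    by (auto simp: W_apply ell2_single.rep_eq star_idem)
  then show ?case
    unfolding r using Cons
    by (simp add: y plus_blinfun.rep_eq plus_ell2.rep_eq scaleC_ell2.rep_eq)
qed

text \<open>Every character is fixed by an idempotent that it makes true, so the domain at 1 is the
  whole spectrum. Thus \<open>\<rho>\<close> itself reappears at the coordinate 1 of the crossed
  product.\<close>

lemma rep_one:
  assumes f: "f \<in> C0 UNIV" shows "rep 1 f = \<rho> f"
proof -
  have id: "(\<phi>, \<phi>) \<in> theta 1" for \<phi> :: "'s spectrum"
  proof -
    obtain e where e: "char_fun \<phi> e" using char_fun_nonzero by blast
    have "(\<phi>, \<phi>) \<in> beta (idem_val e)" using e by (simp add: mem_beta conj_idem_val)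
    then show ?thesis unfolding mem_theta by (intro exI[of _ "idem_val e"]) simp
  qed
  then have "pa_dom theta 1 = (UNIV :: 's spectrum set)" using pa_dom_theta by blast
  moreover have "pull 1 f = f" using pull_theta[OF id] by blast
  ultimately show ?thesis using ideal.ext_eq[of f 1] f by simp
qed

lemma norm_lin_eq: "norm (lin left_regular_op xs) = norm (lin W xs)"
proof (rule antisym)
  show "norm (lin left_regular_op xs) \<le> norm (lin W xs)"
  proof (rule norm_lin_le_if_coefficients[OF op_rep_left_regular op_rep_W closure_cspan_deltas])
    fix \<xi> :: "('s, complex) ell2" assume "\<xi> \<in> range ell2_delta"
    then obtain t where t: "\<xi> = ell2_delta t" by blast
    \<comment> \<open>The principal character of \<open>t * star t\<close>.\<close>
    let ?b = "\<lambda>e. e * dom_idem (star t) = dom_idem (star t)"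
    have "?b (e * f) \<longleftrightarrow> ?b e \<and> ?b f" for e f
    proof
      assume b: "?b (e * f)"
      have "?b e"
        using arg_cong[OF b, of "\<lambda>x. e * x"] b by (metis idem_idem mult.assoc)
      moreover have "?b f"
        using arg_cong[OF b, of "\<lambda>x. f * x"] b by (metis idem_idem mult.assoc mult.commute)
      ultimately show "?b e \<and> ?b f" ..
    qed (simp add: mult.assoc)
    moreover have "\<exists>e. ?b e" by (rule exI[of _ "dom_idem (star t)"]) simp
    ultimately have b: "char_fun (Abs_spectrum ?b) = ?b" by (intro Abs_spectrum_inverse) auto
    have "cmod (cinner (blinfun_apply (lin left_regular_op ys) \<xi>) \<xi>) \<le> norm (lin W ys)" for ys
    proof -
      let ?f = "\<lambda>\<phi>. diag (char_fun \<phi>) ys"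
      have "cinner (blinfun_apply (lin left_regular_op ys) \<xi>) \<xi> = ?f (Abs_spectrum ?b)"
        unfolding t b left_regular_diag[symmetric]
        by (subst (2) ell2_delta_single) (simp add: cinner_ell2_single cinner_complex_def)
      also have "cmod \<dots> \<le> norm (\<rho> ?f)"
        by (rule faithful_spectrum_rep_lower[OF _ inj diag_C0]) unfold_locales
      \<comment> \<open>By \<open>W_diag\<close> at 1, the operator on the left is the corner of
        \<open>lin W ys\<close> at that coordinate.\<close>
      also have "\<dots> \<le> norm (lin W ys)"
      proof (rule norm_blinfun_bound)
        fix x
        have "norm (blinfun_apply (\<rho> ?f) x)
            = norm (ell2_fun (blinfun_apply (lin W ys) (ell2_single 1 x)) 1)"
          unfolding W_diag rep_one[OF diag_C0] ..
        also have "\<dots> \<le> norm (blinfun_apply (lin W ys) (ell2_single 1 x))" by (rule norm_ell2_fun_le)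
        also have "\<dots> \<le> norm (lin W ys) * norm x" using norm_blinfun by (metis norm_ell2_single)
        finally show "norm (blinfun_apply (\<rho> ?f) x) \<le> norm (lin W ys) * norm x" .
      qed simp
      finally show ?thesis .
    qed
    then show "\<exists>C. \<forall>ys. cmod (cinner (blinfun_apply (lin left_regular_op ys) \<xi>) \<xi>)
        \<le> C * norm (lin W ys)"
      by (intro exI[of _ 1]) simp
  qed
  show "norm (lin W xs) \<le> norm (lin left_regular_op xs)"
  proof (rule norm_lin_le_if_coefficients[OF op_rep_W op_rep_left_regular closure_cspan_singles])
    fix \<xi> :: "('s max_group, 'h) ell2" assume "\<xi> \<in> range (\<lambda>(i, x). ell2_single i x)"
    then obtain h x where \<xi>: "\<xi> = ell2_single h x" by auto
    \<comment> \<open>The constant depends on the vector, as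
      \<open>norm_lin_le_if_coefficients\<close> permits. Here only contractivity of the extension
      at \<open>h\<close> is used, together with the fact that the left regular norm dominates every
      value of the expectation.\<close>
    have "cmod (cinner (blinfun_apply (lin W ys) \<xi>) \<xi>) \<le> (norm x)\<^sup>2 * norm (lin left_regular_op
        ys)" for ys
    proof -
      let ?r = "rep h (\<lambda>\<phi>. diag (char_fun \<phi>) ys)"
      have "cmod (cinner (blinfun_apply (lin W ys) \<xi>) \<xi>) = cmod (cinner (blinfun_apply ?r x) x)"
        unfolding \<xi> cinner_ell2_single W_diag ..
      also have "\<dots> \<le> norm (blinfun_apply ?r x) * norm x" by (rule cinner_bound)
      also have "\<dots> \<le> norm (lin left_regular_op ys) * norm x * norm x"
        by (intro mult_right_mono norm_blinfun_apply_le ideal.norm_ext_le[OF diag_C0]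
            diag_le_norm_left_regular) simp
      finally show ?thesis by (simp add: power2_eq_square mult_ac)
    qed
    then show "\<exists>C. \<forall>ys. cmod (cinner (blinfun_apply (lin W ys) \<xi>) \<xi>)
        \<le> C * norm (lin left_regular_op ys)"
      by blast
  qed
qed

section \<open>Identification of the crossed product with the closed span of
  \<open>W\<close>\<close>

definition finite_sums :: "('s max_group, 'h) ell2 op set" where
  "finite_sums = {\<Sum>g\<in>K. reg g (a g) | K a.
     finite K \<and> (\<forall>g\<in>K. a g \<in> C0 (pa_dom theta g))}"

lemma finite_sumsE:
  assumes "T \<in> finite_sums"
  obtains K a where "finite K" "\<forall>g\<in>K. a g \<in> C0 (pa_dom theta g)"
    "T = (\<Sum>g\<in>K. reg g (a g))"
  using assms unfolding finite_sums_def mem_Collect_eq by (elim exE conjE) (rule that)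

lemma finite_sums_add:
  assumes T: "T \<in> finite_sums" and b: "b \<in> C0 (pa_dom theta g)"
  shows "reg g b + T \<in> finite_sums"
proof -
  obtain K a where K: "finite K" "\<forall>g\<in>K. a g \<in> C0 (pa_dom theta g)"
    and T: "T = (\<Sum>g\<in>K. reg g (a g))"
    using T by (rule finite_sumsE)
  \<comment> \<open>A finite sum has one coefficient per group element, so the new coefficient is
    merged with the old one when \<open>g\<close> already occurs.\<close>
  define c where "c = a(g := (\<lambda>x. b x + (if g \<in> K then a g x else 0)))"
  have "c k \<in> C0 (pa_dom theta k)" if "k \<in> insert g K" for k
    using that K(2) b by (cases "g \<in> K") (auto simp: c_def intro: C0_add)
  moreover have "(\<Sum>k\<in>insert g K. reg k (c k)) = reg g b + T"
  proof -
    have rest: "(\<Sum>k\<in>K - {g}. reg k (c k)) = (\<Sum>k\<in>K - {g}. reg k (a k))"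
      by (rule sum.cong) (auto simp: c_def)
    have "(\<Sum>k\<in>insert g K. reg k (c k))
        = reg g (c g) + (\<Sum>k\<in>K - {g}. reg k (a k))"
      unfolding rest[symmetric] using K(1) by (rule sum.insert_remove)
    also have "\<dots> = reg g b + T"
    proof (cases "g \<in> K")
      case True
      then have "reg g (c g) = reg g b + reg g (a g)"
        using regular_rep_add[OF C0_UNIV[OF b] C0_UNIV[of "a g" "pa_dom theta g"]] K(2) by
            (simp add: c_def)
      then show ?thesis unfolding T by (simp add: sum.remove[OF K(1) True] add.assoc)
    qed (simp add: c_def T)
    finally show ?thesis .
  qed
  ultimately show ?thesis
    unfolding finite_sums_def using K(1)
    by (intro CollectI exI[of _ "insert g K"] exI[of _ c]) auto
qed

text \<open>Each idempotent of \<open>ran_idems g\<close> is the range idempotent of some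
  \<open>s\<close> of class \<open>g\<close>, and its indicator at \<open>g\<close> is then exactly
  \<open>W s\<close>. Density of simple functions and contractivity of \<open>reg g\<close> do the
  rest.\<close>

lemma regular_rep_in_closure:
  assumes a: "a \<in> C0 (pa_dom theta g)"
  shows "reg g a \<in> closure (range (lin W))"
  unfolding closure_approachable
proof (intro allI impI)
  fix e :: real assume e: "0 < e"
  then have "0 < e / 2" by simp
  from simple_on_dense[OF a _ ran_idems_ideal this] obtain c
    where c: "c \<in> simple_on (ran_idems g)" "\<And>\<phi>. cmod (a \<phi> - c \<phi>) < e / 2"
    by (auto simp: pa_dom_ran_idems)
  obtain ys where ys: "snd ` set ys \<subseteq> ran_idems g" "c = (\<lambda>\<phi>. fsum (\<lambda>e. chi e \<phi>) ys)"
    using c(1) unfolding simple_on_def by blast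
  have simp_C0: "(\<lambda>\<phi>. fsum (\<lambda>e. chi e \<phi>) ys) \<in> C0 UNIV" for ys :: "(complex \<times> 's idem) list"
    using sfun_C0[of ys] unfolding sfun_def[abs_def] .
  have "\<exists>xs. reg g (\<lambda>\<phi>. fsum (\<lambda>e. chi e \<phi>) ys) = lin W xs" using ys(1)
  proof (induction ys)
    case Nil
    have "reg g (\<lambda>x. 0 * 0) = scale_op 0 (reg g (\<lambda>x. 0))"
      by (rule regular_rep_scale) simp
    also have "\<dots> = 0" by (rule blinfun_eqI) simp
    finally show ?case by (intro exI[of _ "[]"]) simp
  next
    case (Cons y ys)
    obtain d e where y: "y = (d, e)" by (cases y)
    obtain xs where xs: "reg g (\<lambda>\<phi>. fsum (\<lambda>e. chi e \<phi>) ys) = lin W xs"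
      using Cons by auto
    obtain s where s: "max_group_class s = g" "e = dom_idem (star s)"
      using Cons.prems y by (auto simp: ran_idems_def)
    have Ws: "W s = reg g (chi e)" by (simp add: W_def s)
    have "reg g (\<lambda>\<phi>. fsum (\<lambda>e. chi e \<phi>) (y # ys)) = scale_op d (W s) + lin W xs"
      unfolding y fsum_simps
      by (simp only: regular_rep_add[OF C0_scale[OF chi_C0_UNIV] simp_C0]
          regular_rep_scale[OF chi_C0_UNIV] xs Ws)
    then show ?case by (intro exI[of _ "(d, s) # xs"]) simp
  qed
  then obtain xs where xs: "reg g c = lin W xs" using ys(2) by blast
  have c0: "c \<in> C0 UNIV" using simp_C0[of ys] ys(2) by simp
  have "norm (reg g (\<lambda>x. c x + (-1) * a x)) \<le> e / 2"
  proof (rule norm_regular_rep_le[OF C0_add[OF c0 C0_scale[OF C0_UNIV[OF a]]]])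
    show "cmod (c x + (-1) * a x) \<le> e / 2" for x
      using c(2)[of x] by (simp add: norm_minus_commute)
  qed
  then have "norm (lin W xs - reg g a) \<le> e / 2"
    by (simp only: regular_rep_add[OF c0 C0_scale[OF C0_UNIV[OF a]]] regular_rep_scale[OF
        C0_UNIV[OF a]]
        scale_op_minus_one xs add_uminus_conv_diff)
  then have "dist (lin W xs) (reg g a) < e" using e by (simp add: dist_norm)
  then show "\<exists>y\<in>range (lin W). dist y (reg g a) < e" by blast
qed

lemma closure_finite_sums: "closure finite_sums = closure (range (lin W))"
proof (rule antisym)
  interpret W: op_rep W star by (rule op_rep_W)
  have "T \<in> closure (range (lin W))" if T: "T \<in> finite_sums" for T
  proof -
    obtain K a where K: "finite K" "\<forall>g\<in>K. a g \<in> C0 (pa_dom theta g)"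
      and T: "T = (\<Sum>g\<in>K. reg g (a g))"
      using T by (rule finite_sumsE)
    have "(\<Sum>g\<in>K. reg g (a g)) \<in> closure (range (lin W))" using K
    proof (induction K)
      case empty
      have "lin W [] \<in> closure (range (lin W))" by (rule subsetD[OF closure_subset]) (rule rangeI)
      then show ?case by simp
    next
      case (insert g K)
      then show ?case by (simp add: W.closure_add regular_rep_in_closure)
    qed
    then show ?thesis using T by simp
  qed
  then show "closure finite_sums \<subseteq> closure (range (lin W))" by (intro closure_minimal) auto
  have "lin W xs \<in> finite_sums" for xs
  proof (induction xs)
    case Nil show ?case unfolding finite_sums_def by (intro CollectI exI[of _ "{}"]) simp
  next
    case (Cons x xs)
    obtain c s where x: "x = (c, s)" by (cases x)
    have "chi (dom_idem (star s)) \<in> C0 (pa_dom theta (max_group_class s))"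
      by (rule C0_restrict[OF chi_C0]) (auto simp: pa_dom_ran_idems ran_idems_def indicator_def)
    from finite_sums_add[OF Cons C0_scale[OF this, of c]]
    show ?case unfolding x lin_simps regular_rep_scale[OF chi_C0_UNIV] W_def[of s] .
  qed
  then show "closure (range (lin W)) \<subseteq> closure finite_sums" by (intro closure_mono) auto
qed

lemma reduced_iso: "reduced_cstar TYPE('s) \<cong>\<^sub>* reduced_crossed_product theta \<rho>"
  unfolding reduced_cstar_def reduced_crossed_product_def op_rep.cstar_generated_eq[OF
      op_rep_left_regular]
    finite_sums_def[symmetric] closure_finite_sums
  by (rule star_isomorphic_closures[OF op_rep_left_regular op_rep_W norm_lin_eq])

end

lemma star_hom_comp: "star_hom A B f \<Longrightarrow> star_hom B C g \<Longrightarrow> star_hom A C (g \<circ> f)"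
  unfolding star_hom_def by (simp add: image_subset_iff)

theorem theorem3p5:
  fixes \<pi> :: "'s::{inverse_semigroup, countable} universal_space op \<Rightarrow> 'h::complex_hilbert op"
  assumes "E_unitary TYPE('s)"
    and "faithful_rep (semilattice_cstar TYPE('s)) \<pi>"
  shows "reduced_cstar TYPE('s) \<cong>\<^sub>* semilattice_crossed_product \<pi>"
proof -
  have iso: "star_hom C0_algebra (semilattice_cstar TYPE('s)) spectral_iso"
    "bij_betw spectral_iso (C0 UNIV) (sa_carrier (semilattice_cstar TYPE('s)))"
    using spectral_iso unfolding star_iso_def by (auto simp: C0_algebra_def)
  have \<pi>: "star_hom (semilattice_cstar TYPE('s)) (op_algebra complex_ops) \<pi>"
    "inj_on \<pi> (sa_carrier (semilattice_cstar TYPE('s)))"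
    using assms(2) unfolding faithful_rep_def by auto
  interpret covariant "TYPE('s)" "\<pi> \<circ> spectral_iso"
  proof
    show "E_unitary TYPE('s)" by (rule assms(1))
    show "star_hom C0_algebra (op_algebra complex_ops) (\<pi> \<circ> spectral_iso)"
      by (rule star_hom_comp[OF iso(1) \<pi>(1)])
    show "inj_on (\<pi> \<circ> spectral_iso) (C0 UNIV)"
      using iso(2) \<pi>(2) by (intro comp_inj_on) (auto simp: bij_betw_def)
  qed
  show ?thesis unfolding semilattice_crossed_product_def by (rule reduced_iso)
qed

end
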